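(* Let $\alpha \in \mathbb{C}$ with $\mathrm{Im}(\alpha)\le 0$, let $U \subset \mathbb{C}$ be a simply connected domain containing $\overline{\mathbb{H}}\setminus\{\alpha\}$, and let $f:U\to\mathbb{C}$ be an injective holomorphic function such that $f(\overline{\mathbb{H}}\setminus\{\alpha\})$ is convex. Let $X_1,X_2,\dots$ be i.i.d. real-valued continuous random variables and let $$M^f_n := f^{-1}\left(\frac1n\sum_{j=1}^n f(X_j)\right).$$ Assume that $E[|f(X_1)|^2]<+\infty$, $E[f(X_1)]\neq 0$, and $$\limsup_{n\to\infty} E\left[\left|M^f_n\right|^{2+\varepsilon_0}\right]<+\infty$$ for some $\varepsilon_0>0$. Then $$\lim_{n\to\infty} n\,\mathrm{Var}\left(M^f_n\right)=\frac{\mathrm{Var}(f(X_1))}{\left|f'\left(f^{-1}(E[f(X_1)])\right)\right|^2}.$$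
   Context: $\mathbb{H}=\{z\in\mathbb{C}:\mathrm{Im}(z)>0\}$ is the open upper half-plane and $\overline{\mathbb{H}}=\{z\in\mathbb{C}:\mathrm{Im}(z)\ge 0\}$ its closure in $\mathbb{C}$ (so $\overline{\mathbb{H}}\setminus\{\alpha\}=\overline{\mathbb{H}}$ if $\alpha\notin\mathbb{R}$). "Continuous" random variable means that its distribution function is continuous, i.e. $P(X_1=x)=0$ for every $x\in\mathbb{R}$. $f^{-1}:f(U)\to U$ is the inverse of $f$; $M_n^f$ is almost surely well defined by convexity. For a complex-valued random variable $Y$, $E[Y]=E[\mathrm{Re}(Y)]+iE[\mathrm{Im}(Y)]$ and $\mathrm{Var}(Y)=E[|Y-E[Y]|^2]$. *)

theory Defs
  imports "HOL-Probability.Probability" "HOL-Complex_Analysis.Complex_Analysis"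
begin

definition closed_upper_half_plane :: "complex set" where
  "closed_upper_half_plane = {z. 0 \<le> Im z}"

text \<open>\<open>inv_into U f\<close> is the inverse \<open>f(U) \<rightarrow> U\<close>, with an arbitrary constant value off
  \<open>f(U)\<close>. For \<open>n \<ge> 1\<close>, the average lies in \<open>f(U)\<close> almost surely if the image of the closed
  half-plane minus \<open>\<alpha>\<close> is convex and contained in \<open>f(U)\<close>, since each \<open>X j\<close> avoids \<open>\<alpha>\<close> almost surely.\<close>

definition quasi_arith_mean ::
    "complex set \<Rightarrow> (complex \<Rightarrow> complex) \<Rightarrow> (nat \<Rightarrow> 'a \<Rightarrow> real) \<Rightarrow> nat \<Rightarrow> 'a \<Rightarrow> complex" where
  "quasi_arith_mean U f X n \<omega> =
     inv_into U f ((\<Sum>j = 1..n. f (complex_of_real (X j \<omega>))) / of_nat n)"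

text \<open>Being a Bochner integral, this is the usual variance for square-integrable \<open>Y\<close>
  and carries no meaning otherwise.\<close>

definition complex_variance :: "'a measure \<Rightarrow> ('a \<Rightarrow> complex) \<Rightarrow> real" where
  "complex_variance M Y = (\<integral>\<omega>. (cmod (Y \<omega> - (\<integral>\<omega>'. Y \<omega>' \<partial>M)))\<^sup>2 \<partial>M)"

end

(*
  Write g for the inverse of f, S n for the average of the f (X j) and \<mu> for their mean. By
  the delta method the limit follows once the error of the linearization of g at \<mu>, evaluated
  at S n, has second moment o(1/n). Near \<mu> this is differentiability; away from \<mu> one needs
  n E(|g (S n)|^2; |S n - \<mu>| \<ge> \<delta>) \<longlonglongrightarrow> 0, and a bounded moment of order 2 + \<epsilon> alone does not give it.

  Convexity of the image provides the missing control. If f is bounded near infinity, large values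
  of g (S n) force S n into one of finitely many half-planes a . w < c, where c < a . \<mu> and a . w is
  bounded below on the image, and such one-sided deviations are superpolynomially rare. Otherwise the
  recession cone of the image contains a line or is an angle, and Schwarz-Pick and Wolff-type
  arguments show that g (w) is at most linear in |w|, or nearly comparable with a higher power of
  |w|, or outgrows every power, or is comparable with the exponential of a linear functional of w.
  Except in the linear case, the moment of
  g (S N) for a single N yields moments of f (X 1) by independence. Then either convexity of the
  power bounds |S n|^q by an average of i.i.d. square-integrable variables, or the relevant
  deviations have superpolynomially small probability, where the moment of order 2 + \<epsilon> suffices.
*)
theory Submission
  imports Defs "HOL-Real_Asymp.Real_Asymp"
begin

section \<open>Schwarz-Pick estimates and automorphisms of the half-plane\<close>

section \<open>The upper half-plane\<close>

text \<open>The moment of order 2 + \<epsilon> falls short because square integrability makes |S n -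
  \<mu>| \<ge> \<delta> an event of probability only o(1/n), and Hoelder's inequality then leaves n
  times o(n^(-\<epsilon> / (2 + \<epsilon>))), which need not vanish.

  The image need not be closed. If \<open>f\<close> is bounded near infinity, its limits there are
  boundary points that the image omits; half-planes can cut them off only because the image cannot
  omit a whole boundary segment.

  Convexity meets function theory in one construction: contracting the image towards
  \<open>f c\<close> and pulling back is a self-map of the half-plane with fixed point
  \<open>c\<close>. Sending \<open>c\<close> to infinity along a recession direction shows that Im g
  does not decrease in that direction. This matters because Schwarz-Pick bounds degenerate near the
  real axis: points are first moved to where the bound is good, and monotonicity carries it back. A
  recession cone of opening a \<pi> yields the exponent 1 / a, the power that unfolds such a cone to
  a half-plane.\<close>

definition upper_half_plane :: "complex set" where
  "upper_half_plane = {z. 0 < Im z}"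

text \<open>The Cayley transform centred at \<open>c\<close>: for \<open>c\<close> in the upper
  half-plane it maps that half-plane onto the unit disc and \<open>c\<close> to 0, and its modulus
  is the pseudo-hyperbolic distance from \<open>c\<close>.\<close>

definition cayley :: "complex \<Rightarrow> complex \<Rightarrow> complex" where
  "cayley c z = (z - c) / (z - cnj c)"

definition cayley_inv :: "complex \<Rightarrow> complex \<Rightarrow> complex" where
  "cayley_inv c w = (c - cnj c * w) / (1 - w)"

lemma open_upper_half_plane: "open upper_half_plane"
  unfolding upper_half_plane_def by (rule open_halfspace_Im_gt)

lemma upper_half_plane_diff_cnj_nonzero:
  assumes "z \<in> upper_half_plane" "c \<in> upper_half_plane"
  shows "z - cnj c \<noteq> 0"
proof
  assume "z - cnj c = 0"
  hence "Im (z - cnj c) = 0" by simp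
  thus False using assms by (simp add: upper_half_plane_def)
qed

text \<open>The bridge from hyperbolic to Euclidean size: comparing moduli of Cayley transforms
  becomes comparing Im z / |z - cnj c|^2. Both the growth bound for self-maps and the limit of
  hyperbolic discs are read off from it.\<close>

lemma one_minus_norm_cayley_sq:
  assumes "z \<in> upper_half_plane" "c \<in> upper_half_plane"
  shows "1 - (norm (cayley c z))\<^sup>2 = 4 * Im c * Im z / (norm (z - cnj c))\<^sup>2"
proof -
  have 1: "(norm (z - cnj c))\<^sup>2 \<noteq> 0" using upper_half_plane_diff_cnj_nonzero[OF assms] by simp
  have 2: "(norm (z - cnj c))\<^sup>2 - (norm (z - c))\<^sup>2 = 4 * Im c * Im z"
    unfolding cmod_power2 by (simp add: power2_eq_square algebra_simps)
  have "1 - (norm (cayley c z))\<^sup>2 = ((norm (z - cnj c))\<^sup>2 - (norm (z - c))\<^sup>2) / (norm (z - cnj c))\<^sup>2"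
    unfolding diff_divide_distrib using 1 by (simp add: cayley_def norm_divide power_divide)
  thus ?thesis unfolding 2 .
qed

lemma norm_cayley_less_1:
  assumes "z \<in> upper_half_plane" "c \<in> upper_half_plane"
  shows "norm (cayley c z) < 1"
proof -
  have "4 * Im c * Im z / (norm (z - cnj c))\<^sup>2 > 0"
    using upper_half_plane_diff_cnj_nonzero[OF assms] assms by (simp add: upper_half_plane_def)
  hence "(norm (cayley c z))\<^sup>2 < 1" using one_minus_norm_cayley_sq[OF assms] by linarith
  thus ?thesis by (simp add: power_less_one_iff abs_square_less_1)
qed

lemma cayley_inv_in_upper_half_plane:
  assumes "norm w < 1" "c \<in> upper_half_plane"
  shows "cayley_inv c w \<in> upper_half_plane"
proof -
  have w1: "1 - w \<noteq> 0" using assms(1) by auto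
  have "Im (cayley_inv c w) = Im ((c - cnj c * w) * cnj (1 - w)) / (norm (1 - w))\<^sup>2"
    unfolding cayley_inv_def
    by (subst complex_div_cnj) (simp only: Im_divide_of_real flip: of_real_power)
  also have "Im ((c - cnj c * w) * cnj (1 - w)) = Im c * (1 - (norm w)\<^sup>2)"
    unfolding cmod_power2 by (simp add: power2_eq_square algebra_simps)
  finally have "Im (cayley_inv c w) = Im c * (1 - (norm w)\<^sup>2) / (norm (1 - w))\<^sup>2" .
  moreover have "(norm w)\<^sup>2 < 1" using assms(1) by (simp add: power_less_one_iff abs_square_less_1)
  ultimately show ?thesis using assms(2) w1 by (simp add: upper_half_plane_def)
qed

lemma cayley_inv_cayley:
  assumes "z \<in> upper_half_plane" "c \<in> upper_half_plane"
  shows "cayley_inv c (cayley c z) = z"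
proof -
  have 1: "z - cnj c \<noteq> 0" using upper_half_plane_diff_cnj_nonzero[OF assms] .
  have 2: "c - cnj c \<noteq> 0" using upper_half_plane_diff_cnj_nonzero[OF assms(2,2)] .
  have "1 - cayley c z = (c - cnj c) / (z - cnj c)" using 1 by (simp add: cayley_def field_simps)
  moreover have "c - cnj c * cayley c z = z * (c - cnj c) / (z - cnj c)"
    using 1 by (simp add: cayley_def field_simps)
  ultimately show ?thesis using 1 2 by (simp add: cayley_inv_def)
qed

lemma cayley_cayley_inv:
  assumes "norm w < 1" "c \<in> upper_half_plane"
  shows "cayley c (cayley_inv c w) = w"
proof -
  have 1: "1 - w \<noteq> 0" using assms(1) by auto
  have 2: "c - cnj c \<noteq> 0" using upper_half_plane_diff_cnj_nonzero[OF assms(2,2)] .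
  have "cayley_inv c w - c = w * (c - cnj c) / (1 - w)" using 1 by (simp add: cayley_inv_def field_simps)
  moreover have "cayley_inv c w - cnj c = (c - cnj c) / (1 - w)" using 1 by (simp add: cayley_inv_def field_simps)
  ultimately show ?thesis using 1 2 by (simp add: cayley_def)
qed

lemma cayley_holomorphic:
  assumes "c \<in> upper_half_plane" shows "cayley c holomorphic_on upper_half_plane"
proof -
  have "(\<lambda>z. (z - c) / (z - cnj c)) holomorphic_on upper_half_plane"
    using upper_half_plane_diff_cnj_nonzero[OF _ assms] by (intro holomorphic_intros) auto
  thus ?thesis by (simp add: cayley_def[abs_def])
qed

lemma cayley_inv_holomorphic: "cayley_inv c holomorphic_on ball 0 1"
proof -
  have "(\<lambda>w. (c - cnj c * w) / (1 - w)) holomorphic_on ball 0 1"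
    by (intro holomorphic_intros) auto
  thus ?thesis by (simp add: cayley_inv_def[abs_def])
qed

lemma cayley_conjugate_holomorphic:
  assumes F: "F holomorphic_on upper_half_plane" "F ` upper_half_plane \<subseteq> upper_half_plane"
    and a: "a \<in> upper_half_plane"
  shows "(\<lambda>w. cayley (F a) (F (cayley_inv a w))) holomorphic_on ball 0 1"
proof -
  have Fa: "F a \<in> upper_half_plane" using F a by auto
  have 1: "cayley_inv a ` ball 0 1 \<subseteq> upper_half_plane"
    using cayley_inv_in_upper_half_plane[OF _ a] by auto
  have "(cayley (F a) \<circ> (F \<circ> cayley_inv a)) holomorphic_on ball 0 1"
    by (intro holomorphic_on_compose_gen[OF _ cayley_holomorphic[OF Fa]]
        holomorphic_on_compose_gen[OF cayley_inv_holomorphic F(1) 1]) (use 1 F(2) in auto)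
  thus ?thesis by (simp add: o_def)
qed

text \<open>Cayley transforms centred at \<open>a\<close> and at \<open>F a\<close> turn
  \<open>F\<close> into a self-map of the disc fixing 0, where the Schwarz lemma applies.\<close>

lemma schwarz_pick_upper_half_plane:
  assumes F: "F holomorphic_on upper_half_plane" "F ` upper_half_plane \<subseteq> upper_half_plane"
    and a: "a \<in> upper_half_plane" and z: "z \<in> upper_half_plane"
  shows "norm (cayley (F a) (F z)) \<le> norm (cayley a z)"
proof -
  define \<phi> where "\<phi> w = cayley (F a) (F (cayley_inv a w))" for w
  have Fa: "F a \<in> upper_half_plane" using F a by auto
  have "norm (\<phi> (cayley a z)) \<le> norm (cayley a z)"
  proof (rule Schwarz_Lemma(1))
    show "\<phi> holomorphic_on ball 0 1"
      unfolding \<phi>_def[abs_def] by (rule cayley_conjugate_holomorphic[OF F a])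
    show "\<phi> 0 = 0" by (simp add: \<phi>_def cayley_inv_def cayley_def)
    show "norm (\<phi> w) < 1" if "norm w < 1" for w
      unfolding \<phi>_def using cayley_inv_in_upper_half_plane[OF that a] F(2) Fa
      by (intro norm_cayley_less_1) auto
    show "norm (cayley a z) < 1" by (rule norm_cayley_less_1[OF z a])
  qed
  thus ?thesis by (simp add: \<phi>_def cayley_inv_cayley[OF z a])
qed

lemma ii_in_upper_half_plane: "\<i> \<in> upper_half_plane"
  by (simp add: upper_half_plane_def)

text \<open>Schwarz-Pick at \<open>\<i>\<close> confines \<open>F z\<close> to a hyperbolic disc
  about \<open>F \<i>\<close>. The use of the bound is that \<open>F\<close> grows at most linearly
  where Im z is comparable with |z|; near the real axis it degenerates, so later arguments first
  move points away from that axis.\<close>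

lemma norm_self_map_upper_half_plane_le:
  assumes F: "F holomorphic_on upper_half_plane" "F ` upper_half_plane \<subseteq> upper_half_plane"
    and z: "z \<in> upper_half_plane"
  shows "norm (F z) \<le> norm (F \<i>) * (1 + (norm (z + \<i>))\<^sup>2 / Im z)"
proof -
  define w where "w = F z"
  define b where "b = F \<i>"
  define \<rho> where "\<rho> = norm (cayley \<i> z)"
  have w: "w \<in> upper_half_plane" and b: "b \<in> upper_half_plane"
    using F(2) z ii_in_upper_half_plane by (auto simp: w_def b_def)
  have Imz: "Im z > 0" using z by (simp add: upper_half_plane_def)
  have zi: "norm (z + \<i>) > 0" using upper_half_plane_diff_cnj_nonzero[OF z ii_in_upper_half_plane] by simp
  have \<rho>1: "\<rho> < 1" "\<rho> \<ge> 0" using norm_cayley_less_1[OF z ii_in_upper_half_plane] by (auto simp: \<rho>_def)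
  have \<rho>2: "1 - \<rho>\<^sup>2 = 4 * Im z / (norm (z + \<i>))\<^sup>2"
    using one_minus_norm_cayley_sq[OF z ii_in_upper_half_plane] by (simp add: \<rho>_def)
  have "norm (w - b) / norm (w - cnj b) \<le> \<rho>"
    using schwarz_pick_upper_half_plane[OF F ii_in_upper_half_plane z]
    by (simp add: cayley_def norm_divide w_def b_def \<rho>_def)
  hence 1: "norm (w - b) \<le> \<rho> * norm (w - cnj b)"
    using upper_half_plane_diff_cnj_nonzero[OF w b] by (simp add: pos_divide_le_eq)
  have "norm (w - cnj b) \<le> norm (w - b) + norm (b - cnj b)"
    using norm_triangle_ineq[of "w - b" "b - cnj b"] by simp
  also have "norm (b - cnj b) = 2 * Im b"
  proof -
    have "b - cnj b = complex_of_real (2 * Im b) * \<i>" by (simp add: complex_eq_iff)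
    thus ?thesis using b by (simp add: norm_mult upper_half_plane_def)
  qed
  finally have 2: "(1 - \<rho>) * norm (w - cnj b) \<le> 2 * Im b"
    using 1 by (simp add: algebra_simps)
  \<comment> \<open>The distance is controlled by 1 / (1 - \<rho>); the factor 1 + \<rho> \<le> 2
    brings in 1 - \<rho>^2, for which \<open>\<rho>2\<close> is an exact formula.\<close>
  have "(1 - \<rho>\<^sup>2) * norm (w - cnj b) = (1 + \<rho>) * ((1 - \<rho>) * norm (w - cnj b))"
    by (simp add: power2_eq_square algebra_simps)
  also have "\<dots> \<le> 2 * (2 * Im b)"
    using \<rho>1 b by (intro mult_mono[OF _ 2]) (auto simp: upper_half_plane_def)
  finally have "norm (w - cnj b) \<le> Im b * (norm (z + \<i>))\<^sup>2 / Im z"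
    unfolding \<rho>2 using Imz zi by (simp add: field_simps)
  also have "\<dots> \<le> norm b * (norm (z + \<i>))\<^sup>2 / Im z"
    using Imz abs_Im_le_cmod[of b] by (intro divide_right_mono mult_right_mono) auto
  finally have "norm (w - cnj b) \<le> norm b * (norm (z + \<i>))\<^sup>2 / Im z" .
  moreover have "norm w \<le> norm (w - cnj b) + norm b"
    using norm_triangle_ineq[of "w - cnj b" "cnj b"] by simp
  ultimately show ?thesis by (simp add: w_def b_def algebra_simps)
qed

text \<open>Both \<open>F\<close> and its inverse \<open>G\<close> contract hyperbolic distances, so
  \<open>F\<close> preserves them. Conjugated to the disc it is a rotation by the equality case of
  the Schwarz lemma, and solving for \<open>G\<close> gives the coefficients.\<close>

lemma upper_half_plane_automorphism_Moebius:
  assumes F: "F holomorphic_on upper_half_plane" "F ` upper_half_plane \<subseteq> upper_half_plane"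
    and G: "G holomorphic_on upper_half_plane" "G ` upper_half_plane \<subseteq> upper_half_plane"
    and GF: "\<And>z. z \<in> upper_half_plane \<Longrightarrow> G (F z) = z"
    and FG: "\<And>z. z \<in> upper_half_plane \<Longrightarrow> F (G z) = z"
  obtains A B C E where "\<And>w. w \<in> upper_half_plane \<Longrightarrow> C * w + E \<noteq> 0"
    "\<And>w. w \<in> upper_half_plane \<Longrightarrow> G w = (A * w + B) / (C * w + E)"
proof -
  define b where "b = F \<i>"
  have b: "b \<in> upper_half_plane" using F(2) ii_in_upper_half_plane by (auto simp: b_def)
  have Gb: "G b = \<i>" using GF ii_in_upper_half_plane by (simp add: b_def)
  define \<phi> where "\<phi> w = cayley (F \<i>) (F (cayley_inv \<i> w))" for w
  have eq: "norm (cayley b (F z)) = norm (cayley \<i> z)" if z: "z \<in> upper_half_plane" for z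
  proof -
    have Fz: "F z \<in> upper_half_plane" using F(2) z by auto
    have "norm (cayley (G b) (G (F z))) \<le> norm (cayley b (F z))"
      by (rule schwarz_pick_upper_half_plane[OF G b Fz])
    moreover have "norm (cayley (F \<i>) (F z)) \<le> norm (cayley \<i> z)"
      by (rule schwarz_pick_upper_half_plane[OF F ii_in_upper_half_plane z])
    ultimately show ?thesis using Gb GF[OF z] by (simp add: b_def)
  qed
  have \<phi>eq: "norm (\<phi> w) = norm w" if "norm w < 1" for w
    using eq[OF cayley_inv_in_upper_half_plane[OF that ii_in_upper_half_plane]]
      cayley_cayley_inv[OF that ii_in_upper_half_plane] by (simp add: \<phi>_def b_def)
  have "\<exists>\<alpha>. (\<forall>z. norm z < 1 \<longrightarrow> \<phi> z = \<alpha> * z) \<and> norm \<alpha> = 1"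
  proof (rule Schwarz_Lemma(3)[where \<xi> = 0])
    show "\<phi> holomorphic_on ball 0 1"
      unfolding \<phi>_def[abs_def] by (rule cayley_conjugate_holomorphic[OF F ii_in_upper_half_plane])
    show "\<phi> 0 = 0" using \<phi>eq[of 0] by simp
    show "norm (\<phi> w) < 1" if "norm w < 1" for w using \<phi>eq[OF that] that by simp
    show "(\<exists>z. norm z < 1 \<and> z \<noteq> 0 \<and> norm (\<phi> z) = norm z) \<or> norm (deriv \<phi> 0) = 1"
      using \<phi>eq by (intro disjI1 exI[of _ "1/2"]) auto
  qed auto
  then obtain \<mu> where \<mu>: "\<And>w. norm w < 1 \<Longrightarrow> \<phi> w = \<mu> * w" "norm \<mu> = 1" by blast
  hence \<mu>0: "\<mu> \<noteq> 0" by auto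
  have main: "\<mu> * (w - cnj b) - (w - b) \<noteq> 0 \<and>
      G w = \<i> * (\<mu> * (w - cnj b) + (w - b)) / (\<mu> * (w - cnj b) - (w - b))"
    if w: "w \<in> upper_half_plane" for w
  proof -
    have Gw: "G w \<in> upper_half_plane" using G(2) w by auto
    define \<zeta> where "\<zeta> = cayley \<i> (G w)"
    have n: "norm \<zeta> < 1" unfolding \<zeta>_def by (rule norm_cayley_less_1[OF Gw ii_in_upper_half_plane])
    have "\<phi> \<zeta> = cayley b w"
      unfolding \<phi>_def \<zeta>_def cayley_inv_cayley[OF Gw ii_in_upper_half_plane] FG[OF w] b_def ..
    hence 1: "\<mu> * \<zeta> = (w - b) / (w - cnj b)" using \<mu>(1)[OF n] by (simp add: cayley_def)
    have wb: "w - cnj b \<noteq> 0" by (rule upper_half_plane_diff_cnj_nonzero[OF w b])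
    hence 2: "w - b = \<mu> * \<zeta> * (w - cnj b)" using 1 by simp
    have 3: "1 - \<zeta> \<noteq> 0" using n by auto
    have "G w = cayley_inv \<i> \<zeta>" unfolding \<zeta>_def by (simp add: cayley_inv_cayley[OF Gw ii_in_upper_half_plane])
    also have "\<dots> = \<i> * (1 + \<zeta>) / (1 - \<zeta>)" by (simp add: cayley_inv_def algebra_simps)
    finally have 4: "G w = \<i> * (1 + \<zeta>) / (1 - \<zeta>)" .
    have 5: "\<mu> * (w - cnj b) - (w - b) = \<mu> * (w - cnj b) * (1 - \<zeta>)"
      unfolding 2 by (simp add: algebra_simps)
    have 6: "\<mu> * (w - cnj b) + (w - b) = \<mu> * (w - cnj b) * (1 + \<zeta>)"
      unfolding 2 by (simp add: algebra_simps)
    show ?thesis unfolding 4 5 6 using \<mu>0 wb 3 by simp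
  qed
  show ?thesis
  proof (rule that[of "\<mu> - 1" "b - \<mu> * cnj b" "\<i> * (\<mu> + 1)" "- \<i> * (\<mu> * cnj b + b)"])
    fix w assume w: "w \<in> upper_half_plane"
    show "(\<mu> - 1) * w + (b - \<mu> * cnj b) \<noteq> 0"
      using main[OF w] by (simp add: algebra_simps)
    have "(\<mu> - 1) * w + (b - \<mu> * cnj b) = \<mu> * (w - cnj b) - (w - b)" by (simp add: algebra_simps)
    moreover have "\<i> * (\<mu> + 1) * w + - \<i> * (\<mu> * cnj b + b) = \<i> * (\<mu> * (w - cnj b) + (w - b))"
      by (simp add: algebra_simps)
    ultimately show "G w = (\<i> * (\<mu> + 1) * w + - \<i> * (\<mu> * cnj b + b)) / ((\<mu> - 1) * w + (b - \<mu> * cnj b))"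
      using main[OF w] by simp
  qed
qed

section \<open>The image as a convex open set, and starlike images of hyperbolic discs\<close>

section \<open>Convex images of the half-plane\<close>

locale convex_half_plane_map =
  fixes f :: "complex \<Rightarrow> complex" and U :: "complex set" and \<alpha> :: complex
  assumes Im_\<alpha>: "Im \<alpha> \<le> 0" and open_U: "open U"
    and dom_subset: "closed_upper_half_plane - {\<alpha>} \<subseteq> U"
    and holo: "f holomorphic_on U" and inj: "inj_on f U"
    and convex_image: "convex (f ` (closed_upper_half_plane - {\<alpha>}))"
begin

abbreviation "K \<equiv> closed_upper_half_plane - {\<alpha>}"
abbreviation "C \<equiv> f ` K"
abbreviation "D \<equiv> f ` upper_half_plane"
abbreviation "g \<equiv> inv_into U f"

lemma upper_half_plane_subset_K: "upper_half_plane \<subseteq> K"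
  using Im_\<alpha> by (auto simp: upper_half_plane_def closed_upper_half_plane_def)

lemma upper_half_plane_subset_U: "upper_half_plane \<subseteq> U"
  using upper_half_plane_subset_K dom_subset by blast

lemma g_f: "z \<in> U \<Longrightarrow> g (f z) = z"
  using inj by (rule inv_into_f_f)

lemma f_g: "w \<in> f ` U \<Longrightarrow> f (g w) = w"
  by (rule f_inv_into_f)

lemma C_subset: "C \<subseteq> f ` U" and D_subset_C: "D \<subseteq> C" and D_subset: "D \<subseteq> f ` U"
  using dom_subset upper_half_plane_subset_K by blast+

lemma g_C: "w \<in> C \<Longrightarrow> g w \<in> K"
  using g_f dom_subset by fastforce

lemma g_D: "w \<in> D \<Longrightarrow> g w \<in> upper_half_plane"
  using g_f upper_half_plane_subset_U by fastforce

lemma continuous_f: "continuous_on U f"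
  by (rule holomorphic_on_imp_continuous_on[OF holo])

lemma open_image: "open (f ` U)"
  by (rule open_mapping_thm3[OF holo open_U inj])

lemma inverse_holomorphic: "g holomorphic_on f ` U"
  and deriv_g: "z \<in> U \<Longrightarrow> deriv f z * deriv g (f z) = 1"
proof -
  obtain h where h: "h holomorphic_on f ` U"
    "\<And>z. z \<in> U \<Longrightarrow> deriv f z * deriv h (f z) = 1" "\<And>z. z \<in> U \<Longrightarrow> h (f z) = z"
    using holomorphic_has_inverse[OF holo open_U inj] by metis
  have eq: "h w = g w" if "w \<in> f ` U" for w
    using that h(3) g_f by auto
  show "g holomorphic_on f ` U" by (rule holomorphic_transform[OF h(1) eq])
  show "deriv f z * deriv g (f z) = 1" if "z \<in> U"
  proof -
    have "eventually (\<lambda>w. w \<in> f ` U) (nhds (f z))"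
      using open_image that by (intro eventually_nhds_in_open) auto
    hence "deriv h (f z) = deriv g (f z)"
      by (intro deriv_cong_ev) (auto elim!: eventually_mono simp: eq)
    with h(2)[OF that] show ?thesis by simp
  qed
qed

lemma continuous_g: "continuous_on (f ` U) g"
  by (rule holomorphic_on_imp_continuous_on[OF inverse_holomorphic])

lemma open_D: "open D"
  using open_mapping_thm3[OF holomorphic_on_subset[OF holo upper_half_plane_subset_U]
      open_upper_half_plane inj_on_subset[OF inj upper_half_plane_subset_U]] .

text \<open>A real point \<open>z\<close> of \<open>K\<close> cannot have its value in the interior
  of \<open>C\<close>: the values at points slightly below \<open>z\<close> would lie in
  \<open>C\<close> too, and injectivity on \<open>U\<close> would place those points in
  \<open>K\<close>. In this way \<open>D\<close> inherits convexity from \<open>C\<close>.\<close>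

lemma D_eq_interior: "D = interior C"
proof
  show "D \<subseteq> interior C" using open_D D_subset_C by (rule interior_maximal[rotated])
  show "interior C \<subseteq> D"
  proof
    fix w assume w: "w \<in> interior C"
    then obtain z where z: "z \<in> K" "w = f z" using interior_subset by blast
    show "w \<in> D"
    proof (cases "Im z > 0")
      case True thus ?thesis using z by (auto simp: upper_half_plane_def)
    next
      case False
      have zU: "z \<in> U" using z dom_subset by auto
      have c: "isCont f z" using continuous_f open_U zU by (simp add: continuous_on_eq_continuous_at)
      have lim: "(\<lambda>n. z - \<i> * complex_of_real (inverse (real (Suc n)))) \<longlonglongrightarrow> z"
        by (rule tendsto_eq_intros refl LIMSEQ_inverse_real_of_nat | simp)+
      have "(\<lambda>n. f (z - \<i> * complex_of_real (inverse (real (Suc n))))) \<longlonglongrightarrow> f z"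
        by (rule isCont_tendsto_compose[OF c lim])
      hence "eventually (\<lambda>n. f (z - \<i> * complex_of_real (inverse (real (Suc n)))) \<in> interior C) sequentially"
        using w z by (intro topological_tendstoD) auto
      moreover have "eventually (\<lambda>n. z - \<i> * complex_of_real (inverse (real (Suc n))) \<in> U) sequentially"
        using lim zU open_U by (intro topological_tendstoD)
      ultimately obtain n where n: "f (z - \<i> * complex_of_real (inverse (real (Suc n)))) \<in> interior C"
        "z - \<i> * complex_of_real (inverse (real (Suc n))) \<in> U"
        using eventually_happens[OF eventually_conj] by (metis (mono_tags, lifting) sequentially_bot)
      then obtain z' where z': "z' \<in> K" "f (z - \<i> * complex_of_real (inverse (real (Suc n)))) = f z'"
        using interior_subset by blast
      hence "z - \<i> * complex_of_real (inverse (real (Suc n))) = z'"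
        using inj_onD[OF inj] n(2) dom_subset by blast
      moreover have "Im (z - \<i> * complex_of_real r) = Im z - r" for r by simp
      ultimately have "Im z' = Im z - inverse (real (Suc n))" by metis
      moreover have "inverse (real (Suc n)) > 0" by simp
      ultimately have "Im z' < 0" using False by linarith
      thus ?thesis using z' by (auto simp: closed_upper_half_plane_def)
    qed
  qed
qed

lemma convex_D: "convex D"
  unfolding D_eq_interior by (rule convex_interior[OF convex_image])

lemma K_limit_of_upper_half_plane:
  assumes "z \<in> K"
  shows "(\<lambda>n. z + \<i> * complex_of_real (inverse (real (Suc n)))) \<longlonglongrightarrow> z"
    "z + \<i> * complex_of_real (inverse (real (Suc n))) \<in> upper_half_plane"
    "(\<lambda>n. f (z + \<i> * complex_of_real (inverse (real (Suc n))))) \<longlonglongrightarrow> f z"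
proof -
  show lim: "(\<lambda>n. z + \<i> * complex_of_real (inverse (real (Suc n)))) \<longlonglongrightarrow> z"
    by (rule tendsto_eq_intros refl LIMSEQ_inverse_real_of_nat | simp)+
  have "inverse (real (Suc n)) > 0" by simp
  thus "z + \<i> * complex_of_real (inverse (real (Suc n))) \<in> upper_half_plane"
    using assms by (auto simp: upper_half_plane_def closed_upper_half_plane_def intro: add_nonneg_pos)
  have c: "isCont f z" using continuous_f open_U assms dom_subset by (auto simp: continuous_on_eq_continuous_at)
  show "(\<lambda>n. f (z + \<i> * complex_of_real (inverse (real (Suc n))))) \<longlonglongrightarrow> f z"
    by (rule isCont_tendsto_compose[OF c lim])
qed

lemma C_subset_closure_D: "C \<subseteq> closure D"
proof
  fix w assume "w \<in> C"
  then obtain z where "z \<in> K" "w = f z" by blast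
  thus "w \<in> closure D"
    unfolding closure_sequential using K_limit_of_upper_half_plane(2,3)
    by (intro exI[of _ "\<lambda>n. f (z + \<i> * complex_of_real (inverse (real (Suc n))))"] conjI allI imageI) simp_all
qed

lemma closure_C: "closure C = closure D"
  using C_subset_closure_D D_subset_C by (simp add: closure_minimal closure_mono subset_antisym)

lemma interior_closure_D: "interior (closure D) = D"
  using convex_interior_closure[OF convex_D] interior_open[OF open_D] by simp

lemma D_nonempty: "D \<noteq> {}"
  using ii_in_upper_half_plane by blast

text \<open>Convexity enters Schwarz-Pick arguments here: contracting \<open>D\<close> towards
  \<open>f c\<close> and pulling back by \<open>g\<close> is a holomorphic self-map of the
  half-plane, and it fixes \<open>c\<close>.\<close>

lemma averaged_self_map:
  assumes l: "0 \<le> l" "l \<le> 1" and c: "c \<in> upper_half_plane"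
  shows "(\<lambda>z. g ((1 - l) *\<^sub>R f z + l *\<^sub>R f c)) holomorphic_on upper_half_plane"
    and "\<And>z. z \<in> upper_half_plane \<Longrightarrow> (1 - l) *\<^sub>R f z + l *\<^sub>R f c \<in> D"
proof -
  show inD: "(1 - l) *\<^sub>R f z + l *\<^sub>R f c \<in> D" if "z \<in> upper_half_plane" for z
    using convexD[OF convex_D, of "f z" "f c" "1 - l" l] that c l by auto
  have "(g \<circ> (\<lambda>z. (1 - l) *\<^sub>R f z + l *\<^sub>R f c)) holomorphic_on upper_half_plane"
  proof (rule holomorphic_on_compose_gen[OF _ inverse_holomorphic])
    show "(\<lambda>z. (1 - l) *\<^sub>R f z + l *\<^sub>R f c) holomorphic_on upper_half_plane"
      unfolding scaleR_conv_of_real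
      by (intro holomorphic_intros holomorphic_on_subset[OF holo upper_half_plane_subset_U])
    show "(\<lambda>z. (1 - l) *\<^sub>R f z + l *\<^sub>R f c) ` upper_half_plane \<subseteq> f ` U"
      using inD D_subset by blast
  qed
  thus "(\<lambda>z. g ((1 - l) *\<^sub>R f z + l *\<^sub>R f c)) holomorphic_on upper_half_plane"
    by (simp add: o_def)
qed

text \<open>The contraction fixes \<open>c\<close>, so Schwarz-Pick makes it preserve every
  hyperbolic disc about \<open>c\<close>; the image of such a disc under \<open>f\<close> is
  therefore starlike about \<open>f c\<close>.\<close>

lemma hyperbolic_disc_image_starlike:
  assumes l: "0 \<le> l" "l \<le> 1" and c: "c \<in> upper_half_plane" and z: "z \<in> upper_half_plane"
  shows "norm (cayley c (g ((1 - l) *\<^sub>R f z + l *\<^sub>R f c))) \<le> norm (cayley c z)"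
proof -
  define F where "F z = g ((1 - l) *\<^sub>R f z + l *\<^sub>R f c)" for z
  have "F ` upper_half_plane \<subseteq> upper_half_plane"
    unfolding F_def using g_D averaged_self_map(2)[OF l c] by auto
  moreover have "F holomorphic_on upper_half_plane"
    unfolding F_def[abs_def] by (rule averaged_self_map(1)[OF l c])
  moreover have "F c = c"
    using c upper_half_plane_subset_U by (auto simp: F_def g_f simp flip: scaleR_left_distrib)
  ultimately show ?thesis
    using schwarz_pick_upper_half_plane[of F c z] c z by (simp add: F_def)
qed

text \<open>Wolff's argument: the hyperbolic discs of the preceding lemma, with centres running off to
  infinity, exhaust a half-plane.\<close>

lemma Im_g_ge_of_centres_to_infinity:
  assumes z: "z \<in> upper_half_plane"
    and c: "\<And>n. c n \<in> upper_half_plane" "filterlim c at_infinity sequentially"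
    and l: "\<And>n. 0 \<le> l n" "\<And>n. l n \<le> (1::real)"
    and lim: "(\<lambda>n. (1 - l n) *\<^sub>R f z + l n *\<^sub>R f (c n)) \<longlonglongrightarrow> u" and u: "u \<in> D"
  shows "Im z \<le> Im (g u)"
proof -
  define G where "G n = g ((1 - l n) *\<^sub>R f z + l n *\<^sub>R f (c n))" for n
  have Gin: "G n \<in> upper_half_plane" for n
    unfolding G_def using averaged_self_map(2)[OF l(1) l(2) c(1) z] g_D by blast
  have "isCont g u"
    using continuous_g open_image u D_subset by (auto simp: continuous_on_eq_continuous_at)
  hence Glim: "G \<longlonglongrightarrow> g u" unfolding G_def by (rule isCont_tendsto_compose[OF _ lim])
  have inv0: "(\<lambda>n. inverse (c n)) \<longlonglongrightarrow> 0"
    by (rule tendsto_inverse_0[THEN filterlim_compose, OF c(2)])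
  have c0: "c n \<noteq> 0" for n using c(1)[of n] by (auto simp: upper_half_plane_def)
  have ineq: "Im z * (norm (G n - cnj (c n)))\<^sup>2 \<le> Im (G n) * (norm (z - cnj (c n)))\<^sup>2" for n
  proof -
    have 1: "norm (G n - cnj (c n)) > 0" "norm (z - cnj (c n)) > 0"
      using upper_half_plane_diff_cnj_nonzero[OF Gin c(1)] upper_half_plane_diff_cnj_nonzero[OF z c(1)] by auto
    have 2: "Im (c n) > 0" using c(1)[of n] by (simp add: upper_half_plane_def)
    have "(norm (cayley (c n) (G n)))\<^sup>2 \<le> (norm (cayley (c n) z))\<^sup>2"
      unfolding G_def by (intro power_mono hyperbolic_disc_image_starlike l c z) auto
    hence "4 * Im (c n) * Im z / (norm (z - cnj (c n)))\<^sup>2 \<le> 4 * Im (c n) * Im (G n) / (norm (G n - cnj (c n)))\<^sup>2"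
      using one_minus_norm_cayley_sq[OF Gin c(1), of n n] one_minus_norm_cayley_sq[OF z c(1), of n] by linarith
    thus ?thesis using 1 2 by (simp add: field_simps)
  qed
  \<comment> \<open>Rescaling by |1 / c n|^2 makes the factors containing \<open>c n\<close> tend to
    1, so that only Im z and Im (g u) survive in the limit.\<close>
  have ineq1: "Im z * (norm ((G n - cnj (c n)) * cnj (inverse (c n))))\<^sup>2 \<le> Im (G n) * (norm ((z - cnj (c n)) * cnj (inverse (c n))))\<^sup>2" for n
    using mult_right_mono[OF ineq, of "(norm (cnj (inverse (c n))))\<^sup>2" n]
    unfolding norm_mult power_mult_distrib by (simp only: mult.assoc zero_le_power2 simp_thms)
  have ineq2: "Im z * (norm (G n * cnj (inverse (c n)) - 1))\<^sup>2 \<le> Im (G n) * (norm (z * cnj (inverse (c n)) - 1))\<^sup>2" for n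
  proof -
    have "cnj (c n) * cnj (inverse (c n)) = 1" using c0[of n] by simp
    hence "(x - cnj (c n)) * cnj (inverse (c n)) = x * cnj (inverse (c n)) - 1" for x
      by (simp only: left_diff_distrib)
    thus ?thesis using ineq1[of n] by (simp only:)
  qed
  have l1: "(\<lambda>n. Im z * (norm (G n * cnj (inverse (c n)) - 1))\<^sup>2) \<longlonglongrightarrow> Im z * (norm (g u * cnj 0 - 1))\<^sup>2"
    by (intro tendsto_intros Glim inv0)
  have l2: "(\<lambda>n. Im (G n) * (norm (z * cnj (inverse (c n)) - 1))\<^sup>2) \<longlonglongrightarrow> Im (g u) * (norm (z * cnj 0 - 1))\<^sup>2"
    by (intro tendsto_intros Glim inv0)
  show ?thesis using LIMSEQ_le[OF l1 l2] ineq2 by auto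
qed

section \<open>Boundary points of the convex image that are not values of \<open>f\<close>\<close>

section \<open>Missing boundary points\<close>

text \<open>As \<open>w\<close> approaches a point that \<open>C\<close> omits, \<open>g w\<close>
  can accumulate only at \<open>\<alpha>\<close> or at infinity, and the quotient vanishes at both:
  the points where its modulus is at least \<open>e\<close> form a compact part of \<open>K\<close>,
  whose image keeps a positive distance from \<open>q\<close>.\<close>

lemma inverse_near_missing_boundary_point:
  assumes q: "q \<notin> C" and e: "e > 0"
  shows "\<exists>d>0. \<forall>w\<in>D. dist w q < d \<longrightarrow> norm ((g w - \<alpha>) / (g w + \<i>)\<^sup>2) < e"
proof -
  define S where "S = {z. 0 \<le> Im z \<and> e * (norm (z + \<i>))\<^sup>2 \<le> norm (z - \<alpha>)}"
  have i: "norm (z + \<i>) \<ge> 1" "norm (z + \<i>) \<ge> norm z" if "0 \<le> Im z" for z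
  proof -
    have "1 \<le> \<bar>Im (z + \<i>)\<bar>" using that by simp
    thus "norm (z + \<i>) \<ge> 1" using abs_Im_le_cmod[of "z + \<i>"] by linarith
    have "(Im z)\<^sup>2 \<le> (Im z + 1)\<^sup>2" using that by (intro power_mono) auto
    thus "norm (z + \<i>) \<ge> norm z" by (simp add: cmod_def)
  qed
  have "closed ({z. 0 \<le> Im z} \<inter> {z. e * (norm (z + \<i>))\<^sup>2 \<le> norm (z - \<alpha>)})"
    by (intro closed_Int closed_halfspace_Im_ge closed_Collect_le continuous_on_mult continuous_on_power
        continuous_on_norm continuous_on_add continuous_on_diff continuous_on_const continuous_on_id)
  hence "closed S" unfolding S_def by (simp add: Collect_conj_eq)
  moreover have "norm z \<le> max 1 ((1 + norm \<alpha>) / e)" if z: "z \<in> S" for z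
  proof (cases "norm z \<le> 1")
    case False
    have "e * (norm z)\<^sup>2 \<le> e * (norm (z + \<i>))\<^sup>2"
      using e i z by (intro mult_left_mono power_mono) (auto simp: S_def)
    also have "\<dots> \<le> norm (z - \<alpha>)" using z by (simp add: S_def)
    also have "\<dots> \<le> norm z + norm \<alpha>" by (rule norm_triangle_ineq4)
    also have "\<dots> \<le> norm z + norm z * norm \<alpha>"
      using False mult_right_mono[of 1 "norm z" "norm \<alpha>"] by simp
    finally have "(e * norm z) * norm z \<le> (1 + norm \<alpha>) * norm z" by (simp add: power2_eq_square algebra_simps)
    hence "e * norm z \<le> 1 + norm \<alpha>"
      by (rule mult_right_le_imp_le) (use False in linarith)
    hence "norm z \<le> (1 + norm \<alpha>) / e" using e by (simp add: field_simps)
    thus ?thesis by simp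
  qed simp
  hence "bounded S" by (intro boundedI)
  ultimately have "compact S" by (simp add: compact_eq_bounded_closed)
  have "\<alpha> \<notin> S"
  proof
    assume "\<alpha> \<in> S"
    hence a: "e * (norm (\<alpha> + \<i>))\<^sup>2 \<le> 0" "0 \<le> Im \<alpha>" by (auto simp: S_def)
    have "norm (\<alpha> + \<i>) > 0" using i(1)[OF a(2)] by linarith
    with a(1) e show False by (simp add: mult_le_0_iff)
  qed
  hence SK: "S \<subseteq> K" by (auto simp: S_def closed_upper_half_plane_def)
  hence "compact (f ` S)"
    using \<open>compact S\<close> dom_subset by (intro compact_continuous_image continuous_on_subset[OF continuous_f]) auto
  moreover have "q \<notin> f ` S" using q SK by blast
  ultimately obtain d where d: "d > 0" "\<And>x. x \<in> f ` S \<Longrightarrow> d \<le> dist q x"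
    using separate_point_closed[of "f ` S" q] compact_imp_closed by metis
  show ?thesis
  proof (intro exI[of _ d] conjI ballI impI d)
    fix w assume w: "w \<in> D" "dist w q < d"
    hence gw: "g w \<in> upper_half_plane" using g_D by blast
    have "f (g w) = w" using f_g D_subset w by blast
    hence "g w \<notin> S" using d(2)[of w] w by (metis dist_commute imageI not_le)
    hence "norm (g w - \<alpha>) < e * (norm (g w + \<i>))\<^sup>2" using gw by (auto simp: S_def upper_half_plane_def)
    moreover have "norm (g w + \<i>) > 0" using i(1)[of "g w"] gw by (auto simp: upper_half_plane_def)
    ultimately show "norm ((g w - \<alpha>) / (g w + \<i>)\<^sup>2) < e"
      by (simp add: norm_divide norm_power field_simps)
  qed
qed

text \<open>On a segment in the boundary of \<open>D\<close> that misses \<open>C\<close>, the function below vanishes; extended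
  by zero across the segment it stays holomorphic.\<close>

lemma no_missing_boundary_segment:
  assumes v: "v \<noteq> 0" and seg: "\<And>t::real. 0 \<le> t \<Longrightarrow> t \<le> 1 \<Longrightarrow> p + t *\<^sub>R v \<in> closure D - C"
  shows False
proof -
  have "\<exists>d0\<in>D. Im ((d0 - p) / v) \<noteq> 0"
  proof -
    obtain d where d: "d \<in> D" using D_nonempty by blast
    then obtain r where r: "r > 0" "cball d r \<subseteq> D" using open_D open_contains_cball by blast
    define d' where "d' = d + \<i> * v * complex_of_real (r / norm v)"
    have "d' \<in> cball d r" using v r(1) by (simp add: d'_def dist_norm norm_mult norm_divide)
    hence "d' \<in> D" using r by blast
    moreover have "(d' - p) / v = (d - p) / v + \<i> * complex_of_real (r / norm v)"
      using v by (simp add: d'_def field_simps)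
    hence "Im ((d' - p) / v) = Im ((d - p) / v) + r / norm v" by simp
    moreover have "r / norm v > 0" using r v by simp
    ultimately have "Im ((d - p) / v) \<noteq> 0 \<or> Im ((d' - p) / v) \<noteq> 0" by linarith
    thus ?thesis using d \<open>d' \<in> D\<close> by blast
  qed
  then obtain d0 where d0: "d0 \<in> D" "Im ((d0 - p) / v) \<noteq> 0" by blast
  \<comment> \<open>Coordinates \<zeta> with w = m + V \<zeta> put the segment at [-1/2, 1/2] with
    its midpoint at 0; the sign of \<open>V\<close> places the interior point \<open>d0\<close>
    above the real axis.\<close>
  define V where "V = (if Im ((d0 - p) / v) > 0 then v else - v)"
  define m where "m = p + (1/2) *\<^sub>R v"
  have V0: "V \<noteq> 0" using v by (auto simp: V_def)
  have mV: "m + s *\<^sub>R V \<in> closure D - C" if "\<bar>s\<bar> \<le> 1/2" for s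
  proof -
    have "m + s *\<^sub>R V = p + (1/2 + (if Im ((d0 - p) / v) > 0 then s else - s)) *\<^sub>R v"
      by (auto simp: m_def V_def scaleR_left_distrib scaleR_conv_of_real algebra_simps)
    thus ?thesis using seg[of "1/2 + (if Im ((d0 - p) / v) > 0 then s else - s)"] that by (auto split: if_splits)
  qed
  define \<zeta>0 where "\<zeta>0 = (d0 - m) / V"
  have \<eta>0: "Im \<zeta>0 > 0"
  proof -
    have "(d0 - m) / v = (d0 - p) / v - 1/2" using v by (simp add: m_def scaleR_conv_of_real field_simps)
    hence "Im ((d0 - m) / v) = Im ((d0 - p) / v)" by simp
    moreover have "Im ((d0 - m) / (- v)) = - Im ((d0 - m) / v)" by simp
    ultimately show ?thesis using d0(2) by (auto simp: \<zeta>0_def V_def)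
  qed
  \<comment> \<open>The upper half-disc of radius \<open>r\<close> is to lie in the triangle with
    apex \<open>d0\<close> over the segment. \<open>\<rho>\<close> accounts for an apex that leans
    sideways: r \<rho> \<le> 1/8 and t \<le> 1/2 keep the foot \<open>s\<close> of the line from
    \<open>d0\<close> through \<zeta> within [-1/2, 1/2].\<close>
  define \<rho> where "\<rho> = 1 + \<bar>Re \<zeta>0\<bar> / Im \<zeta>0"
  have \<rho>: "\<rho> \<ge> 1" using \<eta>0 by (simp add: \<rho>_def)
  define r where "r = min (Im \<zeta>0 / 2) (1 / (8 * \<rho>))"
  have r: "r > 0" "r \<le> Im \<zeta>0 / 2" "r * \<rho> \<le> 1/8"
  proof -
    show "r > 0" "r \<le> Im \<zeta>0 / 2" using \<eta>0 \<rho> by (auto simp: r_def)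
    have "r * \<rho> \<le> 1 / (8 * \<rho>) * \<rho>" using \<rho> by (intro mult_right_mono) (auto simp: r_def)
    thus "r * \<rho> \<le> 1/8" using \<rho> by simp
  qed
  define W where "W \<zeta> = m + V * \<zeta>" for \<zeta>
  have WD: "W \<zeta> \<in> D" if "norm \<zeta> < r" "Im \<zeta> > 0" for \<zeta>
  proof -
    define t where "t = Im \<zeta> / Im \<zeta>0"
    define s where "s = (Re \<zeta> - t * Re \<zeta>0) / (1 - t)"
    have "Im \<zeta> < r" "\<bar>Re \<zeta>\<bar> < r" using that abs_Im_le_cmod[of \<zeta>] abs_Re_le_cmod[of \<zeta>] by auto
    hence t: "0 < t" "t \<le> 1/2" using that \<eta>0 r(2) by (auto simp: t_def field_simps)
    have "\<bar>Re \<zeta> - t * Re \<zeta>0\<bar> \<le> \<bar>Re \<zeta>\<bar> + t * \<bar>Re \<zeta>0\<bar>"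
      using t abs_triangle_ineq4[of "Re \<zeta>" "t * Re \<zeta>0"] by (simp add: abs_mult)
    also have "\<dots> \<le> r + (r / Im \<zeta>0) * \<bar>Re \<zeta>0\<bar>"
      unfolding t_def using \<open>Im \<zeta> < r\<close> \<open>\<bar>Re \<zeta>\<bar> < r\<close> \<eta>0
      by (intro add_mono mult_right_mono divide_right_mono) auto
    also have "\<dots> = r * \<rho>" by (simp add: \<rho>_def field_simps)
    also have "\<dots> \<le> 1/8" by (rule r(3))
    finally have "\<bar>Re \<zeta> - t * Re \<zeta>0\<bar> \<le> 1/8" .
    moreover have "1 - t \<ge> 1/2" using t by simp
    ultimately have "\<bar>Re \<zeta> - t * Re \<zeta>0\<bar> / \<bar>1 - t\<bar> \<le> (1/8) / (1/2)" by (intro frac_le) auto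
    moreover have "(1/8) / (1/2) \<le> (1/2::real)" by simp
    ultimately have "\<bar>Re \<zeta> - t * Re \<zeta>0\<bar> / \<bar>1 - t\<bar> \<le> 1/2" by (rule order_trans)
    hence s: "\<bar>s\<bar> \<le> 1/2" by (simp add: s_def abs_divide)
    have st: "(1 - t) * s = Re \<zeta> - t * Re \<zeta>0" using t by (simp add: s_def)
    have z: "\<zeta> = (1 - t) *\<^sub>R complex_of_real s + t *\<^sub>R \<zeta>0"
      using st \<eta>0 by (simp add: complex_eq_iff t_def)
    have d: "d0 = m + V * \<zeta>0" using V0 by (simp add: \<zeta>0_def)
    have "W \<zeta> = (1 - t) *\<^sub>R (m + s *\<^sub>R V) + t *\<^sub>R d0"
      unfolding W_def z d by (simp add: scaleR_conv_of_real algebra_simps)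
    hence eq: "W \<zeta> = (1 - (1 - t)) *\<^sub>R d0 + (1 - t) *\<^sub>R (m + s *\<^sub>R V)" by (simp add: algebra_simps)
    have "m + s *\<^sub>R V \<noteq> d0" using mV[OF s] d0 D_subset_C by auto
    hence "W \<zeta> \<in> open_segment d0 (m + s *\<^sub>R V)"
      unfolding in_segment eq using t by (intro conjI exI[of _ "1 - t"]) auto
    thus "W \<zeta> \<in> D"
      using in_interior_closure_convex_segment[OF convex_D, of d0 "m + s *\<^sub>R V"] d0 mV[OF s] interior_open[OF open_D]
      by auto
  qed
  define h where "h w = (g w - \<alpha>) / (g w + \<i>)\<^sup>2" for w
  define hT where "hT \<zeta> = (if Im \<zeta> > 0 then h (W \<zeta>) else 0)" for \<zeta>
  define B where "B = ball (0::complex) r"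
  have gi: "g w + \<i> \<noteq> 0" if "w \<in> D" for w
  proof
    assume "g w + \<i> = 0"
    hence "Im (g w + \<i>) = 0" by simp
    thus False using g_D[OF that] by (simp add: upper_half_plane_def)
  qed
  have hD: "h holomorphic_on D"
    unfolding h_def using gi by (intro holomorphic_intros holomorphic_on_subset[OF inverse_holomorphic D_subset]) auto
  have up: "(\<lambda>\<zeta>. h (W \<zeta>)) holomorphic_on (B \<inter> {z. 0 < Im z})"
  proof -
    have "(h \<circ> W) holomorphic_on (B \<inter> {z. 0 < Im z})"
      by (rule holomorphic_on_compose_gen[OF _ hD]) (auto simp: W_def[abs_def] B_def WD[unfolded W_def] intro!: holomorphic_intros)
    thus ?thesis by (simp add: o_def)
  qed
  have oU: "open (B \<inter> {z. 0 < Im z})" and oL: "open (B \<inter> {z. Im z < 0})"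
    by (auto simp: B_def intro!: open_Int open_halfspace_Im_gt open_halfspace_Im_lt)
  have hup: "hT holomorphic_on (B \<inter> {z. 0 < Im z})"
    by (rule holomorphic_transform[OF up]) (simp add: hT_def)
  have hlow: "hT holomorphic_on (B \<inter> {z. Im z < 0})"
    by (rule holomorphic_transform[of "\<lambda>_. 0"]) (auto simp: hT_def)
  have "isCont hT \<zeta>" if z: "\<zeta> \<in> B" for \<zeta>
  proof -
    consider "Im \<zeta> > 0" | "Im \<zeta> < 0" | "Im \<zeta> = 0" by linarith
    thus ?thesis
    proof cases
      case 1
      thus ?thesis using holomorphic_on_imp_continuous_on[OF hup] oU z
        by (auto simp: continuous_on_eq_continuous_at)
    next
      case 2
      thus ?thesis using holomorphic_on_imp_continuous_on[OF hlow] oL z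
        by (auto simp: continuous_on_eq_continuous_at)
    next
      case 3
      have W\<zeta>: "W \<zeta> = m + Re \<zeta> *\<^sub>R V" using 3 by (simp add: W_def complex_eq_iff)
      have "\<bar>Re \<zeta>\<bar> \<le> 1/2"
      proof -
        have "r * 1 \<le> r * \<rho>" using r(1) \<rho> by (intro mult_left_mono) auto
        moreover have "norm \<zeta> < r" using z by (simp add: B_def)
        ultimately show ?thesis using r(3) abs_Re_le_cmod[of \<zeta>] by linarith
      qed
      hence notC: "W \<zeta> \<notin> C" using mV[of "Re \<zeta>"] W\<zeta> by auto
      have hT0: "hT \<zeta> = 0" using 3 by (simp add: hT_def)
      show ?thesis unfolding continuous_at_eps_delta hT0
      proof (intro allI impI)
        fix e :: real assume e: "e > 0"
        obtain d where d: "d > 0" "\<And>w. w \<in> D \<Longrightarrow> dist w (W \<zeta>) < d \<Longrightarrow> norm (h w) < e"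
          using inverse_near_missing_boundary_point[OF notC e] unfolding h_def by blast
        define d' where "d' = min (d / norm V) (r - norm \<zeta>)"
        have "d' > 0" using d V0 z by (simp add: d'_def B_def)
        moreover have "dist (hT x) 0 < e" if x: "dist x \<zeta> < d'" for x
        proof (cases "Im x > 0")
          case True
          have "norm x \<le> norm \<zeta> + dist x \<zeta>" using norm_triangle_ineq[of \<zeta> "x - \<zeta>"] by (simp add: dist_norm)
          hence "norm x < r" using x by (simp add: d'_def)
          hence WxD: "W x \<in> D" using WD True by blast
          have "dist (W x) (W \<zeta>) = norm V * dist x \<zeta>"
            by (simp add: W_def dist_norm flip: norm_mult right_diff_distrib)
          also have "\<dots> < d" using x V0 by (simp add: d'_def field_simps)
          finally show ?thesis using d(2)[OF WxD] True by (simp add: hT_def)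
        next
          case False thus ?thesis using e by (simp add: hT_def)
        qed
        ultimately show "\<exists>d>0. \<forall>x'. dist x' \<zeta> < d \<longrightarrow> dist (hT x') 0 < e" by blast
      qed
    qed
  qed
  hence "continuous_on B hT" by (simp add: continuous_at_imp_continuous_on)
  \<comment> \<open>Continuity across the real line and holomorphy on both sides give holomorphy
    (Morera). Vanishing below the line, the function vanishes throughout \<open>B\<close>, which
    forces \<open>g\<close> to take the value \<open>\<alpha>\<close> on \<open>D\<close>; but
    \<open>g\<close> maps \<open>D\<close> into the open upper half-plane.\<close>
  hence holT: "hT holomorphic_on B"
    using hup hlow by (intro holomorphic_on_paste_across_line[of B \<i> hT 0]) (auto simp: B_def)
  define z1 where "z1 = \<i> * complex_of_real (r/2)"
  have z1: "z1 \<in> B" "Im z1 > 0" "norm z1 < r" using r(1) by (auto simp: z1_def B_def norm_mult)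
  have "hT z1 = 0"
  proof (rule analytic_continuation_open[of "B \<inter> {z. Im z < 0}" B hT "\<lambda>_. 0"])
    have "- z1 \<in> B \<inter> {z. Im z < 0}" using z1 by (simp add: B_def)
    thus "B \<inter> {z. Im z < 0} \<noteq> {}" by blast
    show "connected B" unfolding B_def by simp
  qed (use z1 oL holT in \<open>auto simp: B_def hT_def\<close>)
  hence "h (W z1) = 0" using z1 by (simp add: hT_def)
  hence "g (W z1) = \<alpha>" using gi[OF WD[OF z1(3,2)]] by (simp add: h_def)
  thus False using g_D[OF WD[OF z1(3,2)]] Im_\<alpha> by (simp add: upper_half_plane_def)
qed

text \<open>If no functional bounded below on \<open>C\<close> takes a smaller value at
  \<open>p\<close> than at \<open>\<mu>\<close>, then the ray from \<open>\<mu>\<close> through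
  \<open>p\<close> never leaves the closure. From \<open>p\<close> on it avoids \<open>C\<close> by
  convexity, and so it contains an omitted boundary segment. The lower bound on \<open>C\<close> is
  what later makes averages close to \<open>p\<close> rare.\<close>

lemma functional_separating_missing_point:
  assumes p: "p \<in> closure C" "p \<notin> C" and \<mu>: "\<mu> \<in> C"
  shows "\<exists>a b. (\<forall>w\<in>C. b \<le> a \<bullet> w) \<and> a \<bullet> p < a \<bullet> \<mu>"
proof (rule ccontr)
  assume no: "\<nexists>a b. (\<forall>w\<in>C. b \<le> a \<bullet> w) \<and> a \<bullet> p < a \<bullet> \<mu>"
  define v where "v = p - \<mu>"
  have in_closure: "\<mu> + t *\<^sub>R v \<in> closure C" if "t \<ge> 0" for t
  proof (rule ccontr)
    assume "\<mu> + t *\<^sub>R v \<notin> closure C"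
    then obtain a b where ab: "a \<bullet> (\<mu> + t *\<^sub>R v) < b" "\<And>x. x \<in> closure C \<Longrightarrow> a \<bullet> x > b"
      using separating_hyperplane_closed_point[OF convex_closure[OF convex_image] closed_closure] by metis
    have "\<forall>w\<in>C. b \<le> a \<bullet> w" using ab(2) closure_subset by (meson less_imp_le subsetD)
    hence "a \<bullet> p \<ge> a \<bullet> \<mu>" using no by (meson not_le)
    hence "t * (a \<bullet> v) \<ge> 0" using that by (simp add: v_def inner_diff_right)
    moreover have "\<mu> \<in> closure C" by (rule subsetD[OF closure_subset \<mu>])
    moreover have "a \<bullet> (\<mu> + t *\<^sub>R v) = a \<bullet> \<mu> + t * (a \<bullet> v)" by (simp only: inner_add_right inner_scaleR_right)
    ultimately show False using ab(1) ab(2)[of \<mu>] by linarith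
  qed
  have not_in: "\<mu> + t *\<^sub>R v \<notin> C" if "t \<ge> 1" for t
  proof
    assume "\<mu> + t *\<^sub>R v \<in> C"
    hence "(1 - 1/t) *\<^sub>R \<mu> + (1/t) *\<^sub>R (\<mu> + t *\<^sub>R v) \<in> C"
      using that \<mu> by (intro convexD[OF convex_image]) auto
    moreover have "(1 - 1/t) *\<^sub>R \<mu> + (1/t) *\<^sub>R (\<mu> + t *\<^sub>R v) = p"
      using that by (simp add: v_def algebra_simps)
    ultimately show False using p by simp
  qed
  have "v \<noteq> 0" using p \<mu> by (auto simp: v_def)
  moreover have "p + t *\<^sub>R v \<in> closure D - C" if "0 \<le> t" "t \<le> 1" for t
  proof -
    have "p + t *\<^sub>R v = \<mu> + (1 + t) *\<^sub>R v" by (simp add: v_def algebra_simps)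
    thus ?thesis using in_closure[of "1 + t"] not_in[of "1 + t"] that closure_C by simp
  qed
  ultimately show False by (rule no_missing_boundary_segment)
qed

section \<open>Recession directions of the image\<close>

section \<open>The recession cone\<close>

definition recession :: "complex set" where
  "recession = {v. \<forall>w\<in>D. \<forall>t\<ge>0. w + t *\<^sub>R v \<in> D}"

lemma recessionD: "v \<in> recession \<Longrightarrow> w \<in> D \<Longrightarrow> 0 \<le> t \<Longrightarrow> w + t *\<^sub>R v \<in> D"
  by (auto simp: recession_def)

text \<open>Directions may be tested against the closure: a ball in \<open>D\<close> about
  \<open>w\<close> is translated along with \<open>w\<close>, so the translate of \<open>w\<close>
  is interior to the closure, and the interior of the closure is \<open>D\<close> again.\<close>

lemma recessionI_closure:
  assumes "\<And>w t. w \<in> D \<Longrightarrow> 0 \<le> t \<Longrightarrow> w + t *\<^sub>R v \<in> closure D"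
  shows "v \<in> recession"
  unfolding recession_def
proof (intro CollectI ballI allI impI)
  fix w t assume w: "w \<in> D" and t: "0 \<le> (t::real)"
  obtain r where r: "r > 0" "ball w r \<subseteq> D" using open_D w openE by blast
  have "ball (w + t *\<^sub>R v) r \<subseteq> closure D"
  proof
    fix x assume "x \<in> ball (w + t *\<^sub>R v) r"
    hence "x - t *\<^sub>R v \<in> ball w r" by (simp add: dist_norm algebra_simps)
    hence "x - t *\<^sub>R v \<in> D" using r by blast
    from assms[OF this t] show "x \<in> closure D" by simp
  qed
  hence "ball (w + t *\<^sub>R v) r \<subseteq> interior (closure D)" by (intro interior_maximal) auto
  thus "w + t *\<^sub>R v \<in> D" using r(1) interior_closure_D centre_in_ball by blast
qed

text \<open>\<open>x + t v\<close> is the limit of convex combinations of \<open>x\<close> and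
  \<open>w n\<close> in which \<open>w n\<close> has the weight t / |w n|.\<close>

lemma recession_limit:
  assumes w: "\<And>n. w n \<in> D" and inf: "filterlim w at_infinity sequentially"
    and lim: "(\<lambda>n. w n /\<^sub>R norm (w n)) \<longlonglongrightarrow> v"
  shows "v \<in> recession"
proof (rule recessionI_closure)
  fix x t assume x: "x \<in> D" and t: "0 \<le> (t::real)"
  define l where "l n = t * inverse (norm (w n))" for n
  have "filterlim (\<lambda>n. norm (w n)) at_top sequentially"
    by (rule filterlim_compose[OF filterlim_norm_at_top inf])
  hence "(\<lambda>n. inverse (norm (w n))) \<longlonglongrightarrow> 0"
    by (rule filterlim_compose[OF tendsto_inverse_0_at_top[OF filterlim_ident]])
  hence l0: "l \<longlonglongrightarrow> 0" unfolding l_def by (intro tendsto_mult_right_zero)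
  hence ev: "\<forall>\<^sub>F n in sequentially. l n < 1" by (rule order_tendstoD) simp
  have "(\<lambda>n. (1 - l n) *\<^sub>R x + t *\<^sub>R (w n /\<^sub>R norm (w n))) \<longlonglongrightarrow> (1 - 0) *\<^sub>R x + t *\<^sub>R v"
    by (intro tendsto_intros l0 lim)
  moreover have "\<forall>\<^sub>F n in sequentially. (1 - l n) *\<^sub>R x + t *\<^sub>R (w n /\<^sub>R norm (w n)) \<in> closure D"
    using ev
  proof eventually_elim
    case (elim n)
    have "(1 - l n) *\<^sub>R x + l n *\<^sub>R w n \<in> D"
      using elim t x w by (intro convexD[OF convex_D]) (auto simp: l_def)
    hence "(1 - l n) *\<^sub>R x + l n *\<^sub>R w n \<in> closure D" by (rule subsetD[OF closure_subset])
    thus ?case by (simp add: l_def)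
  qed
  ultimately have "(1 - 0) *\<^sub>R x + t *\<^sub>R v \<in> closure D"
    by (intro Lim_in_closed_set[OF closed_closure _ sequentially_bot])
  thus "x + t *\<^sub>R v \<in> closure D" by simp
qed

lemma recession_add:
  assumes "v1 \<in> recession" "v2 \<in> recession" "0 \<le> s" "0 \<le> t"
  shows "s *\<^sub>R v1 + t *\<^sub>R v2 \<in> recession"
  unfolding recession_def
proof (intro CollectI ballI allI impI)
  fix w r assume "w \<in> D" "0 \<le> (r::real)"
  hence "(w + (r * s) *\<^sub>R v1) + (r * t) *\<^sub>R v2 \<in> D"
    using assms by (intro recessionD) auto
  thus "w + r *\<^sub>R (s *\<^sub>R v1 + t *\<^sub>R v2) \<in> D" by (simp add: algebra_simps)
qed

lemma closed_recession: "closed recession"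
  unfolding closed_sequential_limits
proof (intro allI impI, elim conjE)
  fix v l assume v: "\<forall>n. v n \<in> recession" and lim: "v \<longlonglongrightarrow> l"
  show "l \<in> recession"
  proof (rule recessionI_closure)
    fix w t assume w: "w \<in> D" "0 \<le> (t::real)"
    have lim': "(\<lambda>n. w + t *\<^sub>R v n) \<longlonglongrightarrow> w + t *\<^sub>R l" by (intro tendsto_intros lim)
    have "w + t *\<^sub>R v n \<in> closure D" for n
      using recessionD[of "v n" w t] v w subsetD[OF closure_subset] by simp
    thus "w + t *\<^sub>R l \<in> closure D"
      by (rule closed_sequentially[OF closed_closure _ lim'])
  qed
qed

lemma recession_of_unbounded:
  assumes w: "\<And>n. w n \<in> D" and inf: "filterlim w at_infinity sequentially"
  obtains v r where "v \<in> recession" "norm v = 1" "strict_mono r"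
    "(\<lambda>n. w (r n) /\<^sub>R norm (w (r n))) \<longlonglongrightarrow> v"
proof -
  have "w n /\<^sub>R norm (w n) \<in> cball 0 1" for n by (cases "w n = 0") auto
  then obtain v r where r: "strict_mono r" "((\<lambda>n. w n /\<^sub>R norm (w n)) \<circ> r) \<longlonglongrightarrow> v"
    using seq_compactE[OF compact_imp_seq_compact[OF compact_cball], of "\<lambda>n. w n /\<^sub>R norm (w n)" 0 1] by metis
  have inf': "filterlim (\<lambda>n. w (r n)) at_infinity sequentially"
    by (rule filterlim_compose[OF inf filterlim_subseq[OF r(1)]])
  have lim: "(\<lambda>n. w (r n) /\<^sub>R norm (w (r n))) \<longlonglongrightarrow> v" using r(2) by (simp add: o_def)
  have "v \<in> recession" by (rule recession_limit[OF w inf' lim])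
  moreover have "norm v = 1"
  proof -
    have "(\<lambda>n. norm (w (r n) /\<^sub>R norm (w (r n)))) \<longlonglongrightarrow> norm v" by (intro tendsto_intros lim)
    moreover have "\<forall>\<^sub>F n in sequentially. 1 \<le> norm (w (r n))"
      using inf' unfolding filterlim_at_infinity[of 0, OF order_refl] by simp
    hence "\<forall>\<^sub>F n in sequentially. norm (w (r n) /\<^sub>R norm (w (r n))) = 1"
    proof eventually_elim
      case (elim n)
      hence "norm (w (r n)) \<noteq> 0" by linarith
      thus ?case by simp
    qed
    ultimately have "(\<lambda>n. 1) \<longlonglongrightarrow> norm v"
      by (rule Lim_transform_eventually)
    thus ?thesis by (simp add: LIMSEQ_const_iff)
  qed
  ultimately show ?thesis using that r(1) lim by blast
qed

text \<open>Were the functional unbounded below, points with values tending to minus infinity would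
  run off to infinity, and a limit of their normalizations would be a recession direction on which
  \<open>a\<close> is not positive.\<close>

lemma functional_bounded_below:
  assumes pos: "\<And>v. v \<in> recession \<Longrightarrow> v \<noteq> 0 \<Longrightarrow> a \<bullet> v > 0"
  shows "\<exists>b. \<forall>w\<in>D. b \<le> a \<bullet> w"
proof (rule ccontr)
  assume "\<nexists>b. \<forall>w\<in>D. b \<le> a \<bullet> w"
  hence "\<exists>w\<in>D. a \<bullet> w < - real n" for n by (meson not_le)
  then obtain w where w: "\<And>n. w n \<in> D" "\<And>n. a \<bullet> w n < - real n" by metis
  have large: "real n \<le> norm a * norm (w n)" for n
    using Cauchy_Schwarz_ineq2[of a "w n"] w(2)[of n] by linarith
  have a0: "norm a > 0" using large[of 1] by (cases "a = 0") auto
  have "filterlim (\<lambda>n. norm (w n)) at_top sequentially"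
  proof (rule filterlim_at_top_mono)
    show "filterlim (\<lambda>n. inverse (norm a) * real n) at_top sequentially"
      using a0 by (intro filterlim_tendsto_pos_mult_at_top[OF tendsto_const] filterlim_real_sequentially) auto
    show "\<forall>\<^sub>F n in sequentially. inverse (norm a) * real n \<le> norm (w n)"
      using large a0 by (intro always_eventually allI) (simp add: field_simps)
  qed
  hence inf: "filterlim w at_infinity sequentially" by (rule filterlim_norm_at_top_imp_at_infinity)
  obtain v r where v: "v \<in> recession" "norm v = 1" and r: "strict_mono r"
    and lim: "(\<lambda>n. w (r n) /\<^sub>R norm (w (r n))) \<longlonglongrightarrow> v"
    using recession_of_unbounded[OF w(1) inf] by metis
  have "(\<lambda>n. a \<bullet> (w (r n) /\<^sub>R norm (w (r n)))) \<longlonglongrightarrow> a \<bullet> v" by (intro tendsto_intros lim)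
  moreover have "a \<bullet> (w (r n) /\<^sub>R norm (w (r n))) \<le> 0" for n
  proof -
    have "a \<bullet> w (r n) \<le> 0" using w(2)[of "r n"] by (meson less_imp_le neg_le_0_iff_le of_nat_0_le_iff order_trans)
    thus ?thesis by (simp add: mult_nonneg_nonpos)
  qed
  ultimately have "a \<bullet> v \<le> 0" by (intro LIMSEQ_le_const2) auto
  moreover have "v \<noteq> 0" using v by auto
  ultimately show False using pos[OF v(1)] by simp
qed

text \<open>Growth bounds are derived on \<open>D\<close>, where \<open>g\<close> takes values in
  the open half-plane, and extended by continuity to \<open>C\<close>, where the averages
  live.\<close>

lemma le_on_C_if_le_on_D:
  fixes \<phi> \<psi> :: "complex \<Rightarrow> real"
  assumes le: "\<And>w. w \<in> D \<Longrightarrow> \<phi> w \<le> \<psi> w"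
    and cont: "continuous_on (f ` U) \<phi>" "continuous_on (f ` U) \<psi>" and w: "w \<in> C"
  shows "\<phi> w \<le> \<psi> w"
proof -
  obtain z where z: "z \<in> K" "w = f z" using w by blast
  define x where "x n = f (z + \<i> * complex_of_real (inverse (real (Suc n))))" for n
  have x: "x \<longlonglongrightarrow> w" "\<And>n. x n \<in> D"
    using K_limit_of_upper_half_plane[OF z(1)] z(2) unfolding x_def by auto
  have c: "isCont \<phi> w" "isCont \<psi> w"
    using cont open_image w C_subset by (auto simp: continuous_on_eq_continuous_at)
  show ?thesis
    using LIMSEQ_le[OF isCont_tendsto_compose[OF c(1) x(1)] isCont_tendsto_compose[OF c(2) x(1)]]
      le x(2) by blast
qed

text \<open>A real point of \<open>K\<close> has its value outside \<open>D\<close>, by injectivity.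
  This prevents an image containing lines from extending to infinity on both sides of them.\<close>

lemma D_ne_UNIV: "D \<noteq> UNIV"
proof
  assume D: "D = UNIV"
  obtain x :: complex where x: "x \<in> K" "Im x = 0"
  proof (cases "\<alpha> = 0")
    case True show ?thesis by (rule that[of 1]) (auto simp: closed_upper_half_plane_def True)
  next
    case False thus ?thesis by (intro that[of 0]) (auto simp: closed_upper_half_plane_def)
  qed
  have "f x \<in> D" using D by simp
  hence "g (f x) \<in> upper_half_plane" by (rule g_D)
  moreover have "g (f x) = x" using g_f x dom_subset by blast
  ultimately show False using x by (simp add: upper_half_plane_def)
qed

text \<open>Points of \<open>K\<close> can be nudged upwards into the open half-plane without
  spoiling the strict inequalities on |z| and |f z|.\<close>

lemma unbounded_near_infinity_sequence:
  assumes unb: "\<And>R. \<exists>z\<in>K. norm z > R \<and> norm (f z) > R"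
  obtains c where "\<And>n. c n \<in> upper_half_plane" "filterlim c at_infinity sequentially"
    "filterlim (\<lambda>n. f (c n)) at_infinity sequentially"
proof -
  have "\<exists>c. c \<in> upper_half_plane \<and> norm c > real n \<and> norm (f c) > real n" for n :: nat
  proof -
    obtain z where z: "z \<in> K" "norm z > real n" "norm (f z) > real n" using unb by blast
    have "\<forall>\<^sub>F k in sequentially. norm (z + \<i> * complex_of_real (inverse (real (Suc k)))) > real n"
      by (rule order_tendstoD(1)[OF tendsto_norm[OF K_limit_of_upper_half_plane(1)[OF z(1)]] z(2)])
    moreover have "\<forall>\<^sub>F k in sequentially. norm (f (z + \<i> * complex_of_real (inverse (real (Suc k))))) > real n"
      by (rule order_tendstoD(1)[OF tendsto_norm[OF K_limit_of_upper_half_plane(3)[OF z(1)]] z(3)])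
    ultimately obtain k where "norm (z + \<i> * complex_of_real (inverse (real (Suc k)))) > real n \<and>
        norm (f (z + \<i> * complex_of_real (inverse (real (Suc k))))) > real n"
      using eventually_happens[OF eventually_conj] sequentially_bot by blast
    thus ?thesis using K_limit_of_upper_half_plane(2)[OF z(1), of k] by blast
  qed
  then obtain c where c: "\<And>n::nat. c n \<in> upper_half_plane" "\<And>n. norm (c n) > real n" "\<And>n. norm (f (c n)) > real n"
    by metis
  have "filterlim (\<lambda>n. norm (c n)) at_top sequentially" "filterlim (\<lambda>n. norm (f (c n))) at_top sequentially"
    by (rule filterlim_at_top_mono[OF filterlim_real_sequentially], use c in \<open>auto intro!: always_eventually less_imp_le\<close>)+
  thus ?thesis
    by (intro that[of c] c(1) filterlim_norm_at_top_imp_at_infinity)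
qed

end

section \<open>Half-planes and strips\<close>

section \<open>Images containing a line\<close>

lemma Moebius_bounded_near_infinity:
  fixes A B C E :: complex
  assumes C: "C \<noteq> 0"
  shows "\<exists>R>0. \<forall>w. R \<le> norm w \<longrightarrow> norm ((A * w + B) / (C * w + E)) \<le> R"
proof -
  define Q where "Q = 2 * (norm A + norm B) / norm C"
  define R where "R = 1 + 2 * norm E / norm C + Q"
  have Q: "Q \<ge> 0" by (simp add: Q_def)
  have "norm ((A * w + B) / (C * w + E)) \<le> R" if w: "R \<le> norm w" for w
  proof -
    have w1: "norm w \<ge> 1" "norm w \<ge> 2 * norm E / norm C" using w Q by (auto simp: R_def intro: order_trans[rotated])
    hence "norm E \<le> norm C * norm w / 2" using C by (simp add: field_simps)
    moreover have "norm (C * w + E) \<ge> norm C * norm w - norm E"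
      using norm_diff_ineq[of "C * w" E] by (simp add: norm_mult)
    ultimately have den: "norm (C * w + E) \<ge> norm C * norm w / 2" by linarith
    have "norm (A * w + B) \<le> norm A * norm w + norm B * 1"
      using norm_triangle_ineq[of "A * w" B] by (simp add: norm_mult)
    also have "\<dots> \<le> norm A * norm w + norm B * norm w" using w1 by (intro add_left_mono mult_left_mono) auto
    finally have num: "norm (A * w + B) \<le> (norm A + norm B) * norm w" by (simp add: algebra_simps)
    have pos: "norm C * norm w / 2 > 0" using C w1 by (intro divide_pos_pos mult_pos_pos) auto
    have "norm ((A * w + B) / (C * w + E)) \<le> ((norm A + norm B) * norm w) / (norm C * norm w / 2)"
      unfolding norm_divide using num den pos by (intro frac_le) auto
    also have "\<dots> = Q"
    proof -
      have "norm w \<noteq> 0" "norm C \<noteq> 0" using C w1 by auto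
      thus ?thesis unfolding Q_def by (simp add: divide_simps)
    qed
    also have "Q \<le> R" by (simp add: R_def)
    finally show ?thesis .
  qed
  moreover have "R > 0" using Q by (simp add: R_def add_pos_nonneg)
  ultimately show ?thesis by blast
qed

text \<open>Substituting 1 / w exchanges \<open>A\<close> with \<open>B\<close> and \<open>C\<close>
  with \<open>E\<close>, which reduces the claim to the behaviour at infinity.\<close>

lemma Moebius_bounded_near_zero:
  fixes A B C E :: complex
  assumes E: "E \<noteq> 0"
  shows "\<exists>R>0. \<forall>w. w \<noteq> 0 \<longrightarrow> norm w \<le> 1 / R \<longrightarrow> norm ((A * w + B) / (C * w + E)) \<le> R"
proof -
  obtain R where R: "R > 0" "\<And>w. R \<le> norm w \<Longrightarrow> norm ((B * w + A) / (E * w + C)) \<le> R"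
    using Moebius_bounded_near_infinity[OF E] by blast
  have "norm ((A * w + B) / (C * w + E)) \<le> R" if "w \<noteq> 0" "norm w \<le> 1 / R" for w
  proof -
    have "R \<le> norm (1 / w)" using that R(1) by (simp add: norm_divide field_simps)
    hence "norm ((B * (1 / w) + A) / (E * (1 / w) + C)) \<le> R" by (rule R(2))
    moreover have "(B * (1 / w) + A) / (E * (1 / w) + C) = (A * w + B) / (C * w + E)"
    proof -
      have "B * (1 / w) + A = (A * w + B) / w" "E * (1 / w) + C = (C * w + E) / w"
        using that by (auto simp: field_simps)
      thus ?thesis using that by simp
    qed
    ultimately show ?thesis by simp
  qed
  thus ?thesis using R(1) by blast
qed

context convex_half_plane_map
begin

text \<open>For a conformal map \<open>E\<close> of \<open>D\<close> onto the half-plane,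
  \<open>E\<close> after \<open>f\<close> is an automorphism of the half-plane, hence a Moebius map;
  an explicit \<open>E\<close> therefore makes \<open>g\<close> explicit.\<close>

lemma inverse_factors_through_Moebius:
  assumes E: "E holomorphic_on D" "\<And>w. w \<in> D \<Longrightarrow> E w \<in> upper_half_plane"
    and E': "E' holomorphic_on upper_half_plane" "\<And>z. z \<in> upper_half_plane \<Longrightarrow> E' z \<in> D"
    and inv: "\<And>w. w \<in> D \<Longrightarrow> E' (E w) = w" "\<And>z. z \<in> upper_half_plane \<Longrightarrow> E (E' z) = z"
  obtains A B C' G' where "\<And>w. w \<in> D \<Longrightarrow> C' * E w + G' \<noteq> 0"
    "\<And>w. w \<in> D \<Longrightarrow> g w = (A * E w + B) / (C' * E w + G')"
proof -
  have F: "(E \<circ> f) holomorphic_on upper_half_plane"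
    by (rule holomorphic_on_compose_gen[OF holomorphic_on_subset[OF holo upper_half_plane_subset_U] E(1)]) auto
  have G: "(g \<circ> E') holomorphic_on upper_half_plane"
    by (rule holomorphic_on_compose_gen[OF E'(1) holomorphic_on_subset[OF inverse_holomorphic D_subset]]) (use E'(2) in auto)
  obtain A B C' G' where M: "\<And>w. w \<in> upper_half_plane \<Longrightarrow> C' * w + G' \<noteq> 0"
    "\<And>w. w \<in> upper_half_plane \<Longrightarrow> (g \<circ> E') w = (A * w + B) / (C' * w + G')"
  proof (rule upper_half_plane_automorphism_Moebius[OF F _ G])
    show "(E \<circ> f) ` upper_half_plane \<subseteq> upper_half_plane" using E(2) by auto
    show "(g \<circ> E') ` upper_half_plane \<subseteq> upper_half_plane" using E'(2) g_D by auto
    show "(g \<circ> E') ((E \<circ> f) z) = z" if "z \<in> upper_half_plane" for z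
      using inv(1)[of "f z"] that g_f upper_half_plane_subset_U by auto
    show "(E \<circ> f) ((g \<circ> E') z) = z" if "z \<in> upper_half_plane" for z
      using f_g[of "E' z"] E'(2)[OF that] D_subset inv(2)[OF that] by auto
  qed blast
  show ?thesis
  proof (rule that[of C' G' A B])
    fix w assume w: "w \<in> D"
    show "C' * E w + G' \<noteq> 0" using M(1)[OF E(2)[OF w]] .
    show "g w = (A * E w + B) / (C' * E w + G')" using M(2)[OF E(2)[OF w]] inv(1)[OF w] by simp
  qed
qed

text \<open>\<open>D\<close> is a union of full lines in direction \<open>v\<close>, so membership
  depends only on Im (w / v), and by convexity the admissible values form an interval.\<close>

lemma saturated_along_line:
  assumes v: "v \<noteq> 0" "v \<in> recession" "- v \<in> recession"
    and w1: "w1 \<in> D" "Im (w1 / v) \<le> Im (w / v)" and w2: "w2 \<in> D" "Im (w / v) \<le> Im (w2 / v)"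
  shows "w \<in> D"
proof -
  have "\<exists>l\<ge>0. l \<le> 1 \<and> (1 - l) * Im (w1 / v) + l * Im (w2 / v) = Im (w / v)"
  proof (cases "Im (w1 / v) = Im (w2 / v)")
    case True thus ?thesis using w1 w2 by (intro exI[of _ 0]) auto
  next
    case False
    hence d: "Im (w2 / v) - Im (w1 / v) > 0" using w1 w2 by linarith
    define l where "l = (Im (w / v) - Im (w1 / v)) / (Im (w2 / v) - Im (w1 / v))"
    have "l * (Im (w2 / v) - Im (w1 / v)) = Im (w / v) - Im (w1 / v)" using d by (simp add: l_def)
    hence "(1 - l) * Im (w1 / v) + l * Im (w2 / v) = Im (w / v)" by (simp add: algebra_simps)
    moreover have "0 \<le> l" "l \<le> 1" using d w1 w2 by (auto simp: l_def divide_le_eq)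
    ultimately show ?thesis by blast
  qed
  then obtain l where l: "0 \<le> l" "l \<le> 1" "(1 - l) * Im (w1 / v) + l * Im (w2 / v) = Im (w / v)" by blast
  define x where "x = (1 - l) *\<^sub>R w1 + l *\<^sub>R w2"
  have x: "x \<in> D" unfolding x_def using l w1 w2 by (intro convexD[OF convex_D]) auto
  have "x / v = (1 - l) *\<^sub>R (w1 / v) + l *\<^sub>R (w2 / v)"
    by (simp add: x_def scaleR_conv_of_real add_divide_distrib)
  hence Im: "Im (x / v) = Im (w / v)" using l by simp
  define s where "s = Re (w / v) - Re (x / v)"
  have "w / v = x / v + complex_of_real s" using Im by (simp add: complex_eq_iff s_def)
  hence eq: "w = x + s *\<^sub>R v" using v by (simp add: field_simps scaleR_conv_of_real)
  show ?thesis
  proof (cases "s \<ge> 0")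
    case True thus ?thesis using recessionD[OF v(2) x] eq by simp
  next
    case False thus ?thesis using recessionD[OF v(3) x, of "- s"] eq by simp
  qed
qed

lemma D_perturb_along:
  assumes v: "v \<noteq> 0" and w: "w \<in> D"
  obtains e where "e > 0" "w + \<i> * v * complex_of_real e \<in> D" "w - \<i> * v * complex_of_real e \<in> D"
proof -
  obtain r where r: "r > 0" "cball w r \<subseteq> D" using open_D open_contains_cball w by blast
  have "w + \<i> * v * complex_of_real (r / norm v) \<in> cball w r" "w - \<i> * v * complex_of_real (r / norm v) \<in> cball w r"
    using v r(1) by (simp_all add: dist_norm norm_mult norm_divide)
  hence "w + \<i> * v * complex_of_real (r / norm v) \<in> D" "w - \<i> * v * complex_of_real (r / norm v) \<in> D"
    using r(2) by blast+
  thus ?thesis using r v by (intro that[of "r / norm v"]) simp_all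
qed

text \<open>The values Im (w / v) on \<open>D\<close> fill a half-line or a bounded interval, so
  \<open>D\<close> is a half-plane or a strip, uniformized by an affine map or by an exponential. In
  the Moebius map that remains, the pole must sit at an end of \<open>D\<close>, because
  \<open>g\<close> is unbounded near infinity.\<close>

lemma growth_if_recession_line_aux:
  assumes unb: "\<And>R. \<exists>z\<in>K. norm z > R \<and> norm (f z) > R"
    and v: "v \<noteq> 0" "v \<in> recession" "- v \<in> recession"
    and low: "\<And>w. w \<in> D \<Longrightarrow> c0 \<le> Im (w / v)"
  shows "(\<exists>A. \<forall>w\<in>C. norm (g w) \<le> A * (1 + norm w)) \<or>
    (\<exists>A \<kappa>. \<forall>w\<in>C. norm (g w) \<le> A * (1 + exp (Re (\<kappa> * w))) \<and> exp (Re (\<kappa> * w)) \<le> A * (1 + norm (g w)))"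
proof -
  obtain c where c: "\<And>n. c n \<in> upper_half_plane" and c_inf: "filterlim c at_infinity sequentially"
    and fc_inf: "filterlim (\<lambda>n. f (c n)) at_infinity sequentially"
    using unbounded_near_infinity_sequence[OF unb] by metis
  have gc: "g (f (c n)) = c n" for n using g_f c upper_half_plane_subset_U by blast
  have fcD: "f (c n) \<in> D" for n using c by blast
  have ev_c: "\<forall>\<^sub>F n in sequentially. R < norm (c n)" for R
    using filterlim_at_infinity_imp_norm_at_top[OF c_inf] unfolding filterlim_at_top_dense by blast
  have ev_fc: "\<forall>\<^sub>F n in sequentially. R < norm (f (c n))" for R
    using filterlim_at_infinity_imp_norm_at_top[OF fc_inf] unfolding filterlim_at_top_dense by blast
  have frequently_false: False if "\<forall>\<^sub>F n in sequentially. norm (c n) \<le> R" for R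
    using eventually_happens[OF eventually_conj[OF that ev_c[of R]]] by auto
  define J where "J = (\<lambda>w. Im (w / v)) ` D"
  have Jne: "J \<noteq> {}" using D_nonempty by (simp add: J_def)
  have Jbb: "bdd_below J" unfolding J_def using low by (intro bdd_belowI) auto
  define c1 where "c1 = Inf J"
  have shift: "Im ((w + \<i> * v * complex_of_real e) / v) = Im (w / v) + e"
    "Im ((w - \<i> * v * complex_of_real e) / v) = Im (w / v) - e" for w e
    using v by (simp_all add: add_divide_distrib diff_divide_distrib)
  have gt: "c1 < Im (w / v)" if w: "w \<in> D" for w
  proof -
    obtain e where e: "e > 0" "w - \<i> * v * complex_of_real e \<in> D" using D_perturb_along[OF v(1) w] by metis
    have "c1 \<le> Im (w / v) - e"
      unfolding c1_def shift(2)[symmetric] using e by (intro cInf_lower Jbb) (auto simp: J_def)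
    thus ?thesis using e by simp
  qed
  have low_ex: "\<exists>w1\<in>D. Im (w1 / v) < y" if "c1 < y" for y
    using cInf_lessD[OF Jne, of y] that by (auto simp: c1_def J_def)
  show ?thesis
  proof (cases "bdd_above J")
    case False
    have high_ex: "\<exists>w1\<in>D. y < Im (w1 / v)" for y
    proof (rule ccontr)
      assume "\<not> ?thesis"
      hence "Im (w / v) \<le> y" if "w \<in> D" for w using that by (meson not_le)
      hence "bdd_above J" unfolding J_def by (intro bdd_aboveI2)
      with False show False by contradiction
    qed
    define E where "E w = w / v - \<i> * complex_of_real c1" for w
    define E' where "E' z = v * (z + \<i> * complex_of_real c1)" for z
    obtain A B C' G' where M: "\<And>w. w \<in> D \<Longrightarrow> C' * E w + G' \<noteq> 0"
      "\<And>w. w \<in> D \<Longrightarrow> g w = (A * E w + B) / (C' * E w + G')"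
    proof (rule inverse_factors_through_Moebius[of E E'])
      show "E holomorphic_on D" unfolding E_def[abs_def] by (intro holomorphic_intros v)
      show "E' holomorphic_on upper_half_plane" unfolding E'_def[abs_def] by (intro holomorphic_intros)
      show "E w \<in> upper_half_plane" if "w \<in> D" for w
        using gt[OF that] by (simp add: E_def upper_half_plane_def)
      show "E' z \<in> D" if z: "z \<in> upper_half_plane" for z
      proof -
        have "Im (E' z / v) = Im z + c1" using v by (simp add: E'_def)
        hence "c1 < Im (E' z / v)" using z by (simp add: upper_half_plane_def)
        from low_ex[OF this] obtain w1 where "w1 \<in> D" "Im (w1 / v) < Im (E' z / v)" by metis
        moreover from high_ex[of "Im (E' z / v)"] obtain w2 where "w2 \<in> D" "Im (E' z / v) < Im (w2 / v)" by metis
        ultimately show ?thesis using saturated_along_line[OF v, of w1 "E' z" w2] by simp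
      qed
      show "E' (E w) = w" for w using v by (simp add: E_def E'_def)
      show "E (E' z) = z" for z using v by (simp add: E_def E'_def)
    qed blast
    \<comment> \<open>A nonzero \<open>C'\<close> would bound \<open>g\<close> near infinity,
      whereas \<open>f (c n)\<close> and its preimage \<open>c n\<close> tend to infinity
      together.\<close>
    have "C' = 0"
    proof (rule ccontr)
      assume "C' \<noteq> 0"
      then obtain R where R: "R > 0" "\<And>w. R \<le> norm w \<Longrightarrow> norm ((A * w + B) / (C' * w + G')) \<le> R"
        using Moebius_bounded_near_infinity[of C' A B G'] by blast
      have "\<forall>\<^sub>F n in sequentially. norm (c n) \<le> R"
        using ev_fc[of "norm v * (R + \<bar>c1\<bar>)"]
      proof eventually_elim
        case (elim n)
        have "R + \<bar>c1\<bar> < norm (f (c n) / v)" using elim v by (simp add: norm_divide field_simps)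
        moreover have "norm (f (c n) / v) - norm (\<i> * complex_of_real c1) \<le> norm (E (f (c n)))"
          unfolding E_def by (rule norm_triangle_ineq2)
        ultimately have "R \<le> norm (E (f (c n)))" by (simp add: norm_mult)
        from R(2)[OF this] show ?case using M(2)[OF fcD] gc by simp
      qed
      thus False by (rule frequently_false)
    qed
    define A1 where "A1 = (norm A * (1 / norm v + \<bar>c1\<bar>) + norm B) / norm G'"
    have "norm (g w) \<le> A1 * (1 + norm w)" if "w \<in> D" for w
    proof -
      have "norm (E w) \<le> norm w / norm v + \<bar>c1\<bar>"
        unfolding E_def using norm_triangle_ineq4[of "w / v" "\<i> * complex_of_real c1"] by (simp add: norm_divide norm_mult)
      also have "\<dots> \<le> (norm w / norm v + \<bar>c1\<bar>) + (1 / norm v + \<bar>c1\<bar> * norm w)" by simp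
      also have "\<dots> = (1 / norm v + \<bar>c1\<bar>) * (1 + norm w)" by (simp add: algebra_simps add_divide_distrib)
      finally have "norm A * norm (E w) + norm B \<le> norm A * ((1 / norm v + \<bar>c1\<bar>) * (1 + norm w)) + norm B * (1 + norm w)"
        by (intro add_mono mult_left_mono) (auto simp: algebra_simps)
      moreover have "norm (A * E w + B) \<le> norm A * norm (E w) + norm B"
        using norm_triangle_ineq[of "A * E w" B] by (simp add: norm_mult)
      ultimately have "norm (A * E w + B) \<le> (norm A * (1 / norm v + \<bar>c1\<bar>) + norm B) * (1 + norm w)"
        by (simp add: algebra_simps)
      hence "norm (A * E w + B) / norm G' \<le> (norm A * (1 / norm v + \<bar>c1\<bar>) + norm B) * (1 + norm w) / norm G'"
        by (intro divide_right_mono) auto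
      thus ?thesis using M(2)[OF that] \<open>C' = 0\<close> by (simp add: norm_divide A1_def)
    qed
    hence "norm (g w) \<le> A1 * (1 + norm w)" if "w \<in> C" for w
      by (rule le_on_C_if_le_on_D[OF _ _ _ that]) (auto intro!: continuous_intros continuous_g)
    thus ?thesis by blast
  next
    case True
    define c2 where "c2 = Sup J"
    have lt: "Im (w / v) < c2" if w: "w \<in> D" for w
    proof -
      obtain e where e: "e > 0" "w + \<i> * v * complex_of_real e \<in> D" using D_perturb_along[OF v(1) w] by metis
      have "Im (w / v) + e \<le> c2"
        unfolding c2_def shift(1)[symmetric] using e by (intro cSup_upper True) (auto simp: J_def)
      thus ?thesis using e by simp
    qed
    have high_ex: "\<exists>w1\<in>D. y < Im (w1 / v)" if "y < c2" for y
      using less_cSupD[OF Jne, of y] that by (auto simp: c2_def J_def)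
    have c12: "c2 - c1 > 0"
    proof -
      obtain w where "w \<in> D" using D_nonempty by blast
      from gt[OF this] lt[OF this] show ?thesis by simp
    qed
    \<comment> \<open>The scaling that gives the strip the width \<pi>, so that the exponential maps
      it onto the half-plane.\<close>
    define k where "k = pi / (c2 - c1)"
    have k: "k > 0" using c12 by (simp add: k_def)
    define E where "E w = exp (complex_of_real k * (w / v - \<i> * complex_of_real c1))" for w
    define E' where "E' z = v * (Ln z / complex_of_real k + \<i> * complex_of_real c1)" for z
    have Imk: "Im (complex_of_real k * (w / v - \<i> * complex_of_real c1)) \<in> {0<..<pi}" if "w \<in> D" for w
    proof -
      have "0 < k * (Im (w / v) - c1)" using gt[OF that] k by simp
      moreover have "k * (Im (w / v) - c1) < k * (c2 - c1)" using lt[OF that] k by simp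
      hence "k * (Im (w / v) - c1) < pi" using c12 by (simp add: k_def)
      ultimately show ?thesis by simp
    qed
    obtain A B C' G' where M: "\<And>w. w \<in> D \<Longrightarrow> C' * E w + G' \<noteq> 0"
      "\<And>w. w \<in> D \<Longrightarrow> g w = (A * E w + B) / (C' * E w + G')"
    proof (rule inverse_factors_through_Moebius[of E E'])
      show "E holomorphic_on D" unfolding E_def[abs_def] by (intro holomorphic_intros v)
      show "E' holomorphic_on upper_half_plane" unfolding E'_def[abs_def]
        using k by (intro holomorphic_intros) (auto simp: upper_half_plane_def complex_nonpos_Reals_iff)
      show "E w \<in> upper_half_plane" if "w \<in> D" for w
        using Imk[OF that] by (simp add: E_def upper_half_plane_def Im_exp sin_gt_zero)
      show "E' z \<in> D" if z: "z \<in> upper_half_plane" for z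
      proof -
        have z0: "z \<noteq> 0" "Im z > 0" using z by (auto simp: upper_half_plane_def)
        have "Im (E' z / v) = Im (Ln z) / k + c1" using v by (simp add: E'_def)
        moreover have Ln: "0 < Im (Ln z)" "Im (Ln z) < pi" using Im_Ln_pos_lt[OF z0(1)] z0(2) by auto
        moreover have "0 < Im (Ln z) / k" using Ln k by simp
        moreover have "Im (Ln z) / k < pi / k" using Ln k by (intro divide_strict_right_mono) auto
        moreover have "pi / k = c2 - c1" using c12 by (simp add: k_def)
        ultimately have "c1 < Im (E' z / v)" "Im (E' z / v) < c2" by linarith+
        hence "\<exists>w1\<in>D. Im (w1 / v) < Im (E' z / v)" "\<exists>w2\<in>D. Im (E' z / v) < Im (w2 / v)"
          using low_ex[of "Im (E' z / v)"] high_ex[of "Im (E' z / v)"] by simp_all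
        then obtain w1 w2 where "w1 \<in> D" "Im (w1 / v) < Im (E' z / v)" "w2 \<in> D" "Im (E' z / v) < Im (w2 / v)" by metis
        thus ?thesis using saturated_along_line[OF v, of w1 "E' z" w2] by simp
      qed
      show "E' (E w) = w" if "w \<in> D" for w
      proof -
        have "Ln (E w) = complex_of_real k * (w / v - \<i> * complex_of_real c1)"
          unfolding E_def using Imk[OF that] by (intro Ln_exp) auto
        thus ?thesis using v k by (simp add: E'_def)
      qed
      show "E (E' z) = z" if "z \<in> upper_half_plane" for z
      proof -
        have "z \<noteq> 0" using that by (auto simp: upper_half_plane_def)
        thus ?thesis using v k by (simp add: E_def E'_def)
      qed
    qed blast
    define \<kappa> where "\<kappa> = complex_of_real k / v"
    have Re\<kappa>: "Re (\<kappa> * w) = k * Re (w / v)" for w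
    proof -
      have "\<kappa> * w = k *\<^sub>R (w / v)" by (simp add: \<kappa>_def scaleR_conv_of_real)
      thus ?thesis by (simp only: scaleR_complex.sel)
    qed
    have nE: "norm (E w) = exp (Re (\<kappa> * w))" for w
    proof -
      have "Re (complex_of_real k * (w / v - \<i> * complex_of_real c1)) = Re (\<kappa> * w)"
        unfolding Re\<kappa> by simp
      thus ?thesis by (simp add: E_def)
    qed
    have E0: "E w \<noteq> 0" for w by (simp add: E_def)
    \<comment> \<open>At the two ends of the strip \<open>E\<close> tends to infinity and to 0. If
      both coefficients were nonzero, \<open>g\<close> would be bounded at both ends.\<close>
    have "C' = 0 \<or> G' = 0"
    proof (rule ccontr)
      assume "\<not> (C' = 0 \<or> G' = 0)"
      hence "C' \<noteq> 0" "G' \<noteq> 0" by auto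
      obtain R where R: "R > 0" "\<And>w. R \<le> norm w \<Longrightarrow> norm ((A * w + B) / (C' * w + G')) \<le> R"
        using Moebius_bounded_near_infinity[OF \<open>C' \<noteq> 0\<close>, of A B G'] by blast
      obtain S where S: "S > 0" "\<And>w. w \<noteq> 0 \<Longrightarrow> norm w \<le> 1 / S \<Longrightarrow> norm ((A * w + B) / (C' * w + G')) \<le> S"
        using Moebius_bounded_near_zero[OF \<open>G' \<noteq> 0\<close>, of A B C'] by blast
      have "\<forall>\<^sub>F n in sequentially. norm (c n) \<le> max R S"
        using ev_fc[of "norm v * ((\<bar>ln R\<bar> + \<bar>ln S\<bar>) / k + \<bar>c1\<bar> + \<bar>c2\<bar>)"]
      proof eventually_elim
        case (elim n)
        define x where "x = f (c n) / v"
        have "norm x > (\<bar>ln R\<bar> + \<bar>ln S\<bar>) / k + \<bar>c1\<bar> + \<bar>c2\<bar>"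
          using elim v by (simp add: x_def norm_divide field_simps)
        moreover have "\<bar>Im x\<bar> \<le> \<bar>c1\<bar> + \<bar>c2\<bar>" using gt[OF fcD, of n] lt[OF fcD, of n] by (simp add: x_def)
        ultimately have "\<bar>Re x\<bar> > (\<bar>ln R\<bar> + \<bar>ln S\<bar>) / k" using cmod_le[of x] by linarith
        hence "\<bar>k * Re x\<bar> > \<bar>ln R\<bar> + \<bar>ln S\<bar>" using k by (simp add: abs_mult field_simps)
        moreover have "k * Re x = Re (\<kappa> * f (c n))" unfolding Re\<kappa> x_def ..
        ultimately consider "Re (\<kappa> * f (c n)) > ln R" | "Re (\<kappa> * f (c n)) < - ln S" by linarith
        thus ?case
        proof cases
          case 1
          hence "exp (ln R) \<le> norm (E (f (c n)))" unfolding nE by simp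
          hence "R \<le> norm (E (f (c n)))" using R(1) by simp
          from R(2)[OF this] show ?thesis using M(2)[OF fcD] gc by simp
        next
          case 2
          hence "norm (E (f (c n))) \<le> exp (- ln S)" unfolding nE by simp
          hence "norm (E (f (c n))) \<le> 1 / S" using S(1) by (simp add: exp_minus inverse_eq_divide)
          from S(2)[OF E0 this] show ?thesis using M(2)[OF fcD] gc by simp
        qed
      qed
      thus False by (rule frequently_false)
    qed
    \<comment> \<open>The end at which \<open>g\<close> is unbounded decides the sign of the
      exponent: \<kappa> if \<open>C'\<close> vanishes, its negative if \<open>G'\<close>
      does.\<close>
    then obtain a b \<kappa>' where ab: "\<kappa>' = \<kappa> \<or> \<kappa>' = - \<kappa>"
      "\<And>w. w \<in> D \<Longrightarrow> \<exists>x. g w = a * x + b \<and> norm x = exp (Re (\<kappa>' * w))"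
    proof
      assume C': "C' = 0"
      show ?thesis
      proof (rule that[of \<kappa> "A / G'" "B / G'"])
        show "\<exists>x. g w = A / G' * x + B / G' \<and> norm x = exp (Re (\<kappa> * w))" if "w \<in> D" for w
          using M(2)[OF that] C' nE by (intro exI[of _ "E w"]) (simp add: add_divide_distrib)
      qed simp
    next
      assume G': "G' = 0"
      show ?thesis
      proof (rule that[of "- \<kappa>" "B / C'" "A / C'"])
        show "\<exists>x. g w = B / C' * x + A / C' \<and> norm x = exp (Re (- \<kappa> * w))" if "w \<in> D" for w
        proof (intro exI[of _ "1 / E w"] conjI)
          show "g w = B / C' * (1 / E w) + A / C'" using M[OF that] G' E0[of w] by (simp add: field_simps)
          have "Re (- \<kappa> * w) = - Re (\<kappa> * w)" by (simp only: mult_minus_left uminus_complex.sel)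
          thus "norm (1 / E w) = exp (Re (- \<kappa> * w))" by (simp only: norm_divide nE exp_minus norm_one inverse_eq_divide)
        qed
      qed simp
    qed
    have a0: "a \<noteq> 0"
    proof
      assume "a = 0"
      hence "g w = b" if "w \<in> D" for w using ab(2)[OF that] by (metis add_0 mult_zero_left)
      hence "c n = b" for n using gc[of n] fcD[of n] by metis
      thus False using frequently_false[of "norm b"] by simp
    qed
    define A1 where "A1 = norm a + norm b + (1 + norm b) / norm a"
    have A1: "norm a \<le> A1" "norm b \<le> A1" "(1 + norm b) / norm a \<le> A1" by (auto simp: A1_def)
    have "norm (g w) \<le> A1 * (1 + exp (Re (\<kappa>' * w))) \<and> exp (Re (\<kappa>' * w)) \<le> A1 * (1 + norm (g w))" if w: "w \<in> D" for w
    proof -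
      obtain x where x: "g w = a * x + b" "norm x = exp (Re (\<kappa>' * w))" using ab(2)[OF w] by blast
      have "norm (g w) \<le> norm a * norm x + norm b"
        unfolding x(1) using norm_triangle_ineq[of "a * x" b] by (simp add: norm_mult)
      also have "\<dots> \<le> A1 * norm x + A1" using A1 by (intro add_mono mult_right_mono) auto
      finally have 1: "norm (g w) \<le> A1 * (1 + exp (Re (\<kappa>' * w)))" by (simp add: x(2) algebra_simps)
      have "norm a * norm x \<le> norm (g w) + norm b"
        using norm_triangle_ineq4[of "g w" b] by (simp add: x(1) norm_mult)
      also have "\<dots> \<le> (1 + norm b) * (1 + norm (g w))" by (simp add: algebra_simps)
      finally have "norm x \<le> (1 + norm b) / norm a * (1 + norm (g w))" using a0 by (simp add: field_simps)
      also have "\<dots> \<le> A1 * (1 + norm (g w))" using A1 by (intro mult_right_mono) auto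
      finally show ?thesis using 1 x(2) by simp
    qed
    hence D1: "norm (g w) \<le> A1 * (1 + exp (Re (\<kappa>' * w)))" and D2: "exp (Re (\<kappa>' * w)) \<le> A1 * (1 + norm (g w))" if "w \<in> D" for w
      using that by auto
    have "norm (g w) \<le> A1 * (1 + exp (Re (\<kappa>' * w)))" if "w \<in> C" for w
      by (rule le_on_C_if_le_on_D[OF D1 _ _ that]) (auto intro!: continuous_intros continuous_g)
    moreover have "exp (Re (\<kappa>' * w)) \<le> A1 * (1 + norm (g w))" if "w \<in> C" for w
      by (rule le_on_C_if_le_on_D[OF D2 _ _ that]) (auto intro!: continuous_intros continuous_g)
    ultimately show ?thesis by blast
  qed
qed

text \<open>\<open>D\<close> is not the whole plane, so Im (w / v) is bounded on at least one side;
  reversing \<open>v\<close> turns an upper bound into a lower one.\<close>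

lemma growth_if_recession_line:
  assumes unb: "\<And>R. \<exists>z\<in>K. norm z > R \<and> norm (f z) > R"
    and v: "v \<noteq> 0" "v \<in> recession" "- v \<in> recession"
  shows "(\<exists>A. \<forall>w\<in>C. norm (g w) \<le> A * (1 + norm w)) \<or>
    (\<exists>A \<kappa>. \<forall>w\<in>C. norm (g w) \<le> A * (1 + exp (Re (\<kappa> * w))) \<and> exp (Re (\<kappa> * w)) \<le> A * (1 + norm (g w)))"
proof -
  have "(\<exists>c. \<forall>w\<in>D. c \<le> Im (w / v)) \<or> (\<exists>c. \<forall>w\<in>D. Im (w / v) \<le> c)"
  proof (rule ccontr)
    assume no: "\<not> ?thesis"
    have low: "\<exists>w\<in>D. Im (w / v) < c" for c
    proof (rule ccontr)
      assume "\<not> ?thesis"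
      hence "\<forall>w\<in>D. c \<le> Im (w / v)" using not_le by blast
      with no show False by blast
    qed
    have high: "\<exists>w\<in>D. c < Im (w / v)" for c
    proof (rule ccontr)
      assume "\<not> ?thesis"
      hence "\<forall>w\<in>D. Im (w / v) \<le> c" using not_le by blast
      with no show False by blast
    qed
    have "w \<in> D" for w
    proof -
      obtain w1 w2 where "w1 \<in> D" "Im (w1 / v) < Im (w / v)" "w2 \<in> D" "Im (w / v) < Im (w2 / v)"
        using low[of "Im (w / v)"] high[of "Im (w / v)"] by metis
      thus "w \<in> D" using saturated_along_line[OF v, of w1 w w2] by simp
    qed
    thus False using D_ne_UNIV by blast
  qed
  thus ?thesis
  proof
    assume "\<exists>c. \<forall>w\<in>D. c \<le> Im (w / v)"
    then obtain c where "\<And>w. w \<in> D \<Longrightarrow> c \<le> Im (w / v)" by blast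
    thus ?thesis by (rule growth_if_recession_line_aux[OF unb v])
  next
    assume "\<exists>c. \<forall>w\<in>D. Im (w / v) \<le> c"
    then obtain c where c: "\<And>w. w \<in> D \<Longrightarrow> Im (w / v) \<le> c" by blast
    have 1: "- c \<le> Im (w / (- v))" if "w \<in> D" for w using c[OF that] by simp
    have 2: "- v \<noteq> 0" "- (- v) \<in> recession" using v by auto
    show ?thesis by (rule growth_if_recession_line_aux[OF unb 2(1) v(3) 2(2) 1])
  qed
qed

end

section \<open>Pointed recession cones and monotonicity of the inverse\<close>

section \<open>Recession directions\<close>

lemma inner_conv_Im: "(\<i> * cnj c) \<bullet> w = Im (c * w)"
  by (simp add: inner_complex_def)

lemma complex_polar: "z = norm z *\<^sub>R cis (Arg z)"
  using rcis_cmod_Arg[of z] by (simp add: rcis_def scaleR_conv_of_real)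

lemma Im_cis_times: "Im (cis \<beta> * z) = norm z * sin (\<beta> + Arg z)"
proof -
  have "cis \<beta> * z = norm z *\<^sub>R cis (\<beta> + Arg z)"
    by (subst (1) complex_polar[of z]) (simp only: mult_scaleR_right cis_mult)
  thus ?thesis by (simp only: scaleR_complex.sel cis.sel)
qed

lemma abs_Arg_less:
  assumes \<beta>: "0 < \<beta>" "\<beta> < pi / 2" and pos: "Im (cis \<beta> * x) > 0" "Im (cis (- \<beta>) * x) < 0"
  shows "\<bar>Arg x\<bar> < \<beta>"
proof -
  have n: "norm x > 0" using pos(1) by (cases "x = 0") auto
  have s1: "sin (\<beta> + Arg x) > 0" using pos(1) n unfolding Im_cis_times by (simp add: zero_less_mult_iff)
  have s2: "sin (- \<beta> + Arg x) < 0" using pos(2) n unfolding Im_cis_times by (simp add: mult_less_0_iff)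
  have A: "- pi < Arg x" "Arg x \<le> pi" using Arg_bounded by auto
  have "Arg x < \<beta>"
  proof (rule ccontr)
    assume "\<not> ?thesis"
    hence "sin (- \<beta> + Arg x) \<ge> 0" using A \<beta> by (intro sin_ge_zero) auto
    thus False using s2 by simp
  qed
  moreover have "- \<beta> < Arg x"
  proof (rule ccontr)
    assume "\<not> ?thesis"
    hence "sin (- (\<beta> + Arg x)) \<ge> 0" using A \<beta> by (intro sin_ge_zero) auto
    thus False using s1 unfolding sin_minus by simp
  qed
  ultimately show ?thesis by simp
qed

context convex_half_plane_map
begin

lemma recession_scaleR: "v \<in> recession \<Longrightarrow> 0 \<le> t \<Longrightarrow> t *\<^sub>R v \<in> recession"
  using recession_add[of v v t 0] by simp

text \<open>A closed cone without lines is an angle with bisector \<open>u\<close>; its opening is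
  written \<open>a * pi\<close> because the power 1 / a unfolds it to a half-plane, and a = 0 is a
  single ray. Arguments are measured from \<open>v0\<close>: pointedness keeps v / v0 off the branch
  cut, so they are continuous on the compact set of unit vectors of the cone and attain their
  extremes.\<close>

lemma recession_angle:
  assumes pointed: "\<And>v. v \<in> recession \<Longrightarrow> - v \<in> recession \<Longrightarrow> v = 0"
    and v0: "v0 \<in> recession" "norm v0 = 1"
  obtains u a where "norm u = 1" "0 \<le> a" "a < 1"
    "u * cis (a * pi / 2) \<in> recession" "u * cis (- (a * pi / 2)) \<in> recession"
    "\<And>v. v \<in> recession \<Longrightarrow> v \<noteq> 0 \<Longrightarrow> \<exists>\<omega>. \<bar>\<omega>\<bar> \<le> a * pi / 2 \<and> v = norm v *\<^sub>R (u * cis \<omega>)"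
proof -
  define S where "S = recession \<inter> sphere 0 1"
  have v00: "v0 \<noteq> 0" using v0 by auto
  have S: "compact S" unfolding S_def by (intro closed_Int_compact closed_recession compact_sphere)
  have v0S: "v0 \<in> S" using v0 by (simp add: S_def)
  have ratio: "v / v0 \<notin> \<real>\<^sub>\<le>\<^sub>0" if "v \<in> S" for v
  proof
    assume "v / v0 \<in> \<real>\<^sub>\<le>\<^sub>0"
    then obtain r where r: "v / v0 = complex_of_real r" "r \<le> 0" by (auto elim: nonpos_Reals_cases)
    have "norm (v / v0) = 1" using that v0 by (simp add: S_def norm_divide)
    hence "r = - 1" using r by simp
    hence "v = - v0" using r v00 by (simp add: field_simps)
    hence "v0 = 0" using pointed[OF v0(1)] that by (simp add: S_def)
    thus False using v00 by simp
  qed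
  have cont: "continuous_on S (\<lambda>v. Arg (v / v0))"
    using ratio v00 by (intro continuous_intros) auto
  obtain v2 where v2: "v2 \<in> S" "\<And>v. v \<in> S \<Longrightarrow> Arg (v / v0) \<le> Arg (v2 / v0)"
    using continuous_attains_sup[OF S _ cont] v0S by blast
  obtain v1 where v1: "v1 \<in> S" "\<And>v. v \<in> S \<Longrightarrow> Arg (v1 / v0) \<le> Arg (v / v0)"
    using continuous_attains_inf[OF S _ cont] v0S by blast
  define \<omega>1 where "\<omega>1 = Arg (v1 / v0)"
  define \<omega>2 where "\<omega>2 = Arg (v2 / v0)"
  have polar: "v = v0 * cis (Arg (v / v0))" if "v \<in> S" for v
  proof -
    have "v / v0 = norm (v / v0) *\<^sub>R cis (Arg (v / v0))" by (rule complex_polar)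
    also have "norm (v / v0) = 1" using that v0 by (simp add: S_def norm_divide)
    finally show ?thesis using v00 by (simp add: field_simps)
  qed
  have p1: "v1 = v0 * cis \<omega>1" and p2: "v2 = v0 * cis \<omega>2"
    using polar[OF v1(1)] polar[OF v2(1)] unfolding \<omega>1_def \<omega>2_def by simp_all
  have r1: "v1 \<in> recession" and r2: "v2 \<in> recession" using v1 v2 by (auto simp: S_def)
  have "\<omega>1 \<le> 0" "0 \<le> \<omega>2"
    using v1(2)[OF v0S] v2(2)[OF v0S] v00 by (simp_all add: \<omega>1_def \<omega>2_def)
  have "- pi < \<omega>1" unfolding \<omega>1_def using Arg_bounded by blast
  have "\<omega>2 < pi"
  proof -
    have "\<omega>2 \<noteq> pi"
    proof
      assume "\<omega>2 = pi"
      hence "v2 = - v0" using p2 by simp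
      hence "v0 = 0" using pointed[OF v0(1)] r2 by simp
      thus False using v00 by simp
    qed
    moreover have "\<omega>2 \<le> pi" unfolding \<omega>2_def using Arg_bounded by blast
    ultimately show ?thesis by simp
  qed
  \<comment> \<open>With an opening of \<pi> or more, \<open>- v1\<close>, whose argument is \<phi>,
    would lie between \<open>v0\<close> and \<open>v2\<close> and hence in the cone.\<close>
  have less: "\<omega>2 - \<omega>1 < pi"
  proof (rule ccontr)
    assume wide: "\<not> ?thesis"
    define \<phi> where "\<phi> = \<omega>1 + pi"
    have \<phi>: "0 < \<phi>" "\<phi> \<le> \<omega>2" using \<open>- pi < \<omega>1\<close> wide by (auto simp: \<phi>_def)
    have s2: "sin \<omega>2 > 0" using \<phi> \<open>\<omega>2 < pi\<close> by (intro sin_gt_zero) auto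
    have s\<phi>: "sin \<phi> \<ge> 0" using \<phi> \<open>\<omega>2 < pi\<close> by (intro sin_ge_zero) auto
    have sd: "sin (\<omega>2 - \<phi>) \<ge> 0" using \<phi> \<open>\<omega>2 < pi\<close> by (intro sin_ge_zero) auto
    have "complex_of_real (sin \<omega>2) * cis \<phi> = complex_of_real (sin (\<omega>2 - \<phi>)) + complex_of_real (sin \<phi>) * cis \<omega>2"
      by (simp add: complex_eq_iff sin_diff algebra_simps)
    hence "cis \<phi> = (sin (\<omega>2 - \<phi>) / sin \<omega>2) *\<^sub>R 1 + (sin \<phi> / sin \<omega>2) *\<^sub>R cis \<omega>2"
      using s2 by (simp add: scaleR_conv_of_real field_simps)
    hence "v0 * cis \<phi> = (sin (\<omega>2 - \<phi>) / sin \<omega>2) *\<^sub>R v0 + (sin \<phi> / sin \<omega>2) *\<^sub>R v2"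
      by (simp add: p2 scaleR_conv_of_real algebra_simps)
    hence "v0 * cis \<phi> \<in> recession"
      using recession_add[OF v0(1) r2, of "sin (\<omega>2 - \<phi>) / sin \<omega>2" "sin \<phi> / sin \<omega>2"] s2 s\<phi> sd by simp
    moreover have "v0 * cis \<phi> = - v1" by (simp add: p1 \<phi>_def cis_mult[symmetric])
    ultimately have "v1 = 0" using pointed r1 by simp
    thus False using v1 by (simp add: S_def)
  qed
  define u where "u = v0 * cis ((\<omega>1 + \<omega>2) / 2)"
  define a where "a = (\<omega>2 - \<omega>1) / pi"
  have a2: "a * pi / 2 = (\<omega>2 - \<omega>1) / 2" by (simp add: a_def)
  show ?thesis
  proof (rule that[of u a])
    show "norm u = 1" using v0 by (simp add: u_def norm_mult)
    show "0 \<le> a" "a < 1" using \<open>\<omega>1 \<le> 0\<close> \<open>0 \<le> \<omega>2\<close> less by (auto simp: a_def)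
    have "u * cis (a * pi / 2) = v2" "u * cis (- (a * pi / 2)) = v1"
      unfolding a2 u_def p1 p2 mult.assoc cis_mult by (simp_all add: field_simps)
    thus "u * cis (a * pi / 2) \<in> recession" "u * cis (- (a * pi / 2)) \<in> recession" using r1 r2 by auto
    fix v assume v: "v \<in> recession" "v \<noteq> 0"
    define x where "x = v /\<^sub>R norm v"
    have xS: "x \<in> S" using v recession_scaleR[OF v(1), of "inverse (norm v)"] by (simp add: S_def x_def)
    define \<omega> where "\<omega> = Arg (x / v0) - (\<omega>1 + \<omega>2) / 2"
    have "\<bar>\<omega>\<bar> \<le> a * pi / 2"
      using v1(2)[OF xS] v2(2)[OF xS] unfolding a2 \<omega>_def \<omega>1_def[symmetric] \<omega>2_def[symmetric] by (simp add: abs_le_iff field_simps)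
    moreover have "x = u * cis \<omega>"
      using polar[OF xS] unfolding u_def \<omega>_def mult.assoc cis_mult by simp
    moreover have "v = norm v *\<^sub>R x" using v(2) by (simp add: x_def)
    ultimately have "v = norm v *\<^sub>R (u * cis \<omega>)" "\<bar>\<omega>\<bar> \<le> a * pi / 2" by simp_all
    thus "\<exists>\<omega>. \<bar>\<omega>\<bar> \<le> a * pi / 2 \<and> v = norm v *\<^sub>R (u * cis \<omega>)" by blast
  qed
qed

text \<open>The two functionals that bound a strictly wider angle are positive on the nonzero
  recession directions, hence bounded below on \<open>D\<close>; an apex far enough back along
  \<open>- u\<close> makes both of them positive on \<open>D\<close>.\<close>

lemma D_in_sector:
  assumes u: "norm u = 1" and a: "0 \<le> a" "a < b" "b < 1"
    and rec: "\<And>v. v \<in> recession \<Longrightarrow> v \<noteq> 0 \<Longrightarrow> \<exists>\<omega>. \<bar>\<omega>\<bar> \<le> a * pi / 2 \<and> v = norm v *\<^sub>R (u * cis \<omega>)"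
  obtains p where "\<And>w. w \<in> D \<Longrightarrow> w \<noteq> p" "\<And>w. w \<in> D \<Longrightarrow> \<bar>Arg ((w - p) / u)\<bar> < b * pi / 2"
proof -
  define \<beta> where "\<beta> = b * pi / 2"
  have \<beta>: "0 < \<beta>" "\<beta> < pi / 2" "a * pi / 2 < \<beta>" using a by (auto simp: \<beta>_def)
  have u0: "u \<noteq> 0" using u by auto
  \<comment> \<open>The pair of signs \<open>c\<close>, \<open>c'\<close> treats the two sides of
    the angle at once.\<close>
  have bb: "\<exists>b. \<forall>w\<in>D. b \<le> Im (c * cis (c' * \<beta>) / u * w)" if c: "c = 1 \<and> c' = 1 \<or> c = - 1 \<and> c' = - (1::real)" for c c'
  proof -
    have "\<exists>b. \<forall>w\<in>D. b \<le> (\<i> * cnj (c * cis (c' * \<beta>) / u)) \<bullet> w"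
    proof (rule functional_bounded_below)
      fix v assume v: "v \<in> recession" "v \<noteq> 0"
      obtain \<omega> where \<omega>: "\<bar>\<omega>\<bar> \<le> a * pi / 2" "v = norm v *\<^sub>R (u * cis \<omega>)" using rec[OF v] by blast
      have "c * cis (c' * \<beta>) / u * v = norm v *\<^sub>R (c * (cis (c' * \<beta>) * cis \<omega>))"
        using u0 by (subst \<omega>(2)) simp
      also have "\<dots> = norm v *\<^sub>R (c * cis (c' * \<beta> + \<omega>))" by (simp only: cis_mult)
      finally have "Im (c * cis (c' * \<beta>) / u * v) = norm v * Im (c * cis (c' * \<beta> + \<omega>))"
        by (simp only: scaleR_complex.sel)
      also have "Im (c * cis (c' * \<beta> + \<omega>)) = sin (\<beta> + c' * \<omega>)"
        using c by (auto simp: sin_diff sin_add)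
      finally have "Im (c * cis (c' * \<beta>) / u * v) = norm v * sin (\<beta> + c' * \<omega>)" .
      moreover have "sin (\<beta> + c' * \<omega>) > 0" using c \<omega>(1) \<beta> a by (intro sin_gt_zero) auto
      ultimately show "0 < (\<i> * cnj (c * cis (c' * \<beta>) / u)) \<bullet> v" unfolding inner_conv_Im using v by simp
    qed
    thus ?thesis unfolding inner_conv_Im .
  qed
  obtain b1 where b1: "\<And>w. w \<in> D \<Longrightarrow> b1 \<le> Im (1 * cis (1 * \<beta>) / u * w)" using bb[of 1 1] by metis
  obtain b2 where b2: "\<And>w. w \<in> D \<Longrightarrow> b2 \<le> Im (- 1 * cis (- 1 * \<beta>) / u * w)" using bb[of "- 1" "- 1"] by metis
  have s: "sin \<beta> > 0" using \<beta> by (intro sin_gt_zero) auto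
  \<comment> \<open>Moving the apex back by \<open>t\<close> adds \<open>t * sin \<beta>\<close> to
    both functionals, which outweighs the lower bounds \<open>b1\<close> and
    \<open>b2\<close>.\<close>
  define t where "t = (1 + \<bar>b1\<bar> + \<bar>b2\<bar>) / sin \<beta>"
  have ts: "t * sin \<beta> = 1 + \<bar>b1\<bar> + \<bar>b2\<bar>" using s by (simp add: t_def)
  define p where "p = - (t *\<^sub>R u)"
  have main: "Im (cis \<beta> * ((w - p) / u)) > 0" "Im (cis (- \<beta>) * ((w - p) / u)) < 0" if w: "w \<in> D" for w
  proof -
    have eq: "cis x * ((w - p) / u) = cis x / u * w + t *\<^sub>R cis x" for x
      using u0 by (simp add: p_def scaleR_conv_of_real field_simps)
    have "Im (cis \<beta> * ((w - p) / u)) = Im (cis \<beta> / u * w) + t * sin \<beta>"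
      unfolding eq by (simp only: plus_complex.sel scaleR_complex.sel cis.sel)
    moreover have "Im (cis \<beta> / u * w) \<ge> b1" using b1[OF w] by simp
    ultimately show "Im (cis \<beta> * ((w - p) / u)) > 0" using ts by linarith
    have "Im (cis (- \<beta>) * ((w - p) / u)) = Im (cis (- \<beta>) / u * w) - t * sin \<beta>"
      unfolding eq by (simp only: plus_complex.sel scaleR_complex.sel cis.sel) simp
    moreover have "Im (- 1 * cis (- 1 * \<beta>) / u * w) = - Im (cis (- \<beta>) / u * w)"
      by (simp only: mult_minus_left mult_1 uminus_complex.sel divide_minus_left)
    hence "- Im (cis (- \<beta>) / u * w) \<ge> b2" using b2[OF w] by simp
    ultimately show "Im (cis (- \<beta>) * ((w - p) / u)) < 0" using ts by linarith
  qed
  show ?thesis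
  proof (rule that[of p])
    fix w assume w: "w \<in> D"
    show "\<bar>Arg ((w - p) / u)\<bar> < b * pi / 2"
      using abs_Arg_less[OF \<beta>(1,2) main[OF w]] by (simp add: \<beta>_def)
    show "w \<noteq> p" using main(1)[OF w] by auto
  qed
qed

text \<open>The arc where \<open>\<bar>z - \<alpha>\<bar> = 1\<close> separates \<open>\<alpha>\<close> from infinity, and a half-plane \<open>\<phi> \<bullet> w > s\<close> with
  \<open>s\<close> large misses its image: the convex set cut off by this half-plane lies on one side.\<close>

lemma inverse_tends_to_infinity:
  assumes unb: "\<And>R. \<exists>z\<in>K. norm z > R \<and> norm (f z) > R"
    and coercive: "k > 0" "\<And>w. w \<in> D \<Longrightarrow> k * norm w - k' \<le> \<phi> \<bullet> w"
  shows "\<exists>L. \<forall>w\<in>D. L < norm w \<longrightarrow> R < norm (g w)"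
proof -
  obtain c where c: "\<And>n. c n \<in> upper_half_plane" and c_inf: "filterlim c at_infinity sequentially"
    and fc_inf: "filterlim (\<lambda>n. f (c n)) at_infinity sequentially"
    using unbounded_near_infinity_sequence[OF unb] by metis
  have ev_c: "\<forall>\<^sub>F n in sequentially. R < norm (c n)" for R
    using filterlim_at_infinity_imp_norm_at_top[OF c_inf] unfolding filterlim_at_top_dense by blast
  have ev_fc: "\<forall>\<^sub>F n in sequentially. R < norm (f (c n))" for R
    using filterlim_at_infinity_imp_norm_at_top[OF fc_inf] unfolding filterlim_at_top_dense by blast
  have bdd: "\<exists>B. \<forall>z\<in>{z. 0 \<le> Im z} \<inter> T. norm (f z) \<le> B"
    if "compact T" "\<alpha> \<notin> T" for T
  proof -
    have "{z. 0 \<le> Im z} \<inter> T \<subseteq> K" using that by (auto simp: closed_upper_half_plane_def)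
    moreover have "compact ({z. 0 \<le> Im z} \<inter> T)" by (intro closed_Int_compact closed_halfspace_Im_ge that)
    ultimately have "compact (f ` ({z. 0 \<le> Im z} \<inter> T))"
      using dom_subset by (intro compact_continuous_image continuous_on_subset[OF continuous_f]) auto
    thus ?thesis using compact_imp_bounded bounded_iff by (metis (no_types, lifting) imageI)
  qed
  obtain B1 where B1: "\<And>z. 0 \<le> Im z \<Longrightarrow> z \<in> sphere \<alpha> 1 \<Longrightarrow> norm (f z) \<le> B1"
  proof -
    have "\<exists>B. \<forall>z\<in>{z. 0 \<le> Im z} \<inter> sphere \<alpha> 1. norm (f z) \<le> B" by (rule bdd) auto
    then obtain B where "\<forall>z\<in>{z. 0 \<le> Im z} \<inter> sphere \<alpha> 1. norm (f z) \<le> B" ..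
    thus ?thesis by (intro that[of B]) simp
  qed
  define s0 where "s0 = norm \<phi> * B1"
  define X where "X = {w \<in> D. s0 < \<phi> \<bullet> w}"
  have fB: "\<phi> \<bullet> f z \<le> s0" if "0 \<le> Im z" "z \<in> sphere \<alpha> 1" for z
  proof -
    have "\<phi> \<bullet> f z \<le> norm \<phi> * norm (f z)" using Cauchy_Schwarz_ineq2[of \<phi> "f z"] by linarith
    also have "\<dots> \<le> s0" unfolding s0_def by (intro mult_left_mono B1 that) auto
    finally show ?thesis .
  qed
  have "convex X"
  proof -
    have "X = D \<inter> {w. s0 < \<phi> \<bullet> w}" by (auto simp: X_def)
    thus ?thesis using convex_Int[OF convex_D convex_halfspace_gt] by simp
  qed
  have "continuous_on X g" by (rule continuous_on_subset[OF continuous_g]) (use D_subset in \<open>auto simp: X_def\<close>)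
  hence conn: "connected (g ` X)" using convex_connected[OF \<open>convex X\<close>] by (rule connected_continuous_image)
  have away: "dist \<alpha> (g w) \<noteq> 1" if w: "w \<in> X" for w
  proof
    assume d: "dist \<alpha> (g w) = 1"
    have wD: "w \<in> D" using w by (simp add: X_def)
    have "0 \<le> Im (g w)" using g_D[OF wD] by (simp add: upper_half_plane_def)
    hence "\<phi> \<bullet> f (g w) \<le> s0" using d by (intro fB) (auto simp: sphere_def)
    moreover have "f (g w) = w" using f_g D_subset wD by blast
    ultimately show False using w by (simp add: X_def)
  qed
  \<comment> \<open>Coercivity makes the functional large along \<open>f (c n)\<close>, so
    \<open>X\<close> contains a point whose preimage is beyond the arc; this decides on which side
    all of its preimages lie.\<close>
  have "\<forall>\<^sub>F n in sequentially. f (c n) \<in> X \<and> dist \<alpha> (c n) > 1"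
    using ev_fc[of "(s0 + k') / k"] ev_c[of "1 + norm \<alpha>"]
  proof eventually_elim
    case (elim n)
    have "s0 < k * norm (f (c n)) - k'" using elim coercive(1) by (simp add: field_simps)
    hence "f (c n) \<in> X" using coercive(2)[of "f (c n)"] c by (auto simp: X_def)
    moreover have "dist \<alpha> (c n) > 1"
      using elim(2) norm_triangle_ineq2[of "c n" \<alpha>] by (simp add: dist_norm norm_minus_commute)
    ultimately show ?case by blast
  qed
  then obtain n where n: "f (c n) \<in> X" "dist \<alpha> (c n) > 1"
    using eventually_happens'[OF sequentially_bot] by blast
  have gc: "g (f (c n)) = c n" using g_f c upper_half_plane_subset_U by blast
  have far: "dist \<alpha> (g w) > 1" if w: "w \<in> X" for w
  proof (rule ccontr)
    assume "\<not> ?thesis"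
    hence 1: "g w \<in> ball \<alpha> 1" using away[OF w] by simp
    have "g ` X \<subseteq> ball \<alpha> 1 \<union> - cball \<alpha> 1" using away by force
    moreover have "ball \<alpha> 1 \<inter> - cball \<alpha> 1 \<inter> g ` X = {}" by auto
    moreover have "ball \<alpha> 1 \<inter> g ` X \<noteq> {}" using 1 w by blast
    moreover have "- cball \<alpha> 1 \<inter> g ` X \<noteq> {}"
    proof -
      have "c n \<in> - cball \<alpha> 1" using n by simp
      moreover have "c n \<in> g ` X" using n(1) gc by (metis imageI)
      ultimately show ?thesis by blast
    qed
    moreover have "open (- cball \<alpha> 1)" by (intro open_Compl closed_cball)
    ultimately show False using connectedD[OF conn open_ball, of "- cball \<alpha> 1" \<alpha> 1] by simp
  qed
  obtain B2 where B2: "\<And>z. 0 \<le> Im z \<Longrightarrow> z \<in> cball \<alpha> (R + norm \<alpha>) - ball \<alpha> 1 \<Longrightarrow> norm (f z) \<le> B2"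
  proof -
    have "compact (cball \<alpha> (R + norm \<alpha>) - ball \<alpha> 1)" by (intro compact_diff compact_cball open_ball)
    hence "\<exists>B. \<forall>z\<in>{z. 0 \<le> Im z} \<inter> (cball \<alpha> (R + norm \<alpha>) - ball \<alpha> 1). norm (f z) \<le> B"
      by (rule bdd) simp
    then obtain B where "\<forall>z\<in>{z. 0 \<le> Im z} \<inter> (cball \<alpha> (R + norm \<alpha>) - ball \<alpha> 1). norm (f z) \<le> B" ..
    thus ?thesis by (intro that[of B]) simp
  qed
  \<comment> \<open>Beyond \<open>L\<close> a point of \<open>D\<close> belongs to \<open>X\<close>,
    so its preimage is outside the arc, and it also exceeds the bound \<open>B2\<close> for
    \<open>f\<close> on the compact half-annulus; the preimage must therefore lie beyond that
    annulus.\<close>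
  define L where "L = max B2 ((s0 + k') / k)"
  have "R < norm (g w)" if w: "w \<in> D" "L < norm w" for w
  proof (rule ccontr)
    assume small: "\<not> ?thesis"
    have "s0 < k * norm w - k'" using w(2) coercive(1) by (simp add: L_def field_simps)
    hence wX: "w \<in> X" using coercive(2)[OF w(1)] w(1) by (simp add: X_def)
    have "dist \<alpha> (g w) \<le> R + norm \<alpha>"
      using small norm_triangle_ineq4[of \<alpha> "g w"] by (simp add: dist_norm)
    hence "g w \<in> cball \<alpha> (R + norm \<alpha>) - ball \<alpha> 1" using far[OF wX] by simp
    moreover have "0 \<le> Im (g w)" using g_D[OF w(1)] by (simp add: upper_half_plane_def)
    ultimately have "norm (f (g w)) \<le> B2" by (intro B2)
    moreover have "f (g w) = w" using f_g D_subset w by blast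
    ultimately show False using w(2) by (simp add: L_def)
  qed
  thus ?thesis by blast
qed

text \<open>Wolff's argument with the centres \<open>g (w + n v)\<close>: the point
  \<open>w + t v\<close> is a convex combination of \<open>w\<close> and \<open>w + n v\<close> in
  which the latter has weight t / n, so Im g does not decrease along a recession direction. The
  claim is the infinitesimal form; the first hypothesis sends the centres to infinity.\<close>

lemma Im_deriv_inverse_nonneg:
  assumes infty: "\<And>R. \<exists>L. \<forall>w\<in>D. L < norm w \<longrightarrow> R < norm (g w)"
    and v: "v \<in> recession" and w: "w \<in> D"
  shows "0 \<le> Im (v * deriv g w)"
proof (cases "v = 0")
  case False
  have incr: "Im (g w) \<le> Im (g (w + t *\<^sub>R v))" if t: "0 \<le> t" for t
  proof -
    define x where "x n = w + real n *\<^sub>R v" for n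
    define c where "c n = g (x n)" for n
    \<comment> \<open>The cap at 1 keeps the weights admissible for the finitely many small
      \<open>n\<close>; eventually it is inactive.\<close>
    define l where "l n = min 1 (t * inverse (real n))" for n
    have xD: "x n \<in> D" for n unfolding x_def using recessionD[OF v w] by simp
    have fc: "f (c n) = x n" for n unfolding c_def by (rule f_g[OF subsetD[OF D_subset xD]])
    have fgw: "f (g w) = w" by (rule f_g[OF subsetD[OF D_subset w]])
    have x_inf: "filterlim (\<lambda>n. norm (x n)) at_top sequentially"
    proof (rule filterlim_at_top_mono)
      show "filterlim (\<lambda>n. - norm w + norm v * real n) at_top sequentially"
        using False by (intro filterlim_tendsto_add_at_top[OF tendsto_const]
            filterlim_tendsto_pos_mult_at_top[OF tendsto_const] filterlim_real_sequentially) auto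
      show "\<forall>\<^sub>F n in sequentially. - norm w + norm v * real n \<le> norm (x n)"
        using norm_diff_ineq[of "real _ *\<^sub>R v" w] by (intro always_eventually allI) (simp add: x_def add.commute mult.commute)
    qed
    have c_inf: "filterlim c at_infinity sequentially"
    proof (rule filterlim_norm_at_top_imp_at_infinity)
      show "filterlim (\<lambda>n. norm (c n)) at_top sequentially"
        unfolding filterlim_at_top_dense
      proof
        fix R
        obtain L where L: "\<And>w. w \<in> D \<Longrightarrow> L < norm w \<Longrightarrow> R < norm (g w)" using infty[of R] by metis
        have "\<forall>\<^sub>F n in sequentially. L < norm (x n)" using x_inf unfolding filterlim_at_top_dense by blast
        thus "\<forall>\<^sub>F n in sequentially. R < norm (c n)"
          by eventually_elim (use L[OF xD] in \<open>simp add: c_def\<close>)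
      qed
    qed
    have l0: "(\<lambda>n. t * inverse (real n)) \<longlonglongrightarrow> 0"
      by (intro tendsto_mult_right_zero lim_inverse_n)
    have lim: "(\<lambda>n. (1 - l n) *\<^sub>R f (g w) + l n *\<^sub>R f (c n)) \<longlonglongrightarrow> w + t *\<^sub>R v"
    proof (rule tendsto_eventually)
      have "\<forall>\<^sub>F n in sequentially. t * inverse (real n) < 1" by (rule order_tendstoD[OF l0]) simp
      thus "\<forall>\<^sub>F n in sequentially. (1 - l n) *\<^sub>R f (g w) + l n *\<^sub>R f (c n) = w + t *\<^sub>R v"
        using eventually_gt_at_top[of 0]
      proof eventually_elim
        case (elim n)
        hence "l n = t * inverse (real n)" by (simp add: l_def)
        thus ?case using elim unfolding fc fgw x_def by (simp add: algebra_simps)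
      qed
    qed
    show ?thesis
    proof (rule Im_g_ge_of_centres_to_infinity[OF _ _ c_inf _ _ lim])
      show "g w \<in> upper_half_plane" by (rule g_D[OF w])
      show "c n \<in> upper_half_plane" for n unfolding c_def by (rule g_D[OF xD])
      show "0 \<le> l n" "l n \<le> 1" for n using t by (auto simp: l_def)
      show "w + t *\<^sub>R v \<in> D" by (rule recessionD[OF v w t])
    qed
  qed
  have "g field_differentiable (at w)"
    by (rule holomorphic_on_imp_differentiable_at[OF inverse_holomorphic open_image subsetD[OF D_subset w]])
  hence der: "(g has_field_derivative deriv g w) (at w)" by (simp add: DERIV_deriv_iff_field_differentiable)
  define t where "t n = inverse (real (Suc n))" for n
  have t: "t \<longlonglongrightarrow> 0" "\<And>n. t n > 0" unfolding t_def by (rule LIMSEQ_inverse_real_of_nat) simp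
  have h0: "(\<lambda>n. t n *\<^sub>R v) \<longlonglongrightarrow> 0" using tendsto_scaleR[OF t(1) tendsto_const[of v]] by simp
  have "filterlim (\<lambda>n. t n *\<^sub>R v) (at 0) sequentially"
    using h0 t(2) False by (intro filterlim_atI) (auto intro!: always_eventually simp: less_imp_neq[THEN not_sym])
  hence "(\<lambda>n. (g (w + t n *\<^sub>R v) - g w) / (t n *\<^sub>R v)) \<longlonglongrightarrow> deriv g w"
    using der unfolding DERIV_def by (rule filterlim_compose[rotated])
  hence "(\<lambda>n. v * ((g (w + t n *\<^sub>R v) - g w) / (t n *\<^sub>R v))) \<longlonglongrightarrow> v * deriv g w"
    by (intro tendsto_intros)
  hence lim: "(\<lambda>n. Im (v * ((g (w + t n *\<^sub>R v) - g w) / (t n *\<^sub>R v)))) \<longlonglongrightarrow> Im (v * deriv g w)"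
    by (rule tendsto_Im)
  have "0 \<le> Im (v * ((g (w + t n *\<^sub>R v) - g w) / (t n *\<^sub>R v)))" for n
  proof -
    have "v * ((g (w + t n *\<^sub>R v) - g w) / (t n *\<^sub>R v)) = (g (w + t n *\<^sub>R v) - g w) /\<^sub>R t n"
      using False t(2)[of n] by (simp add: scaleR_conv_of_real field_simps)
    moreover have "Im (g (w + t n *\<^sub>R v) - g w) \<ge> 0" using incr[of "t n"] t(2)[of n] by simp
    ultimately show ?thesis using t(2)[of n] by simp
  qed
  thus ?thesis by (intro LIMSEQ_le_const[OF lim]) auto
qed simp

section \<open>Upper and lower power bounds for the inverse\<close>

section \<open>Growth of the inverse\<close>

lemma holomorphic_f_upper_half_plane: "f holomorphic_on upper_half_plane"
  by (rule holomorphic_on_subset[OF holo upper_half_plane_subset_U])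

text \<open>Since f' = 1 / g', the vertical derivative of Re ((f - p) / u) has the sign of Im (u
  g').\<close>

lemma Re_f_nondecreasing_upwards:
  assumes der: "\<And>w. w \<in> D \<Longrightarrow> 0 \<le> Im (u * deriv g w)" and u: "u \<noteq> 0"
    and z: "z \<in> upper_half_plane" and T: "0 \<le> T"
  shows "Re ((f z - p) / u) \<le> Re ((f (z + \<i> * complex_of_real T) - p) / u)"
proof -
  define F where "F s = (f (z + \<i> * s) - p) / u" for s
  have "Re (F (complex_of_real 0)) \<le> Re (F (complex_of_real T))"
  proof (rule DERIV_nonneg_imp_nondecreasing[OF T])
    fix t assume t: "0 \<le> t" "t \<le> T"
    define y where "y = z + \<i> * complex_of_real t"
    have y: "y \<in> upper_half_plane" using z t by (simp add: upper_half_plane_def y_def)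
    hence yU: "y \<in> U" using upper_half_plane_subset_U by blast
    have df: "(f has_field_derivative deriv f y) (at y)"
      using holomorphic_derivI[OF holo open_U yU] .
    have "(F has_field_derivative deriv f y * \<i> / u) (at (complex_of_real t))"
      unfolding F_def
      by (rule derivative_eq_intros DERIV_chain'[of "\<lambda>s. z + \<i> * s" _ _ _ f] df[unfolded y_def] refl | simp add: y_def u)+
    hence "((\<lambda>t. F (complex_of_real t)) has_vector_derivative deriv f y * \<i> / u) (at t)"
      by (rule has_vector_derivative_real_field)
    hence "((\<lambda>t. Re (F (complex_of_real t))) has_vector_derivative Re (deriv f y * \<i> / u)) (at t)"
      by (rule bounded_linear.has_vector_derivative[OF bounded_linear_Re])
    hence "((\<lambda>t. Re (F (complex_of_real t))) has_real_derivative Re (deriv f y * \<i> / u)) (at t)"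
      by (simp add: has_real_derivative_iff_has_vector_derivative)
    moreover have "Re (deriv f y * \<i> / u) \<ge> 0"
    proof -
      define X where "X = u * deriv g (f y)"
      have "deriv f y * deriv g (f y) = 1" by (rule deriv_g[OF yU])
      hence "deriv f y = inverse (deriv g (f y))" by (metis inverse_unique mult.commute)
      hence "deriv f y * \<i> / u = \<i> * inverse X" by (simp add: X_def field_simps)
      moreover have "Re (\<i> * inverse X) = Im X / ((Re X)\<^sup>2 + (Im X)\<^sup>2)" by simp
      moreover have "0 \<le> Im X" unfolding X_def by (rule der) (use y in blast)
      ultimately show ?thesis by simp
    qed
    ultimately show "\<exists>y. ((\<lambda>t. Re (F (complex_of_real t))) has_real_derivative y) (at t) \<and> 0 \<le> y" by blast
  qed
  thus ?thesis by (simp add: F_def)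
qed

text \<open>\<open>D\<close> lies in a sector of opening \<open>b * pi\<close>, so the power 1 / b
  of (f - p) / u, rotated by \<open>\<i>\<close>, is a self-map \<open>H\<close> of the half-plane
  and grows at most linearly away from the real axis. Points near the axis are reached because Re
  ((f - p) / u) does not decrease upwards, and in the sector this real part controls the
  modulus.\<close>

lemma norm_le_powr_norm_inverse:
  assumes u: "norm u = 1" and b: "0 < b" "b < 1"
    and p: "\<And>w. w \<in> D \<Longrightarrow> w \<noteq> p" "\<And>w. w \<in> D \<Longrightarrow> \<bar>Arg ((w - p) / u)\<bar> < b * pi / 2"
    and der: "\<And>w. w \<in> D \<Longrightarrow> 0 \<le> Im (u * deriv g w)"
  shows "\<exists>A. \<forall>w\<in>C. norm w \<le> A * (1 + norm (g w)) powr b"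
proof -
  have u0: "u \<noteq> 0" using u by auto
  define \<beta> where "\<beta> = b * pi / 2"
  have \<beta>: "0 < \<beta>" "\<beta> < pi / 2" using b by (auto simp: \<beta>_def)
  define x where "x z = (f z - p) / u" for z
  have x0: "x z \<noteq> 0" and Arg_x: "\<bar>Arg (x z)\<bar> < \<beta>" if "z \<in> upper_half_plane" for z
    using p(1)[of "f z"] p(2)[of "f z"] that u0 by (auto simp: x_def \<beta>_def)
  define H where "H z = \<i> * exp (Ln (x z) / complex_of_real b)" for z
  have H: "H holomorphic_on upper_half_plane"
  proof -
    have "x z \<notin> \<real>\<^sub>\<le>\<^sub>0" if z: "z \<in> upper_half_plane" for z
    proof
      assume "x z \<in> \<real>\<^sub>\<le>\<^sub>0"
      then obtain r where r: "x z = complex_of_real r" "r \<le> 0" by (auto elim: nonpos_Reals_cases)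
      hence "Arg (x z) = pi" using x0[OF z] by (simp add: Arg_eq_pi)
      thus False using Arg_x[OF z] \<beta> by simp
    qed
    thus ?thesis unfolding H_def x_def using u0 b
      by (intro holomorphic_intros holomorphic_f_upper_half_plane) auto
  qed
  have H2: "H ` upper_half_plane \<subseteq> upper_half_plane"
  proof (intro subsetI, elim imageE)
    fix y z assume z: "z \<in> upper_half_plane" and y: "y = H z"
    have "\<bar>Im (Ln (x z) / complex_of_real b)\<bar> < pi / 2"
    proof -
      have "\<bar>Im (Ln (x z) / complex_of_real b)\<bar> = \<bar>Arg (x z)\<bar> / b"
        using b by (simp add: Arg_eq_Im_Ln[OF x0[OF z]] abs_divide)
      also have "\<dots> < \<beta> / b" using Arg_x[OF z] b by (intro divide_strict_right_mono) auto
      also have "\<beta> / b = pi / 2" using b by (simp add: \<beta>_def)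
      finally show ?thesis .
    qed
    hence "cos (Im (Ln (x z) / complex_of_real b)) > 0" by (intro cos_gt_zero_pi; linarith)
    thus "y \<in> upper_half_plane" unfolding y H_def upper_half_plane_def by (simp add: Re_exp)
  qed
  have nH: "norm (H z) = norm (x z) powr (1 / b)" if z: "z \<in> upper_half_plane" for z
    using x0[OF z] by (simp add: H_def norm_mult powr_def)
  have nx: "norm (x z) = norm (H z) powr b" if z: "z \<in> upper_half_plane" for z
    unfolding nH[OF z] powr_powr using b x0[OF z] by simp
  define Q where "Q = (5 * norm (H \<i>)) powr b"
  have cb: "cos \<beta> > 0" using \<beta> by (intro cos_gt_zero_pi) auto
  have xb: "norm (x z) * cos \<beta> \<le> Q * (1 + norm z) powr b" if z: "z \<in> upper_half_plane" for z
  proof -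
    define r where "r = 1 + norm z"
    have r: "r \<ge> 1" by (simp add: r_def)
    \<comment> \<open>Raised by r = 1 + |z|, the point satisfies Im z' \<ge> r and |z' + \<i>| \<le>
      2 r, so the growth factor is at most 1 + 4 r \<le> 5 r.\<close>
    define z' where "z' = z + \<i> * complex_of_real r"
    have z': "z' \<in> upper_half_plane" and Imz': "Im z' \<ge> r" using z r by (auto simp: z'_def upper_half_plane_def)
    have "norm (x z) * cos \<beta> \<le> norm (x z) * cos (Arg (x z))"
    proof (intro mult_left_mono)
      have "cos \<beta> \<le> cos \<bar>Arg (x z)\<bar>" using Arg_x[OF z] \<beta> by (intro cos_monotone_0_pi_le) auto
      thus "cos \<beta> \<le> cos (Arg (x z))" by simp
    qed simp
    also have "\<dots> = Re (x z)" by (subst (3) complex_polar[of "x z"]) (simp only: scaleR_complex.sel cis.sel)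
    also have "\<dots> \<le> Re (x z')"
      unfolding x_def z'_def using r by (intro Re_f_nondecreasing_upwards[OF der u0 z]) auto
    also have "\<dots> \<le> norm (x z')" by (rule complex_Re_le_cmod)
    also have "\<dots> = norm (H z') powr b" by (rule nx[OF z'])
    also have "\<dots> \<le> (5 * norm (H \<i>) * r) powr b"
    proof (intro powr_mono2)
      have "norm (H z') \<le> norm (H \<i>) * (1 + (norm (z' + \<i>))\<^sup>2 / Im z')"
        by (rule norm_self_map_upper_half_plane_le[OF H H2 z'])
      also have "\<dots> \<le> norm (H \<i>) * (1 + (2 * r)\<^sup>2 / r)"
      proof (intro mult_left_mono add_left_mono frac_le power_mono)
        have "norm (z' + \<i>) \<le> norm z + norm (\<i> * complex_of_real r) + norm \<i>"
          unfolding z'_def by (intro norm_triangle_le add_mono) auto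
        also have "norm (\<i> * complex_of_real r) = r" using r by (simp add: norm_mult)
        also have "norm z + r + norm \<i> = 2 * r" by (simp add: r_def)
        finally show "norm (z' + \<i>) \<le> 2 * r" .
      qed (use r Imz' in auto)
      also have "(2 * r)\<^sup>2 / r = 4 * r" using r by (simp add: power2_eq_square)
      also have "norm (H \<i>) * (1 + 4 * r) \<le> norm (H \<i>) * (5 * r)" using r by (intro mult_left_mono) auto
      finally show "norm (H z') \<le> 5 * norm (H \<i>) * r" by simp
    qed (use b in auto)
    also have "\<dots> = Q * r powr b" using r by (simp add: Q_def powr_mult)
    finally show ?thesis by (simp add: r_def)
  qed
  define A where "A = norm p + Q / cos \<beta>"
  have D1: "norm w \<le> A * (1 + norm (g w)) powr b" if w: "w \<in> D" for w
  proof -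
    have z: "g w \<in> upper_half_plane" by (rule g_D[OF w])
    have fw: "f (g w) = w" by (rule f_g[OF subsetD[OF D_subset w]])
    have one: "1 \<le> (1 + norm (g w)) powr b" using b by (intro ge_one_powr_ge_zero) auto
    have "norm w \<le> norm p + norm (w - p)" using norm_triangle_ineq[of p "w - p"] by simp
    also have "norm (w - p) = norm (x (g w))" by (simp add: x_def fw norm_divide u)
    also have "\<dots> \<le> Q / cos \<beta> * (1 + norm (g w)) powr b" using xb[OF z] cb by (simp add: field_simps)
    also have "norm p + \<dots> \<le> norm p * (1 + norm (g w)) powr b + Q / cos \<beta> * (1 + norm (g w)) powr b"
      using mult_left_mono[OF one, of "norm p"] by simp
    finally show ?thesis by (simp add: A_def algebra_simps)
  qed
  have "norm w \<le> A * (1 + norm (g w)) powr b" if "w \<in> C" for w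
    by (rule le_on_C_if_le_on_D[OF D1 _ _ that])
       (use b in \<open>auto intro!: continuous_intros continuous_g simp: add_nonneg_eq_0_iff\<close>)
  thus ?thesis by blast
qed

lemma Im_g_nondecreasing_along:
  assumes u: "u \<in> recession" and w: "w \<in> D" and T: "0 \<le> T"
    and der: "\<And>x. x \<in> D \<Longrightarrow> 0 \<le> Im (c * u * deriv g x)"
  shows "Im (c * g w) \<le> Im (c * g (w + T *\<^sub>R u))"
proof -
  define F where "F s = c * g (w + s * u)" for s
  have "Im (F (complex_of_real 0)) \<le> Im (F (complex_of_real T))"
  proof (rule DERIV_nonneg_imp_nondecreasing[OF T])
    fix t assume t: "0 \<le> t" "t \<le> T"
    define y where "y = w + complex_of_real t * u"
    have y: "y \<in> D" using recessionD[OF u w t(1)] by (simp add: y_def scaleR_conv_of_real)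
    have dg: "(g has_field_derivative deriv g y) (at y)"
      by (rule holomorphic_derivI[OF inverse_holomorphic open_image subsetD[OF D_subset y]])
    have "(F has_field_derivative c * u * deriv g y) (at (complex_of_real t))"
      unfolding F_def
      by (rule derivative_eq_intros DERIV_chain'[of "\<lambda>s. w + s * u" _ _ _ g] dg[unfolded y_def] refl | simp add: y_def)+
    hence "((\<lambda>t. F (complex_of_real t)) has_vector_derivative c * u * deriv g y) (at t)"
      by (rule has_vector_derivative_real_field)
    hence "((\<lambda>t. Im (F (complex_of_real t))) has_vector_derivative Im (c * u * deriv g y)) (at t)"
      by (rule bounded_linear.has_vector_derivative[OF bounded_linear_Im])
    thus "\<exists>y. ((\<lambda>t. Im (F (complex_of_real t))) has_real_derivative y) (at t) \<and> 0 \<le> y"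
      using der[OF y] by (auto simp: has_real_derivative_iff_has_vector_derivative)
  qed
  thus ?thesis by (simp add: F_def scaleR_conv_of_real)
qed

text \<open>\<open>D\<close> contains a translate of the cone with apex \<open>f \<i>\<close>, and
  \<open>\<Psi>\<close> maps the half-plane onto the interior of this translate by the power
  \<open>a\<close>. So \<open>F\<close>, which is \<open>g\<close> after \<open>\<Psi>\<close>, is a
  self-map of the half-plane, and its linear growth is growth of order 1 / a in terms of w. An
  arbitrary \<open>w\<close> is first pushed along \<open>u\<close> deep into the cone; two rotated
  imaginary parts of \<open>g\<close> do not decrease on the way and carry the bound back.\<close>

lemma norm_inverse_le_powr_norm:
  assumes u: "norm u = 1" and a: "0 < a" "a < 1"
    and rec: "u * cis (a * pi / 2) \<in> recession" "u * cis (- (a * pi / 2)) \<in> recession"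
    and der: "\<And>v w. v \<in> recession \<Longrightarrow> w \<in> D \<Longrightarrow> 0 \<le> Im (v * deriv g w)"
  shows "\<exists>A. \<forall>w\<in>C. norm (g w) \<le> A * (1 + norm w) powr (1 / a)"
proof -
  have u0: "u \<noteq> 0" using u by auto
  define \<beta> where "\<beta> = a * pi / 2"
  have \<beta>: "0 < \<beta>" "\<beta> < pi / 2" using a by (auto simp: \<beta>_def)
  have sc: "sin \<beta> > 0" "cos \<beta> > 0" using \<beta> by (auto intro: sin_gt_zero cos_gt_zero_pi)
  have s2: "sin (2 * \<beta>) > 0" using \<beta> by (intro sin_gt_zero) auto
  \<comment> \<open>Every direction of the angle is a nonnegative combination of its two
    edges.\<close>
  have cone: "r *\<^sub>R (u * cis \<omega>) \<in> recession" if r: "0 \<le> r" and \<omega>: "\<bar>\<omega>\<bar> \<le> \<beta>" for r \<omega>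
  proof -
    have "complex_of_real (sin (2 * \<beta>)) * cis \<omega> =
        complex_of_real (sin (\<beta> + \<omega>)) * cis \<beta> + complex_of_real (sin (\<beta> - \<omega>)) * cis (- \<beta>)"
      unfolding sin_double by (simp add: complex_eq_iff sin_add sin_diff algebra_simps)
    hence "cis \<omega> = (sin (\<beta> + \<omega>) / sin (2 * \<beta>)) *\<^sub>R cis \<beta> + (sin (\<beta> - \<omega>) / sin (2 * \<beta>)) *\<^sub>R cis (- \<beta>)"
      using s2 by (simp add: scaleR_conv_of_real field_simps)
    hence "u * cis \<omega> = (sin (\<beta> + \<omega>) / sin (2 * \<beta>)) *\<^sub>R (u * cis \<beta>) + (sin (\<beta> - \<omega>) / sin (2 * \<beta>)) *\<^sub>R (u * cis (- \<beta>))"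
      by (simp add: distrib_left)
    moreover have "0 \<le> sin (\<beta> + \<omega>)" "0 \<le> sin (\<beta> - \<omega>)" using \<beta> \<omega> by (auto intro!: sin_ge_zero)
    ultimately have "u * cis \<omega> \<in> recession"
      using recession_add[OF rec[folded \<beta>_def]] s2 by simp
    thus ?thesis by (rule recession_scaleR[OF _ r])
  qed
  have urec: "u \<in> recession" using cone[of 1 0] \<beta> by simp
  \<comment> \<open>With r = |w - p|, a push by M (1 + r) along \<open>u\<close> makes the component
    of w - p along \<open>u\<close> exceed cot (\<beta> / 2) times the transversal one, so the
    argument falls below \<beta> / 2.\<close>
  define M where "M = 2 + cos (\<beta> / 2) / sin (\<beta> / 2)"
  have sc2: "sin (\<beta> / 2) > 0" "cos (\<beta> / 2) > 0" using \<beta> by (auto intro: sin_gt_zero cos_gt_zero_pi)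
  have M: "M \<ge> 2" using sc2 by (simp add: M_def)
  define p where "p = f \<i>"
  have pD: "p \<in> D" using ii_in_upper_half_plane by (auto simp: p_def)
  define \<Psi> where "\<Psi> z = p + u * exp (complex_of_real a * Ln (- \<i> * z))" for z
  have Lnz: "\<bar>Im (Ln (- \<i> * z))\<bar> < pi / 2" "- \<i> * z \<noteq> 0" if "z \<in> upper_half_plane" for z
    using Re_Ln_pos_lt[of "- \<i> * z"] that by (auto simp: upper_half_plane_def complex_eq_iff)
  have \<Psi>D: "\<Psi> z \<in> D" if z: "z \<in> upper_half_plane" for z
  proof -
    have "exp (complex_of_real a * Ln (- \<i> * z)) = exp (a * Re (Ln (- \<i> * z))) *\<^sub>R cis (a * Im (Ln (- \<i> * z)))"
      by (simp add: exp_eq_polar scaleR_conv_of_real)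
    hence "\<Psi> z = p + 1 *\<^sub>R (exp (a * Re (Ln (- \<i> * z))) *\<^sub>R (u * cis (a * Im (Ln (- \<i> * z)))))"
      by (simp add: \<Psi>_def)
    moreover have "\<bar>a * Im (Ln (- \<i> * z))\<bar> \<le> \<beta>"
      using mult_left_mono[OF less_imp_le[OF Lnz(1)[OF z]], of a] a by (simp add: abs_mult \<beta>_def)
    ultimately show ?thesis using recessionD[OF cone pD, of _ _ 1] by simp
  qed
  define F where "F z = g (\<Psi> z)" for z
  have F: "F holomorphic_on upper_half_plane" "F ` upper_half_plane \<subseteq> upper_half_plane"
  proof -
    have "- \<i> * z \<notin> \<real>\<^sub>\<le>\<^sub>0" if z: "z \<in> upper_half_plane" for z
      using z by (auto simp: upper_half_plane_def complex_nonpos_Reals_iff)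
    hence "\<Psi> holomorphic_on upper_half_plane" unfolding \<Psi>_def by (intro holomorphic_intros) auto
    hence "(g \<circ> \<Psi>) holomorphic_on upper_half_plane"
      by (rule holomorphic_on_compose_gen[OF _ holomorphic_on_subset[OF inverse_holomorphic D_subset]]) (use \<Psi>D in auto)
    thus "F holomorphic_on upper_half_plane" by (simp add: F_def[abs_def] o_def)
    show "F ` upper_half_plane \<subseteq> upper_half_plane"
      unfolding F_def using g_D[OF \<Psi>D] by auto
  qed
  define Q where "Q = ((M + 1) * (1 + norm p)) powr (1 / a)"
  define A where "A = (1 / sin \<beta> + 1 / cos \<beta>) * (9 * norm (F \<i>) * Q)"
  have D1: "norm (g w) \<le> A * (1 + norm w) powr (1 / a)" if w: "w \<in> D" for w
  proof -
    define r where "r = norm (w - p)"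
    define t where "t = M * (1 + r)"
    have r0: "r \<ge> 0" by (simp add: r_def)
    have t0: "t \<ge> 0" using M r0 by (simp add: t_def)
    define w' where "w' = w + t *\<^sub>R u"
    define x where "x = (w' - p) / u"
    have x_eq: "x = complex_of_real t + (w - p) / u" using u0 by (simp add: x_def w'_def scaleR_conv_of_real field_simps)
    have n1: "norm ((w - p) / u) = r" by (simp add: r_def norm_divide u)
    have Re_x: "Re x \<ge> t - r" using abs_Re_le_cmod[of "(w - p) / u"] n1 unfolding x_eq by simp
    have Im_x: "\<bar>Im x\<bar> \<le> r" using abs_Im_le_cmod[of "(w - p) / u"] n1 unfolding x_eq by simp
    have "t - r = (1 + cos (\<beta> / 2) / sin (\<beta> / 2)) * (1 + r) + 1" by (simp add: t_def M_def algebra_simps)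
    also have "\<dots> \<ge> cos (\<beta> / 2) / sin (\<beta> / 2) * r + 1"
    proof -
      have "q * r + 1 \<le> (1 + q) * (1 + r) + 1" if "0 \<le> q" for q using that r0 by (simp add: algebra_simps)
      from this[of "cos (\<beta> / 2) / sin (\<beta> / 2)"] show ?thesis using sc2 by simp
    qed
    finally have Re_x2: "Re x \<ge> cos (\<beta> / 2) / sin (\<beta> / 2) * r + 1" using Re_x by linarith
    have "sin (\<beta> / 2) * Re x \<ge> sin (\<beta> / 2) * (cos (\<beta> / 2) / sin (\<beta> / 2) * r + 1)"
      using sc2 Re_x2 by (intro mult_left_mono) auto
    also have "sin (\<beta> / 2) * (cos (\<beta> / 2) / sin (\<beta> / 2) * r + 1) = cos (\<beta> / 2) * r + sin (\<beta> / 2)"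
      using sc2 by (simp add: field_simps)
    finally have "sin (\<beta> / 2) * Re x > cos (\<beta> / 2) * r" using sc2 by linarith
    moreover have "cos (\<beta> / 2) * \<bar>Im x\<bar> \<le> cos (\<beta> / 2) * r" using sc2 Im_x by (intro mult_left_mono) auto
    ultimately have "cos (\<beta> / 2) * \<bar>Im x\<bar> < sin (\<beta> / 2) * Re x" by linarith
    moreover have "\<bar>cos (\<beta> / 2) * Im x\<bar> = cos (\<beta> / 2) * \<bar>Im x\<bar>" using sc2 by (simp add: abs_mult)
    ultimately have "Im (cis (\<beta> / 2) * x) > 0" "Im (cis (- (\<beta> / 2)) * x) < 0" by (simp_all; linarith)+
    hence Arg_x: "\<bar>Arg x\<bar> < \<beta> / 2" using \<beta> by (intro abs_Arg_less) auto
    have Rex1: "Re x \<ge> 1"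
    proof -
      have "cos (\<beta> / 2) / sin (\<beta> / 2) * r \<ge> 0" using sc2 r0 by simp
      thus ?thesis using Re_x2 by linarith
    qed
    hence x0: "x \<noteq> 0" by auto
    have nx1: "norm x \<ge> 1" using Rex1 complex_Re_le_cmod[of x] by linarith
    define y where "y = Ln x / complex_of_real a"
    define \<zeta> where "\<zeta> = \<i> * exp y"
    \<comment> \<open>The angle \<beta> / 2 becomes \<pi> / 4 under the power 1 / a, which keeps
      \<open>\<zeta>\<close> away from the real axis: Im \<zeta> \<ge> |\<zeta>| / 2.\<close>
    have Im_y: "\<bar>Im y\<bar> < pi / 4"
    proof -
      have "\<bar>Im y\<bar> = \<bar>Arg x\<bar> / a" using a by (simp add: y_def Arg_eq_Im_Ln[OF x0] abs_divide)
      also have "\<dots> < (\<beta> / 2) / a" using Arg_x a by (intro divide_strict_right_mono) auto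
      also have "(\<beta> / 2) / a = pi / 4" using a by (simp add: \<beta>_def)
      finally show ?thesis .
    qed
    have n\<zeta>: "norm \<zeta> = norm x powr (1 / a)" using x0 by (simp add: \<zeta>_def y_def norm_mult powr_def)
    have n\<zeta>1: "norm \<zeta> \<ge> 1" unfolding n\<zeta> using nx1 a by (intro ge_one_powr_ge_zero) auto
    have Im\<zeta>: "Im \<zeta> \<ge> norm \<zeta> / 2"
    proof -
      have "cos (pi / 4) \<le> cos \<bar>Im y\<bar>" using Im_y by (intro cos_monotone_0_pi_le) auto
      moreover have "cos (pi / 4) \<ge> 1 / 2" using real_sqrt_ge_one[of 2] by (simp add: cos_45)
      ultimately have "exp (Re y) * (1 / 2) \<le> exp (Re y) * cos (Im y)" by (intro mult_left_mono) auto
      thus ?thesis by (simp add: \<zeta>_def norm_mult Re_exp)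
    qed
    hence \<zeta>: "\<zeta> \<in> upper_half_plane" using n\<zeta>1 by (simp add: upper_half_plane_def)
    have "\<Psi> \<zeta> = w'"
    proof -
      have "Ln (- \<i> * \<zeta>) = y" unfolding \<zeta>_def using Im_y pi_gt_zero by (simp add: Ln_exp)
      hence "exp (complex_of_real a * Ln (- \<i> * \<zeta>)) = x" using a x0 by (simp add: y_def)
      thus ?thesis using u0 by (simp add: \<Psi>_def x_def)
    qed
    hence "norm (g w') \<le> norm (F \<i>) * (1 + (norm (\<zeta> + \<i>))\<^sup>2 / Im \<zeta>)"
      using norm_self_map_upper_half_plane_le[OF F \<zeta>] by (simp add: F_def)
    also have "\<dots> \<le> norm (F \<i>) * (norm \<zeta> + (2 * norm \<zeta>)\<^sup>2 / (norm \<zeta> / 2))"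
    proof (intro mult_left_mono add_mono frac_le power_mono)
      show "norm (\<zeta> + \<i>) \<le> 2 * norm \<zeta>" using norm_triangle_ineq[of \<zeta> \<i>] n\<zeta>1 by simp
    qed (use n\<zeta>1 Im\<zeta> in auto)
    also have "(2 * norm \<zeta>)\<^sup>2 / (norm \<zeta> / 2) = 8 * norm \<zeta>" using n\<zeta>1 by (simp add: power2_eq_square)
    finally have gw': "norm (g w') \<le> 9 * norm (F \<i>) * norm \<zeta>" by (simp add: algebra_simps)
    have "norm \<zeta> \<le> ((M + 1) * (1 + norm p) * (1 + norm w)) powr (1 / a)"
      unfolding n\<zeta>
    proof (intro powr_mono2)
      have "norm x \<le> t + r" unfolding x_eq using norm_triangle_ineq[of "complex_of_real t" "(w - p) / u"] n1 t0 by simp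
      also have "\<dots> \<le> (M + 1) * (1 + r)" using r0 by (simp add: t_def algebra_simps)
      also have "\<dots> \<le> (M + 1) * ((1 + norm p) * (1 + norm w))"
      proof (intro mult_left_mono)
        have "r \<le> norm w + norm p" unfolding r_def by (rule norm_triangle_ineq4)
        moreover have "0 \<le> norm p * norm w" by simp
        ultimately show "1 + r \<le> (1 + norm p) * (1 + norm w)" unfolding distrib_left distrib_right by linarith
      qed (use M in auto)
      finally show "norm x \<le> (M + 1) * (1 + norm p) * (1 + norm w)" by (simp add: mult.assoc)
    qed (use a in auto)
    also have "\<dots> = Q * (1 + norm w) powr (1 / a)" using M by (simp add: Q_def powr_mult)
    finally have n\<zeta>2: "norm \<zeta> \<le> Q * (1 + norm w) powr (1 / a)" .
    \<comment> \<open>Both edges \<open>u * cis \<beta>\<close> and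
      \<open>u * cis (- \<beta>)\<close> are recession directions, so neither of cos \<beta> Im g +
      sin \<beta> Re g and cos \<beta> Im g - sin \<beta> Re g decreases along \<open>u\<close>. As
      Im g is positive, the two resulting bounds control |Re g| and Im g separately.\<close>
    have mono: "Im (cis c * g w) \<le> norm (g w')" if c: "c = \<beta> \<or> c = - \<beta>" for c
    proof -
      have "Im (cis c * g w) \<le> Im (cis c * g w')"
        unfolding w'_def
      proof (rule Im_g_nondecreasing_along[OF urec w t0])
        fix y assume y: "y \<in> D"
        have "u * cis c \<in> recession" using rec[folded \<beta>_def] c by auto
        from der[OF this y] show "0 \<le> Im (cis c * u * deriv g y)" by (simp only: mult.commute[of u])
      qed
      also have "\<dots> \<le> norm (cis c * g w')" using abs_Im_le_cmod[of "cis c * g w'"] by linarith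
      finally show ?thesis by (simp add: norm_mult)
    qed
    have Img: "Im (g w) \<ge> 0" using g_D[OF w] by (simp add: upper_half_plane_def)
    have "cos \<beta> * Im (g w) + sin \<beta> * Re (g w) \<le> norm (g w')" "cos \<beta> * Im (g w) - sin \<beta> * Re (g w) \<le> norm (g w')"
      using mono[of \<beta>] mono[of "- \<beta>"] by simp_all
    moreover have "0 \<le> cos \<beta> * Im (g w)" using sc Img by simp
    moreover have "sin \<beta> * \<bar>Re (g w)\<bar> = \<bar>sin \<beta> * Re (g w)\<bar>" using sc by (simp add: abs_mult)
    ultimately have "sin \<beta> * \<bar>Re (g w)\<bar> \<le> norm (g w')" "cos \<beta> * Im (g w) \<le> norm (g w')" by linarith+
    hence "\<bar>Re (g w)\<bar> \<le> norm (g w') / sin \<beta>" "\<bar>Im (g w)\<bar> \<le> norm (g w') / cos \<beta>"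
      using sc Img by (simp_all add: field_simps)
    hence "norm (g w) \<le> (1 / sin \<beta> + 1 / cos \<beta>) * norm (g w')"
      using cmod_le[of "g w"] by (simp add: algebra_simps)
    also have "\<dots> \<le> (1 / sin \<beta> + 1 / cos \<beta>) * (9 * norm (F \<i>) * (Q * (1 + norm w) powr (1 / a)))"
      using sc gw' n\<zeta>2 by (intro mult_left_mono order_trans[OF gw']) auto
    finally show ?thesis by (simp add: A_def mult.assoc)
  qed
  have "norm (g w) \<le> A * (1 + norm w) powr (1 / a)" if "w \<in> C" for w
    by (rule le_on_C_if_le_on_D[OF D1 _ _ that])
       (use a in \<open>auto intro!: continuous_intros continuous_g simp: add_nonneg_eq_0_iff\<close>)
  thus ?thesis by blast
qed

text \<open>The opening \<open>a * pi\<close> of the recession cone decides: a positive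
  \<open>a\<close> gives q = 1 / a, while for a = 0 the lower bound holds with arbitrarily small
  exponents b > 0, which means growth beyond every power. The slack \<eta> is there because
  \<open>D\<close> is only known to fit into sectors strictly wider than the cone.\<close>

lemma growth_if_recession_pointed:
  assumes unb: "\<And>R. \<exists>z\<in>K. norm z > R \<and> norm (f z) > R"
    and pointed: "\<forall>v\<in>recession. - v \<in> recession \<longrightarrow> v = 0"
    and \<eta>: "\<eta> > 0"
  shows "(\<exists>A q. 1 \<le> q \<and> (\<forall>w\<in>C. norm (g w) \<le> A * (1 + norm w) powr q \<and>
      (1 + norm w) powr q \<le> A * (1 + norm (g w)) powr (1 + \<eta>))) \<or>
    (\<forall>s>0. \<exists>A. \<forall>w\<in>C. norm w powr s \<le> A * (1 + norm (g w)))"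
proof -
  obtain c where c: "\<And>n. c n \<in> upper_half_plane"
    and fc_inf: "filterlim (\<lambda>n. f (c n)) at_infinity sequentially"
    using unbounded_near_infinity_sequence[OF unb] by metis
  obtain v0 where v0: "v0 \<in> recession" "norm v0 = 1"
    using recession_of_unbounded[OF imageI[OF c] fc_inf] by metis
  obtain u a where u: "norm u = 1" and a: "0 \<le> a" "a < 1"
    and rec: "u * cis (a * pi / 2) \<in> recession" "u * cis (- (a * pi / 2)) \<in> recession"
    and sector: "\<And>v. v \<in> recession \<Longrightarrow> v \<noteq> 0 \<Longrightarrow> \<exists>\<omega>. \<bar>\<omega>\<bar> \<le> a * pi / 2 \<and> v = norm v *\<^sub>R (u * cis \<omega>)"
    using recession_angle[OF pointed[rule_format] v0] by metis
  have infty: "\<exists>L. \<forall>w\<in>D. L < norm w \<longrightarrow> R < norm (g w)" for R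
  proof -
    define b where "b = (1 + a) / 2"
    have b: "a < b" "b < 1" "0 < b" using a by (auto simp: b_def)
    obtain p where p: "\<And>w. w \<in> D \<Longrightarrow> \<bar>Arg ((w - p) / u)\<bar> < b * pi / 2"
      using D_in_sector[OF u a(1) b(1,2) sector] by metis
    define k where "k = cos (b * pi / 2)"
    have "b * pi < 1 * pi" using b by (intro mult_strict_right_mono) auto
    hence bp: "0 < b * pi / 2" "b * pi / 2 < pi / 2" using b by auto
    hence k: "k > 0" unfolding k_def by (intro cos_gt_zero_pi; use pi_gt_zero in linarith)
    \<comment> \<open>In a sector of half-opening below \<pi> / 2 the functional Re (w / u) is
      coercive.\<close>
    have "k * norm w - (norm p + k * norm p) \<le> (\<i> * cnj (\<i> / u)) \<bullet> w" if w: "w \<in> D" for w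
    proof -
      define x where "x = (w - p) / u"
      have nx: "norm x = norm (w - p)" by (simp add: x_def norm_divide u)
      have "norm x * k \<le> norm x * cos \<bar>Arg x\<bar>"
        unfolding k_def using p[OF w] bp by (intro mult_left_mono cos_monotone_0_pi_le) (auto simp: x_def)
      also have "\<dots> = Re x" by (subst (3) complex_polar[of x]) (simp only: scaleR_complex.sel cis.sel cos_abs_real)
      also have "\<dots> = Re (w / u) - Re (p / u)" by (simp add: x_def diff_divide_distrib)
      also have "\<dots> \<le> Re (w / u) + norm p"
        using abs_Re_le_cmod[of "p / u"] by (simp add: norm_divide u)
      finally have 1: "k * norm (w - p) \<le> Re (w / u) + norm p" by (simp add: nx mult.commute)
      have "k * norm w \<le> k * (norm (w - p) + norm p)"
        using k norm_triangle_ineq[of "w - p" p] by (intro mult_left_mono) auto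
      hence "k * norm w - (norm p + k * norm p) \<le> Re (w / u)" using 1 by (simp add: algebra_simps)
      moreover have "\<i> / u * w = \<i> * (w / u)" by simp
      hence "(\<i> * cnj (\<i> / u)) \<bullet> w = Re (w / u)" unfolding inner_conv_Im by (simp only: Im_i_times)
      ultimately show ?thesis by simp
    qed
    from inverse_tends_to_infinity[OF unb k this] show ?thesis .
  qed
  have der: "0 \<le> Im (v * deriv g w)" if "v \<in> recession" "w \<in> D" for v w
    using Im_deriv_inverse_nonneg[OF infty that] .
  have urec: "u \<in> recession"
  proof -
    have ca: "cos (a * pi / 2) > 0"
    proof -
      have "a * pi < 1 * pi" using a by (intro mult_strict_right_mono) auto
      moreover have "0 \<le> a * pi" using a by simp
      ultimately show ?thesis by (intro cos_gt_zero_pi; use pi_gt_zero in linarith)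
    qed
    define q where "q = 2 * cos (a * pi / 2)"
    have "cis x + cis (- x) = complex_of_real (2 * cos x)" for x by (simp add: complex_eq_iff)
    hence "u * cis (a * pi / 2) + u * cis (- (a * pi / 2)) = u * complex_of_real q"
      by (simp only: q_def flip: distrib_left)
    hence "(1 / q) *\<^sub>R (u * cis (a * pi / 2)) + (1 / q) *\<^sub>R (u * cis (- (a * pi / 2))) = (1 / q) *\<^sub>R (u * complex_of_real q)"
      by (simp only: flip: scaleR_right_distrib)
    moreover have q: "q > 0" using ca by (simp add: q_def)
    hence "(1 / q) *\<^sub>R (u * complex_of_real q) = u" by (simp add: scaleR_conv_of_real)
    moreover have "0 \<le> 1 / q" using q by simp
    ultimately show ?thesis using recession_add[OF rec, of "1 / q" "1 / q"] by simp
  qed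
  have lower: "\<exists>A. \<forall>w\<in>C. norm w \<le> A * (1 + norm (g w)) powr b" if b: "a < b" "b < 1" for b
  proof -
    obtain p where p: "\<And>w. w \<in> D \<Longrightarrow> w \<noteq> p" "\<And>w. w \<in> D \<Longrightarrow> \<bar>Arg ((w - p) / u)\<bar> < b * pi / 2"
      using D_in_sector[OF u a(1) b sector] by metis
    show ?thesis using a b by (intro norm_le_powr_norm_inverse[OF u _ _ p der[OF urec]]) auto
  qed
  show ?thesis
  proof (cases "a = 0")
    case True
    have "\<exists>A. \<forall>w\<in>C. norm w powr s \<le> A * (1 + norm (g w))" if s: "s > 0" for s :: real
    proof -
      define b where "b = min (1/2) (1/s)"
      have b: "0 < b" "b < 1" "b * s \<le> 1" using s by (auto simp: b_def min_def field_simps)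
      obtain A where A: "\<And>w. w \<in> C \<Longrightarrow> norm w \<le> A * (1 + norm (g w)) powr b"
        using lower[of b] b True by auto
      have "norm w powr s \<le> \<bar>A\<bar> powr s * (1 + norm (g w))" if w: "w \<in> C" for w
      proof -
        have "norm w \<le> \<bar>A\<bar> * (1 + norm (g w)) powr b"
          using A[OF w] by (rule order_trans) (intro mult_right_mono, auto)
        hence "norm w powr s \<le> (\<bar>A\<bar> * (1 + norm (g w)) powr b) powr s" using s by (intro powr_mono2) auto
        also have "\<dots> = \<bar>A\<bar> powr s * (1 + norm (g w)) powr (b * s)" by (simp add: powr_mult powr_powr)
        also have "\<dots> \<le> \<bar>A\<bar> powr s * (1 + norm (g w)) powr 1" using b by (intro mult_left_mono powr_mono) auto
        finally show ?thesis by (simp add: add_nonneg_nonneg)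
      qed
      thus ?thesis by blast
    qed
    thus ?thesis by blast
  next
    case False
    hence a0: "a > 0" using a by simp
    obtain A1 where A1: "\<And>w. w \<in> C \<Longrightarrow> norm (g w) \<le> A1 * (1 + norm w) powr (1 / a)"
      using norm_inverse_le_powr_norm[OF u a0 a(2) rec der] by metis
    \<comment> \<open>Strictly between \<open>a\<close> and 1, and so close to \<open>a\<close> that
      b / a \<le> 1 + \<eta>.\<close>
    define b where "b = min ((1 + a) / 2) (a * (1 + \<eta>))"
    have b: "a < b" "b < 1" "b / a \<le> 1 + \<eta>" using a a0 \<eta> by (auto simp: b_def min_def field_simps)
    obtain A2 where A2: "\<And>w. w \<in> C \<Longrightarrow> norm w \<le> A2 * (1 + norm (g w)) powr b"
      using lower[OF b(1,2)] by metis
    define A where "A = \<bar>A1\<bar> + (1 + \<bar>A2\<bar>) powr (1 / a)"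
    have "norm (g w) \<le> A * (1 + norm w) powr (1 / a) \<and> (1 + norm w) powr (1 / a) \<le> A * (1 + norm (g w)) powr (1 + \<eta>)"
      if w: "w \<in> C" for w
    proof
      show "norm (g w) \<le> A * (1 + norm w) powr (1 / a)"
      proof (rule order_trans[OF A1[OF w]])
        have "A1 \<le> A" unfolding A_def using abs_ge_self[of A1] powr_ge_zero[of "1 + \<bar>A2\<bar>" "1 / a"] by linarith
        thus "A1 * (1 + norm w) powr (1 / a) \<le> A * (1 + norm w) powr (1 / a)" by (intro mult_right_mono) auto
      qed
      have one: "1 \<le> (1 + norm (g w)) powr b" using b a0 by (intro ge_one_powr_ge_zero) auto
      have "1 + norm w \<le> (1 + norm (g w)) powr b + \<bar>A2\<bar> * (1 + norm (g w)) powr b"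
        using one A2[OF w] mult_right_mono[OF abs_ge_self[of A2], of "(1 + norm (g w)) powr b"] by simp
      hence "1 + norm w \<le> (1 + \<bar>A2\<bar>) * (1 + norm (g w)) powr b" by (simp add: algebra_simps)
      hence "(1 + norm w) powr (1 / a) \<le> ((1 + \<bar>A2\<bar>) * (1 + norm (g w)) powr b) powr (1 / a)"
        using a0 by (intro powr_mono2) auto
      also have "\<dots> = (1 + \<bar>A2\<bar>) powr (1 / a) * (1 + norm (g w)) powr (b / a)" by (simp add: powr_mult powr_powr)
      also have "\<dots> \<le> A * (1 + norm (g w)) powr (1 + \<eta>)"
        using b by (intro mult_mono powr_mono) (auto simp: A_def)
      finally show "(1 + norm w) powr (1 / a) \<le> A * (1 + norm (g w)) powr (1 + \<eta>)" .
    qed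
    moreover have "1 \<le> 1 / a" using a a0 by simp
    ultimately show ?thesis by blast
  qed
qed

text \<open>The three alternatives occur for images resembling a sector (or a half-plane), a parabola or
  half-strip, and a strip.\<close>

theorem inverse_growth:
  assumes unb: "\<And>R. \<exists>z\<in>K. norm z > R \<and> norm (f z) > R" and \<eta>: "\<eta> > 0"
  shows "(\<exists>A q. 1 \<le> q \<and> (\<forall>w\<in>C. norm (g w) \<le> A * (1 + norm w) powr q \<and>
      (q = 1 \<or> (1 + norm w) powr q \<le> A * (1 + norm (g w)) powr (1 + \<eta>)))) \<or>
    (\<forall>s>0. \<exists>A. \<forall>w\<in>C. norm w powr s \<le> A * (1 + norm (g w))) \<or>
    (\<exists>A \<kappa>. \<forall>w\<in>C. norm (g w) \<le> A * (1 + exp (Re (\<kappa> * w))) \<and> exp (Re (\<kappa> * w)) \<le> A * (1 + norm (g w)))"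
proof (cases "\<exists>v. v \<noteq> 0 \<and> v \<in> recession \<and> - v \<in> recession")
  case True
  then obtain v where v: "v \<noteq> 0" "v \<in> recession" "- v \<in> recession" by auto
  from growth_if_recession_line[OF unb v] show ?thesis
  proof
    assume "\<exists>A. \<forall>w\<in>C. norm (g w) \<le> A * (1 + norm w)"
    then obtain A where "\<forall>w\<in>C. norm (g w) \<le> A * (1 + norm w)" ..
    hence "\<forall>w\<in>C. norm (g w) \<le> A * (1 + norm w) powr 1 \<and>
      ((1::real) = 1 \<or> (1 + norm w) powr 1 \<le> A * (1 + norm (g w)) powr (1 + \<eta>))" by (simp add: add_nonneg_nonneg)
    thus ?thesis by (intro disjI1 exI[of _ A] exI[of _ 1] conjI order_refl)
  qed (intro disjI2, assumption)
next
  case False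
  hence pointed: "\<forall>v\<in>recession. - v \<in> recession \<longrightarrow> v = 0" by blast
  from growth_if_recession_pointed[OF unb pointed \<eta>] show ?thesis
  proof
    assume "\<exists>A q. 1 \<le> q \<and> (\<forall>w\<in>C. norm (g w) \<le> A * (1 + norm w) powr q \<and>
      (1 + norm w) powr q \<le> A * (1 + norm (g w)) powr (1 + \<eta>))"
    then obtain A q where "1 \<le> q" "\<forall>w\<in>C. norm (g w) \<le> A * (1 + norm w) powr q \<and>
      (1 + norm w) powr q \<le> A * (1 + norm (g w)) powr (1 + \<eta>)" by metis
    thus ?thesis by (intro disjI1 exI[of _ A] exI[of _ q]) simp
  qed (rule disjI2[OF disjI1])
qed

end

section \<open>Second and fourth moments of centred sums\<close>

section \<open>Sums of independent identically distributed variables\<close>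

locale iid_sequence = prob_space M for M :: "'a measure" +
  fixes X :: "nat \<Rightarrow> 'a \<Rightarrow> real"
  assumes indep_X: "indep_vars (\<lambda>_. borel) X {1..}"
    and distr_X: "\<And>j. j \<ge> 1 \<Longrightarrow> distr M borel (X j) = distr M borel (X 1)"
begin

lemma measurable_X [measurable]: "j \<in> {1..} \<Longrightarrow> X j \<in> borel_measurable M"
  using indep_X by (auto simp: indep_vars_def)

lemma integrable_X_iff:
  fixes h :: "real \<Rightarrow> 'b :: {banach, second_countable_topology}"
  assumes "h \<in> borel_measurable borel" "j \<ge> 1"
  shows "integrable M (\<lambda>\<omega>. h (X j \<omega>)) \<longleftrightarrow> integrable M (\<lambda>\<omega>. h (X 1 \<omega>))"
  using integrable_distr_eq[of "X j" M borel h] integrable_distr_eq[of "X 1" M borel h]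
    distr_X[OF assms(2)] assms measurable_X[of j] measurable_X[of 1] by simp

lemma integral_X:
  fixes h :: "real \<Rightarrow> 'b :: {banach, second_countable_topology}"
  assumes "h \<in> borel_measurable borel" "j \<ge> 1"
  shows "(\<integral>\<omega>. h (X j \<omega>) \<partial>M) = (\<integral>\<omega>. h (X 1 \<omega>) \<partial>M)"
  using integral_distr[of "X j" M borel h] integral_distr[of "X 1" M borel h]
    distr_X[OF assms(2)] assms measurable_X[of j] measurable_X[of 1] by simp

lemma prob_X:
  assumes "Measurable.pred borel P" "j \<ge> 1"
  shows "prob {\<omega>\<in>space M. P (X j \<omega>)} = prob {\<omega>\<in>space M. P (X 1 \<omega>)}"
proof -
  have "prob {\<omega>\<in>space M. P (X i \<omega>)} = measure (distr M borel (X i)) {x. P x}" if "i \<ge> 1" for i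
    using that assms(1) measurable_X[of i]
    by (subst measure_distr) (auto intro!: arg_cong[where f = prob] simp: pred_def)
  thus ?thesis using distr_X[OF assms(2)] assms(2) by simp
qed

lemma AE_X:
  assumes "Measurable.pred borel P" "j \<ge> 1" "AE \<omega> in M. P (X 1 \<omega>)"
  shows "AE \<omega> in M. P (X j \<omega>)"
proof -
  have "(AE \<omega> in M. P (X i \<omega>)) \<longleftrightarrow> (AE x in distr M borel (X i). P x)" if "i \<ge> 1" for i
    using that assms(1) measurable_X[of i] by (subst AE_distr_iff) (auto simp: pred_def)
  from this[of j] this[of 1] show ?thesis using distr_X[OF assms(2)] assms(2,3) by (simp only: order_refl simp_thms)
qed

lemma indep_vars_compose_X:
  assumes "\<And>j. h j \<in> borel_measurable borel" "I \<subseteq> {1..}"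
  shows "indep_vars (\<lambda>_. borel) (\<lambda>j \<omega>. h j (X j \<omega>)) I"
  by (rule indep_vars_compose2[OF indep_vars_subset[OF indep_X assms(2)]]) (rule assms(1))

lemma indep_var_next_sum:
  fixes h :: "real \<Rightarrow> real"
  assumes "h \<in> borel_measurable borel"
  shows "indep_var borel (\<lambda>\<omega>. h (X (Suc n) \<omega>)) borel (\<lambda>\<omega>. \<Sum>j=1..n. h (X j \<omega>))"
  by (rule indep_vars_sum[OF _ _ indep_vars_compose_X]) (use assms in auto)

lemma second_moment_sum:
  fixes h :: "real \<Rightarrow> real"
  assumes h [measurable]: "h \<in> borel_measurable borel"
    and sq: "integrable M (\<lambda>\<omega>. (h (X 1 \<omega>))\<^sup>2)" and mean: "(\<integral>\<omega>. h (X 1 \<omega>) \<partial>M) = 0"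
  shows "integrable M (\<lambda>\<omega>. (\<Sum>j=1..n. h (X j \<omega>))\<^sup>2)"
    and "(\<integral>\<omega>. (\<Sum>j=1..n. h (X j \<omega>))\<^sup>2 \<partial>M) = real n * (\<integral>\<omega>. (h (X 1 \<omega>))\<^sup>2 \<partial>M)"
proof (induction n)
  case 0
  { case 1 show ?case by simp }
  { case 2 show ?case by simp }
next
  case (Suc n)
  define S where "S = (\<lambda>\<omega>. \<Sum>j=1..n. h (X j \<omega>))"
  define Y where "Y = (\<lambda>\<omega>. h (X (Suc n) \<omega>))"
  have [measurable]: "X (Suc n) \<in> borel_measurable M" by (intro measurable_X) simp
  have [measurable]: "S \<in> borel_measurable M" "Y \<in> borel_measurable M" unfolding S_def Y_def by measurable
  have Y2: "integrable M (\<lambda>\<omega>. (Y \<omega>)\<^sup>2)"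
    unfolding Y_def using integrable_X_iff[of "\<lambda>x. (h x)\<^sup>2" "Suc n"] sq by simp
  have S2: "integrable M (\<lambda>\<omega>. (S \<omega>)\<^sup>2)" using Suc(1) by (simp add: S_def)
  have Y1: "integrable M Y" and S1: "integrable M S"
    using square_integrable_imp_integrable[OF _ Y2] square_integrable_imp_integrable[OF _ S2]
    by (simp_all add: \<open>Y \<in> borel_measurable M\<close> \<open>S \<in> borel_measurable M\<close>)
  have ind: "indep_var borel Y borel S" unfolding S_def Y_def by (rule indep_var_next_sum) simp
  have YS: "integrable M (\<lambda>\<omega>. Y \<omega> * S \<omega>)" by (rule indep_var_integrable[OF ind Y1 S1])
  have EY: "(\<integral>\<omega>. Y \<omega> \<partial>M) = 0" unfolding Y_def using integral_X[of h "Suc n"] mean by simp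
  have EYS: "(\<integral>\<omega>. Y \<omega> * S \<omega> \<partial>M) = 0" using indep_var_lebesgue_integral[OF ind Y1 S1] EY by simp
  have eq: "(\<Sum>j=1..Suc n. h (X j \<omega>))\<^sup>2 = (S \<omega>)\<^sup>2 + (Y \<omega>)\<^sup>2 + 2 * (Y \<omega> * S \<omega>)" for \<omega>
    by (simp add: S_def Y_def power2_eq_square algebra_simps)
  { case 1 show ?case unfolding eq using S2 Y2 YS by simp }
  { case 2
    have "(\<integral>\<omega>. (S \<omega>)\<^sup>2 + (Y \<omega>)\<^sup>2 + 2 * (Y \<omega> * S \<omega>) \<partial>M) = (\<integral>\<omega>. (S \<omega>)\<^sup>2 \<partial>M) + (\<integral>\<omega>. (Y \<omega>)\<^sup>2 \<partial>M)"
      using S2 Y2 YS EYS by simp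
    also have "(\<integral>\<omega>. (Y \<omega>)\<^sup>2 \<partial>M) = (\<integral>\<omega>. (h (X 1 \<omega>))\<^sup>2 \<partial>M)"
      unfolding Y_def using integral_X[of "\<lambda>x. (h x)\<^sup>2" "Suc n"] by simp
    finally show ?case unfolding eq using Suc(2) by (simp add: S_def algebra_simps) }
qed

text \<open>When one summand is added, the cross terms of odd order vanish by independence and
  centring; the induction closes because 3 n^2 + 6 n + 1 \<le> 3 (n + 1)^2.\<close>

lemma fourth_moment_sum_le:
  fixes h :: "real \<Rightarrow> real"
  assumes h [measurable]: "h \<in> borel_measurable borel"
    and bound: "\<And>x. \<bar>h x\<bar> \<le> T" and mean: "(\<integral>\<omega>. h (X 1 \<omega>) \<partial>M) = 0"
  shows "(\<integral>\<omega>. (\<Sum>j=1..n. h (X j \<omega>)) ^ 4 \<partial>M) \<le> 3 * (real n)\<^sup>2 * T ^ 4"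
proof (induction n)
  case (Suc n)
  define S where "S = (\<lambda>\<omega>. \<Sum>j=1..n. h (X j \<omega>))"
  define Y where "Y = (\<lambda>\<omega>. h (X (Suc n) \<omega>))"
  have [measurable]: "X (Suc n) \<in> borel_measurable M" by (intro measurable_X) simp
  have [measurable]: "S \<in> borel_measurable M" "Y \<in> borel_measurable M" unfolding S_def Y_def by measurable
  have T0: "T \<ge> 0" using bound[of 0] by linarith
  have bS: "\<bar>S \<omega>\<bar> \<le> real n * T" for \<omega>
  proof -
    have "\<bar>S \<omega>\<bar> \<le> (\<Sum>j=1..n. T)" unfolding S_def by (intro order_trans[OF sum_abs] sum_mono bound)
    thus ?thesis by simp
  qed
  have bY: "\<bar>Y \<omega>\<bar> \<le> T" for \<omega> unfolding Y_def by (rule bound)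
  have int: "integrable M (\<lambda>\<omega>. Y \<omega> ^ i * S \<omega> ^ k)" for i k
  proof (rule integrable_const_bound[of _ "T ^ i * (real n * T) ^ k"])
    show "AE \<omega> in M. norm (Y \<omega> ^ i * S \<omega> ^ k) \<le> T ^ i * (real n * T) ^ k"
      using bS bY T0 by (intro AE_I2) (auto simp: abs_mult power_abs intro!: mult_mono power_mono)
  qed measurable
  have intY: "integrable M (\<lambda>\<omega>. Y \<omega> ^ i)" and intS: "integrable M (\<lambda>\<omega>. S \<omega> ^ i)" for i
    using int[of i 0] int[of 0 i] by simp_all
  have ind0: "indep_var borel Y borel S" unfolding S_def Y_def by (rule indep_var_next_sum) simp
  have E: "(\<integral>\<omega>. Y \<omega> ^ i * S \<omega> ^ k \<partial>M) = (\<integral>\<omega>. Y \<omega> ^ i \<partial>M) * (\<integral>\<omega>. S \<omega> ^ k \<partial>M)" for i k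
  proof -
    have "indep_var borel ((\<lambda>x. x ^ i) \<circ> Y) borel ((\<lambda>x. x ^ k) \<circ> S)"
      by (rule indep_var_compose[OF ind0]) measurable
    hence "indep_var borel (\<lambda>\<omega>. Y \<omega> ^ i) borel (\<lambda>\<omega>. S \<omega> ^ k)" by (simp add: o_def)
    from indep_var_lebesgue_integral[OF this intY intS] show ?thesis .
  qed
  have EY: "(\<integral>\<omega>. Y \<omega> \<partial>M) = 0" unfolding Y_def using integral_X[of h "Suc n"] mean by simp
  have sq: "(h x)\<^sup>2 \<le> T\<^sup>2" for x using power_mono[OF bound[of x], of 2] by simp
  have int2: "integrable M (\<lambda>\<omega>. (h (X 1 \<omega>))\<^sup>2)"
    using sq by (intro integrable_const_bound[of _ "T\<^sup>2"] AE_I2) auto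
  have ES: "(\<integral>\<omega>. S \<omega> \<partial>M) = 0"
  proof -
    have ih: "integrable M (\<lambda>\<omega>. h (X j \<omega>))" if "j \<in> {1..n}" for j
    proof -
      have "integrable M (\<lambda>\<omega>. h (X 1 \<omega>))"
        by (rule square_integrable_imp_integrable[OF _ int2]) simp
      thus ?thesis using that integrable_X_iff[of h j] by simp
    qed
    have "(\<integral>\<omega>. S \<omega> \<partial>M) = (\<Sum>j=1..n. \<integral>\<omega>. h (X j \<omega>) \<partial>M)"
      unfolding S_def using ih by (rule Bochner_Integration.integral_sum)
    also have "\<dots> = (\<Sum>j=1..n. 0)"
    proof (rule sum.cong[OF refl])
      show "(\<integral>\<omega>. h (X j \<omega>) \<partial>M) = 0" if "j \<in> {1..n}" for j
        using integral_X[OF h, of j] mean that by simp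
    qed
    finally show ?thesis by simp
  qed
  have ES2: "(\<integral>\<omega>. S \<omega> ^ 2 \<partial>M) \<le> real n * T\<^sup>2"
  proof -
    have "(\<integral>\<omega>. S \<omega> ^ 2 \<partial>M) = real n * (\<integral>\<omega>. (h (X 1 \<omega>))\<^sup>2 \<partial>M)"
      unfolding S_def by (rule second_moment_sum(2)[OF h int2 mean])
    also have "(\<integral>\<omega>. (h (X 1 \<omega>))\<^sup>2 \<partial>M) \<le> (\<integral>\<omega>. T\<^sup>2 \<partial>M)"
      using int2 sq by (intro integral_mono) auto
    finally show ?thesis by (simp add: mult_left_mono prob_space)
  qed
  have EYk: "(\<integral>\<omega>. Y \<omega> ^ k \<partial>M) \<le> T ^ k" for k
  proof -
    have "(\<integral>\<omega>. Y \<omega> ^ k \<partial>M) \<le> (\<integral>\<omega>. T ^ k \<partial>M)"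
    proof (intro integral_mono intY)
      show "Y \<omega> ^ k \<le> T ^ k" for \<omega>
        using power_mono[OF bY[of \<omega>] abs_ge_zero, of k] abs_ge_self[of "Y \<omega> ^ k"] unfolding power_abs by linarith
    qed simp
    thus ?thesis by (simp add: prob_space)
  qed
  have eq: "(\<Sum>j=1..Suc n. h (X j \<omega>)) ^ 4 =
      S \<omega> ^ 4 + 4 * (Y \<omega> ^ 1 * S \<omega> ^ 3) + 6 * (Y \<omega> ^ 2 * S \<omega> ^ 2) + 4 * (Y \<omega> ^ 3 * S \<omega> ^ 1) + Y \<omega> ^ 4" for \<omega>
    by (simp add: S_def Y_def power4_eq_xxxx power2_eq_square power3_eq_cube algebra_simps)
  have "(\<integral>\<omega>. (\<Sum>j=1..Suc n. h (X j \<omega>)) ^ 4 \<partial>M) =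
      (\<integral>\<omega>. S \<omega> ^ 4 \<partial>M) + 4 * (\<integral>\<omega>. Y \<omega> ^ 1 * S \<omega> ^ 3 \<partial>M) + 6 * (\<integral>\<omega>. Y \<omega> ^ 2 * S \<omega> ^ 2 \<partial>M)
        + 4 * (\<integral>\<omega>. Y \<omega> ^ 3 * S \<omega> ^ 1 \<partial>M) + (\<integral>\<omega>. Y \<omega> ^ 4 \<partial>M)"
    unfolding eq using int[of 1 3] int[of 2 2] int[of 3 1] intY[of 4] intS[of 4] by simp
  also have "\<dots> = (\<integral>\<omega>. S \<omega> ^ 4 \<partial>M) + 6 * ((\<integral>\<omega>. Y \<omega> ^ 2 \<partial>M) * (\<integral>\<omega>. S \<omega> ^ 2 \<partial>M)) + (\<integral>\<omega>. Y \<omega> ^ 4 \<partial>M)"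
    unfolding E using EY ES by simp
  also have "\<dots> \<le> 3 * (real n)\<^sup>2 * T ^ 4 + 6 * (T\<^sup>2 * (real n * T\<^sup>2)) + T ^ 4"
  proof -
    have "0 \<le> (\<integral>\<omega>. S \<omega> ^ 2 \<partial>M)" by (intro integral_nonneg_AE) auto
    hence "(\<integral>\<omega>. Y \<omega> ^ 2 \<partial>M) * (\<integral>\<omega>. S \<omega> ^ 2 \<partial>M) \<le> T\<^sup>2 * (real n * T\<^sup>2)"
      by (intro mult_mono[OF EYk[of 2] ES2]) auto
    moreover have "(\<integral>\<omega>. S \<omega> ^ 4 \<partial>M) \<le> 3 * (real n)\<^sup>2 * T ^ 4" using Suc.IH by (simp only: S_def)
    ultimately show ?thesis using EYk[of 4] by linarith
  qed
  also have "\<dots> = (3 * (real n)\<^sup>2 + 6 * real n + 1) * T ^ 4"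
    by (simp add: power4_eq_xxxx power2_eq_square algebra_simps)
  also have "\<dots> \<le> (3 * (real (Suc n))\<^sup>2) * T ^ 4"
    using T0 by (intro mult_right_mono) (auto simp: power2_eq_square algebra_simps)
  finally show ?case .
qed simp

section \<open>Uniform integrability and superpolynomial tail bounds\<close>

section \<open>Moderate deviations\<close>

lemma truncation_error_tendsto_0:
  fixes h :: "real \<Rightarrow> real"
  assumes h [measurable]: "h \<in> borel_measurable borel"
    and sq: "integrable M (\<lambda>\<omega>. (h (X 1 \<omega>))\<^sup>2)"
  shows "(\<lambda>T. \<integral>\<omega>. (if \<bar>h (X 1 \<omega>)\<bar> \<le> real T then 0 else h (X 1 \<omega>))\<^sup>2 \<partial>M) \<longlonglongrightarrow> 0"
proof -
  have "(\<lambda>T. \<integral>\<omega>. (if \<bar>h (X 1 \<omega>)\<bar> \<le> real T then 0 else h (X 1 \<omega>))\<^sup>2 \<partial>M) \<longlonglongrightarrow> (\<integral>\<omega>. 0 \<partial>M)"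
  proof (rule integral_dominated_convergence[where w = "\<lambda>\<omega>. (h (X 1 \<omega>))\<^sup>2"])
    show "AE \<omega> in M. (\<lambda>T. (if \<bar>h (X 1 \<omega>)\<bar> \<le> real T then 0 else h (X 1 \<omega>))\<^sup>2) \<longlonglongrightarrow> 0"
    proof (intro AE_I2 tendsto_eventually)
      fix \<omega>
      show "\<forall>\<^sub>F T in sequentially. (if \<bar>h (X 1 \<omega>)\<bar> \<le> real T then 0 else h (X 1 \<omega>))\<^sup>2 = 0"
        using eventually_ge_at_top[of "nat \<lceil>\<bar>h (X 1 \<omega>)\<bar>\<rceil>"]
      proof eventually_elim
        case (elim T)
        hence "\<bar>h (X 1 \<omega>)\<bar> \<le> real T" by linarith
        thus ?case by simp
      qed
    qed
  qed (use sq in auto)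
  thus ?thesis by simp
qed

text \<open>A second moment alone makes the squared normalized sums uniformly integrable:
  \<open>h\<close> is split into a bounded centred part, whose sum has fourth moment of order n^2,
  and a centred remainder of arbitrarily small variance.\<close>

lemma normalized_sum_uniformly_integrable:
  fixes h :: "real \<Rightarrow> real"
  assumes h [measurable]: "h \<in> borel_measurable borel"
    and sq: "integrable M (\<lambda>\<omega>. (h (X 1 \<omega>))\<^sup>2)" and mean: "(\<integral>\<omega>. h (X 1 \<omega>) \<partial>M) = 0"
    and A [measurable]: "\<And>n. A n \<in> events" and A0: "(\<lambda>n. prob (A n)) \<longlonglongrightarrow> 0"
  shows "(\<lambda>n. (\<integral>\<omega>. indicator (A n) \<omega> * (\<Sum>j=1..n. h (X j \<omega>))\<^sup>2 \<partial>M) / real n) \<longlonglongrightarrow> 0"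
proof -
  have int1: "integrable M (\<lambda>\<omega>. h (X 1 \<omega>))" by (rule square_integrable_imp_integrable[OF _ sq]) simp
  define G where "G T x = (if \<bar>h x\<bar> \<le> real T then 0 else h x)" for T x
  have G [measurable]: "G T \<in> borel_measurable borel" for T unfolding G_def by measurable
  define e where "e T = (\<integral>\<omega>. (G T (X 1 \<omega>))\<^sup>2 \<partial>M)" for T
  have e0: "e \<longlonglongrightarrow> 0" unfolding e_def G_def by (rule truncation_error_tendsto_0[OF h sq])
  have bound: "(\<integral>\<omega>. indicator (A n) \<omega> * (\<Sum>j=1..n. h (X j \<omega>))\<^sup>2 \<partial>M) / real n
      \<le> 96 * s * real T ^ 4 + prob (A n) / (2 * s) + 2 * e T" if s: "s > 0" and n: "n > 0" for n T s
  proof -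
    define c where "c = (\<integral>\<omega>. G T (X 1 \<omega>) \<partial>M)"
    \<comment> \<open>\<open>G T\<close> is the part of \<open>h\<close> beyond the level
      \<open>T\<close>, and \<open>h - G T\<close> the bounded part. Their means are
      \<open>c\<close> and \<open>- c\<close>, so the shift by \<open>c\<close> makes both
      \<open>p\<close> and \<open>r\<close> centred, with h = p + r.\<close>
    define p where "p x = h x - G T x + c" for x
    define r where "r x = G T x - c" for x
    have [measurable]: "p \<in> borel_measurable borel" "r \<in> borel_measurable borel" unfolding p_def r_def by measurable
    have G2: "integrable M (\<lambda>\<omega>. (G T (X 1 \<omega>))\<^sup>2)"
      by (rule Bochner_Integration.integrable_bound[OF sq]) (auto simp: G_def)
    have G1: "integrable M (\<lambda>\<omega>. G T (X 1 \<omega>))" by (rule square_integrable_imp_integrable[OF _ G2]) simp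
    have hG: "\<bar>h x - G T x\<bar> \<le> real T" for x by (auto simp: G_def)
    have "c = - (\<integral>\<omega>. h (X 1 \<omega>) - G T (X 1 \<omega>) \<partial>M)" unfolding c_def using int1 G1 mean by simp
    moreover have "\<bar>\<integral>\<omega>. h (X 1 \<omega>) - G T (X 1 \<omega>) \<partial>M\<bar> \<le> (\<integral>\<omega>. \<bar>h (X 1 \<omega>) - G T (X 1 \<omega>)\<bar> \<partial>M)"
      by (rule integral_abs_bound)
    moreover have "(\<integral>\<omega>. \<bar>h (X 1 \<omega>) - G T (X 1 \<omega>)\<bar> \<partial>M) \<le> (\<integral>\<omega>. real T \<partial>M)"
      using int1 G1 hG by (intro integral_mono) auto
    ultimately have "\<bar>c\<bar> \<le> (\<integral>\<omega>. real T \<partial>M)" by linarith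
    hence c: "\<bar>c\<bar> \<le> real T" by (simp add: prob_space)
    have p_bound: "\<bar>p x\<bar> \<le> 2 * real T" for x using hG[of x] c unfolding p_def by linarith
    have p_mean: "(\<integral>\<omega>. p (X 1 \<omega>) \<partial>M) = 0" unfolding p_def using int1 G1 mean by (simp add: c_def prob_space)
    have r_mean: "(\<integral>\<omega>. r (X 1 \<omega>) \<partial>M) = 0" unfolding r_def using G1 by (simp add: c_def prob_space)
    have r_eq: "(r x)\<^sup>2 = (G T x)\<^sup>2 - 2 * c * G T x + c\<^sup>2" for x by (simp add: r_def power2_eq_square algebra_simps)
    have r2: "integrable M (\<lambda>\<omega>. (r (X 1 \<omega>))\<^sup>2)" unfolding r_eq using G1 G2 by simp
    have "(\<integral>\<omega>. (r (X 1 \<omega>))\<^sup>2 \<partial>M) = e T - 2 * c * c + c\<^sup>2"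
      unfolding r_eq using G1 G2 by (simp add: prob_space c_def e_def)
    hence r2e: "(\<integral>\<omega>. (r (X 1 \<omega>))\<^sup>2 \<partial>M) \<le> e T" by (simp add: power2_eq_square)
    define P where "P = (\<lambda>\<omega>. \<Sum>j=1..n. p (X j \<omega>))"
    define R where "R = (\<lambda>\<omega>. \<Sum>j=1..n. r (X j \<omega>))"
    have [measurable]: "P \<in> borel_measurable M" "R \<in> borel_measurable M" unfolding P_def R_def by measurable
    have iR: "integrable M (\<lambda>\<omega>. (R \<omega>)\<^sup>2)" unfolding R_def by (rule second_moment_sum(1)[OF _ r2 r_mean]) simp
    have ER: "(\<integral>\<omega>. (R \<omega>)\<^sup>2 \<partial>M) \<le> real n * e T"
      unfolding R_def second_moment_sum(2)[OF \<open>r \<in> borel_measurable borel\<close> r2 r_mean] using r2e by (intro mult_left_mono) auto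
    have bP: "\<bar>P \<omega>\<bar> \<le> real n * (2 * real T)" for \<omega>
    proof -
      have "\<bar>P \<omega>\<bar> \<le> (\<Sum>j=1..n. 2 * real T)" unfolding P_def by (intro order_trans[OF sum_abs] sum_mono p_bound)
      thus ?thesis by simp
    qed
    have iP: "integrable M (\<lambda>\<omega>. P \<omega> ^ 4)"
    proof (rule integrable_const_bound[of _ "(real n * (2 * real T)) ^ 4"])
      show "AE \<omega> in M. norm (P \<omega> ^ 4) \<le> (real n * (2 * real T)) ^ 4"
        using power_mono[OF bP abs_ge_zero] by (intro AE_I2) (simp only: real_norm_def power_abs)
    qed measurable
    have EP: "(\<integral>\<omega>. P \<omega> ^ 4 \<partial>M) \<le> 3 * (real n)\<^sup>2 * (2 * real T) ^ 4"
      unfolding P_def by (rule fourth_moment_sum_le[OF _ p_bound p_mean]) simp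
    have hPR: "(\<Sum>j=1..n. h (X j \<omega>)) = P \<omega> + R \<omega>" for \<omega>
      unfolding P_def R_def sum.distrib[symmetric] by (intro sum.cong) (auto simp: p_def r_def)
    \<comment> \<open>On \<open>A n\<close>, completing the square gives P^2 \<le> (s / n) P^4 + n /
      (4 s), and (P + R)^2 \<le> 2 P^2 + 2 R^2. The parameter \<open>s\<close> balances the fourth
      moment against the probability of \<open>A n\<close>; the constant 96 is 2 times 3 times
      2^4.\<close>
    define q where "q = (\<lambda>\<omega>. 2 * ((s / real n) * P \<omega> ^ 4 + (real n / (4 * s)) * indicator (A n) \<omega>) + 2 * (R \<omega>)\<^sup>2)"
    have le: "indicator (A n) \<omega> * (\<Sum>j=1..n. h (X j \<omega>))\<^sup>2 \<le> q \<omega>" for \<omega>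
    proof -
      have q0: "0 \<le> (s / real n) * P \<omega> ^ 4" using s by simp
      show ?thesis
      proof (cases "\<omega> \<in> A n")
        case True
        have "0 \<le> (s / real n) * ((P \<omega>)\<^sup>2 - real n / (2 * s))\<^sup>2" using s by simp
        also have "\<dots> = (s / real n) * P \<omega> ^ 4 + real n / (4 * s) - (P \<omega>)\<^sup>2"
          using s n by (simp add: power2_eq_square power4_eq_xxxx field_simps)
        finally have "(P \<omega>)\<^sup>2 \<le> (s / real n) * P \<omega> ^ 4 + real n / (4 * s)" by simp
        then obtain u where u: "u = (s / real n) * P \<omega> ^ 4 + real n / (4 * s)" "(P \<omega>)\<^sup>2 \<le> u" by blast
        have "(P \<omega> + R \<omega>)\<^sup>2 \<le> 2 * (P \<omega>)\<^sup>2 + 2 * (R \<omega>)\<^sup>2"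
          using zero_le_power2[of "P \<omega> - R \<omega>"] by (simp add: power2_eq_square algebra_simps)
        moreover have "q \<omega> = 2 * u + 2 * (R \<omega>)\<^sup>2"
          using True by (simp only: u q_def indicator_simps mult_1_right)
        moreover have "indicator (A n) \<omega> * (P \<omega> + R \<omega>)\<^sup>2 = (P \<omega> + R \<omega>)\<^sup>2" using True by simp
        ultimately show ?thesis using u(2) unfolding hPR by linarith
      next
        case False
        thus ?thesis using q0 by (simp add: q_def)
      qed
    qed
    have iq: "integrable M q" unfolding q_def using iP iR by (auto simp: emeasure_eq_measure)
    have Eq: "(\<integral>\<omega>. q \<omega> \<partial>M) = 2 * ((s / real n) * (\<integral>\<omega>. P \<omega> ^ 4 \<partial>M) + (real n / (4 * s)) * prob (A n)) + 2 * (\<integral>\<omega>. (R \<omega>)\<^sup>2 \<partial>M)"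
      unfolding q_def using iP iR by (simp add: emeasure_eq_measure)
    have [measurable]: "(\<lambda>\<omega>. \<Sum>j=1..n. h (X j \<omega>)) \<in> borel_measurable M" by measurable
    have "(\<integral>\<omega>. indicator (A n) \<omega> * (\<Sum>j=1..n. h (X j \<omega>))\<^sup>2 \<partial>M) \<le> (\<integral>\<omega>. q \<omega> \<partial>M)"
    proof (rule integral_mono[OF _ iq le])
      show "integrable M (\<lambda>\<omega>. indicator (A n) \<omega> * (\<Sum>j=1..n. h (X j \<omega>))\<^sup>2)"
      proof (rule Bochner_Integration.integrable_bound[OF iq])
        show "AE \<omega> in M. norm (indicator (A n) \<omega> * (\<Sum>j=1..n. h (X j \<omega>))\<^sup>2) \<le> norm (q \<omega>)"
          using le by (intro AE_I2) (auto simp: abs_mult intro: order_trans[OF _ abs_ge_self])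
      qed measurable
    qed
    also have "\<dots> \<le> 2 * ((s / real n) * (3 * (real n)\<^sup>2 * (2 * real T) ^ 4) + (real n / (4 * s)) * prob (A n)) + 2 * (real n * e T)"
      unfolding Eq using s n EP ER by (intro add_mono mult_left_mono order_refl) auto
    also have "\<dots> = real n * (96 * s * real T ^ 4 + prob (A n) / (2 * s) + 2 * e T)"
      using s n by (simp add: power2_eq_square power_mult_distrib field_simps)
    finally show ?thesis using n by (simp add: pos_divide_le_eq mult.commute)
  qed
  show ?thesis
  proof (rule tendstoI)
    fix \<epsilon> :: real assume \<epsilon>: "\<epsilon> > 0"
    have "\<forall>\<^sub>F T in sequentially. e T < \<epsilon> / 6" by (rule order_tendstoD[OF e0]) (use \<epsilon> in simp)
    then obtain T where T: "e T < \<epsilon> / 6" using eventually_happens'[OF sequentially_bot] by blast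
    \<comment> \<open>The choices are made in the order \<open>T\<close>, \<open>s\<close>,
      \<open>n\<close>: the variance of the remainder, the fourth-moment term and the probability
      term are pushed below \<epsilon> / 3 one after the other.\<close>
    define s where "s = \<epsilon> / (3 * (96 * real T ^ 4 + 1))"
    have s: "s > 0" unfolding s_def using \<epsilon> by (intro divide_pos_pos mult_pos_pos add_nonneg_pos) auto
    have "s * (96 * real T ^ 4 + 1) = \<epsilon> / 3"
    proof -
      have "96 * real T ^ 4 + 1 > 0" by (intro add_nonneg_pos) auto
      thus ?thesis unfolding s_def by (simp add: divide_simps)
    qed
    hence s2: "96 * s * real T ^ 4 < \<epsilon> / 3" using s by (simp add: algebra_simps)
    have "(\<lambda>n. prob (A n) / (2 * s)) \<longlonglongrightarrow> 0" using tendsto_divide[OF A0 tendsto_const, of "2 * s"] s by simp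
    hence "\<forall>\<^sub>F n in sequentially. prob (A n) / (2 * s) < \<epsilon> / 3" by (rule order_tendstoD) (use \<epsilon> in simp)
    thus "\<forall>\<^sub>F n in sequentially. dist ((\<integral>\<omega>. indicator (A n) \<omega> * (\<Sum>j=1..n. h (X j \<omega>))\<^sup>2 \<partial>M) / real n) 0 < \<epsilon>"
      using eventually_gt_at_top[of 0]
    proof eventually_elim
      case (elim n)
      have "0 \<le> (\<integral>\<omega>. indicator (A n) \<omega> * (\<Sum>j=1..n. h (X j \<omega>))\<^sup>2 \<partial>M) / real n"
        by (intro divide_nonneg_nonneg integral_nonneg_AE) auto
      thus ?case using bound[OF s elim(2), of T] elim(1) s2 T by simp
    qed
  qed
qed

text \<open>The error \<open>n^-m\<close> comes from truncating at \<open>n^(1/4)\<close>, where Hoeffding's inequality is still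
  effective.\<close>

lemma upper_deviation_superpolynomial:
  fixes h :: "real \<Rightarrow> real"
  assumes h [measurable]: "h \<in> borel_measurable borel"
    and int: "integrable M (\<lambda>\<omega>. h (X 1 \<omega>))"
    and pos: "\<And>k::nat. integrable M (\<lambda>\<omega>. (max 0 (h (X 1 \<omega>))) ^ k)"
    and d: "d > 0"
  shows "(\<lambda>n. real n ^ m * prob {\<omega>\<in>space M. (\<Sum>j=1..n. h (X j \<omega>)) \<ge> real n * ((\<integral>\<omega>. h (X 1 \<omega>) \<partial>M) + d)}) \<longlonglongrightarrow> 0"
proof -
  define \<mu> where "\<mu> = (\<integral>\<omega>. h (X 1 \<omega>) \<partial>M)"
  \<comment> \<open>Truncation from below at a fixed level only enlarges the sum and moves the mean
    by less than d / 3; this handles a lower tail with just a first moment.\<close>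
  have "(\<lambda>T. \<integral>\<omega>. max (h (X 1 \<omega>)) (- real T) \<partial>M) \<longlonglongrightarrow> \<mu>"
    unfolding \<mu>_def
  proof (rule integral_dominated_convergence[where w = "\<lambda>\<omega>. \<bar>h (X 1 \<omega>)\<bar>"])
    show "AE \<omega> in M. (\<lambda>T. max (h (X 1 \<omega>)) (- real T)) \<longlonglongrightarrow> h (X 1 \<omega>)"
    proof (intro AE_I2 tendsto_eventually)
      fix \<omega>
      show "\<forall>\<^sub>F T in sequentially. max (h (X 1 \<omega>)) (- real T) = h (X 1 \<omega>)"
        using eventually_ge_at_top[of "nat \<lceil>\<bar>h (X 1 \<omega>)\<bar>\<rceil>"]
      proof eventually_elim
        case (elim T)
        hence "\<bar>h (X 1 \<omega>)\<bar> \<le> real T" by linarith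
        thus ?case by simp
      qed
    qed
  qed (use int in auto)
  hence "\<forall>\<^sub>F T in sequentially. (\<integral>\<omega>. max (h (X 1 \<omega>)) (- real T) \<partial>M) < \<mu> + d / 3"
    by (rule order_tendstoD) (use d in simp)
  then obtain T :: nat where T: "(\<integral>\<omega>. max (h (X 1 \<omega>)) (- real T) \<partial>M) < \<mu> + d / 3"
    using eventually_happens'[OF sequentially_bot] by blast
  \<comment> \<open>At the level n^(1/4) the moment of order \<open>k\<close> gives the tail bound
    n^-(m + 2) up to a constant; the union over n summands costs one power, and n^-(m + 1) still
    beats n^m.\<close>
  define k where "k = 4 * (m + 2)"
  define E where "E = (\<integral>\<omega>. (max 0 (h (X 1 \<omega>))) ^ k \<partial>M)"
  define c where "c n = real n powr (1 / 4)" for n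
  define t where "t n x = max (min (h x) (c n)) (- real T)" for n x
  have [measurable]: "t n \<in> borel_measurable borel" for n unfolding t_def by measurable
  define Q where "Q n = real n ^ m * (real n * (E / real n ^ (m + 2)) + exp (- 2 * (real n * (2 * d / 3))\<^sup>2 / (real n * (c n + real T)\<^sup>2)))" for n
  have bound: "real n ^ m * prob {\<omega>\<in>space M. (\<Sum>j=1..n. h (X j \<omega>)) \<ge> real n * (\<mu> + d)} \<le> Q n" if n: "n > 0" for n
  proof -
    have c0: "c n > 0" using n by (simp add: c_def)
    have ck: "c n ^ k = real n ^ (m + 2)"
    proof -
      have "c n ^ k = c n powr real k" using c0 by (simp add: powr_realpow)
      also have "1 / 4 * real k = real (m + 2)" by (simp add: k_def)
      hence "c n powr real k = real n powr real (m + 2)" unfolding c_def powr_powr by (simp only:)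
      also have "\<dots> = real n ^ (m + 2)" using n by (subst powr_realpow) auto
      finally show ?thesis .
    qed
    have tail: "prob {\<omega>\<in>space M. h (X 1 \<omega>) > c n} \<le> E / real n ^ (m + 2)"
    proof -
      have [measurable]: "Measurable.pred M (\<lambda>\<omega>. c n ^ k \<le> (max 0 (h (X 1 \<omega>))) ^ k)" by measurable
      have "prob {\<omega>\<in>space M. h (X 1 \<omega>) > c n} \<le> prob {\<omega>\<in>space M. c n ^ k \<le> (max 0 (h (X 1 \<omega>))) ^ k}"
        using c0 by (intro finite_measure_mono) (auto intro!: power_mono)
      also have "\<dots> \<le> E / c n ^ k"
        unfolding E_def using c0 pos[of k] by (intro integral_Markov_inequality_measure[of _ _ "{}"]) auto
      finally show ?thesis unfolding ck .
    qed
    have [measurable]: "(\<lambda>\<omega>. \<Sum>j=1..n. h (X j \<omega>)) \<in> borel_measurable M" by measurable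
    have [measurable]: "(\<lambda>\<omega>. \<Sum>j=1..n. t n (X j \<omega>)) \<in> borel_measurable M" by measurable
    have mXj: "X j \<in> borel_measurable M" if "j \<in> {1..n}" for j using that by (intro measurable_X) simp
    have ev [measurable]: "{\<omega>\<in>space M. h (X j \<omega>) > c n} \<in> events" if "j \<in> {1..n}" for j
    proof -
      have [measurable]: "X j \<in> borel_measurable M" by (rule mXj[OF that])
      show ?thesis by measurable
    qed
    have intt: "integrable M (\<lambda>\<omega>. t n (X 1 \<omega>))"
      using c0 by (intro integrable_const_bound[of _ "max (c n) (real T)"] AE_I2) (auto simp: t_def)
    have "(\<integral>\<omega>. t n (X 1 \<omega>) \<partial>M) \<le> (\<integral>\<omega>. max (h (X 1 \<omega>)) (- real T) \<partial>M)"
    proof (rule integral_mono[OF intt])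
      show "integrable M (\<lambda>\<omega>. max (h (X 1 \<omega>)) (- real T))" using int by simp
    qed (auto simp: t_def)
    hence mean_t: "(\<integral>\<omega>. t n (X 1 \<omega>) \<partial>M) \<le> \<mu> + d / 3" using T by linarith
    \<comment> \<open>Truncation has used up d / 3 of the margin per summand; the remaining 2 d / 3
      is left to Hoeffding's inequality.\<close>
    define B where "B = {\<omega>\<in>space M. (\<Sum>j=1..n. t n (X j \<omega>)) \<ge> real n * (\<integral>\<omega>. t n (X 1 \<omega>) \<partial>M) + real n * (2 * d / 3)}"
    have [measurable]: "B \<in> events" unfolding B_def by measurable
    have sub: "{\<omega>\<in>space M. (\<Sum>j=1..n. h (X j \<omega>)) \<ge> real n * (\<mu> + d)} \<subseteq> (\<Union>j\<in>{1..n}. {\<omega>\<in>space M. h (X j \<omega>) > c n}) \<union> B"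
    proof
      fix \<omega> assume \<omega>: "\<omega> \<in> {\<omega>\<in>space M. (\<Sum>j=1..n. h (X j \<omega>)) \<ge> real n * (\<mu> + d)}"
      show "\<omega> \<in> (\<Union>j\<in>{1..n}. {\<omega>\<in>space M. h (X j \<omega>) > c n}) \<union> B"
      proof (cases "\<exists>j\<in>{1..n}. h (X j \<omega>) > c n")
        case True thus ?thesis using \<omega> by auto
      next
        case False
        have "(\<Sum>j=1..n. h (X j \<omega>)) \<le> (\<Sum>j=1..n. t n (X j \<omega>))"
          using False by (intro sum_mono) (auto simp: t_def not_less)
        moreover have "real n * (\<integral>\<omega>. t n (X 1 \<omega>) \<partial>M) \<le> real n * (\<mu> + d / 3)" by (intro mult_left_mono mean_t) simp
        hence "real n * (\<integral>\<omega>. t n (X 1 \<omega>) \<partial>M) + real n * (2 * d / 3) \<le> real n * (\<mu> + d)" by (simp add: algebra_simps)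
        ultimately show ?thesis using \<omega> by (auto simp: B_def)
      qed
    qed
    have "prob {\<omega>\<in>space M. (\<Sum>j=1..n. h (X j \<omega>)) \<ge> real n * (\<mu> + d)}
        \<le> prob ((\<Union>j\<in>{1..n}. {\<omega>\<in>space M. h (X j \<omega>) > c n}) \<union> B)"
      using ev by (intro finite_measure_mono sub sets.Un sets.finite_UN) auto
    also have "\<dots> \<le> prob (\<Union>j\<in>{1..n}. {\<omega>\<in>space M. h (X j \<omega>) > c n}) + prob B"
      using ev by (intro measure_Un_le sets.finite_UN) auto
    also have "prob (\<Union>j\<in>{1..n}. {\<omega>\<in>space M. h (X j \<omega>) > c n}) \<le> (\<Sum>j\<in>{1..n}. prob {\<omega>\<in>space M. h (X j \<omega>) > c n})"
      using ev by (intro finite_measure_subadditive_finite) auto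
    also have "(\<Sum>j\<in>{1..n}. prob {\<omega>\<in>space M. h (X j \<omega>) > c n}) \<le> (\<Sum>j\<in>{1..n}. E / real n ^ (m + 2))"
    proof (rule sum_mono)
      fix j assume "j \<in> {1..n}"
      hence "prob {\<omega>\<in>space M. h (X j \<omega>) > c n} = prob {\<omega>\<in>space M. h (X 1 \<omega>) > c n}"
        by (intro prob_X) auto
      thus "prob {\<omega>\<in>space M. h (X j \<omega>) > c n} \<le> E / real n ^ (m + 2)" using tail by simp
    qed
    also have "prob B \<le> exp (- 2 * (real n * (2 * d / 3))\<^sup>2 / (real n * (c n + real T)\<^sup>2))"
    proof -
      interpret H: Hoeffding_ineq_iid M "{1..n}" "\<lambda>j \<omega>. t n (X j \<omega>)" "\<lambda>\<omega>. t n (X 1 \<omega>)" "- real T" "c n" "\<integral>\<omega>. t n (X 1 \<omega>) \<partial>M"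
      proof unfold_locales
        show "indep_vars (\<lambda>_. borel) (\<lambda>j \<omega>. t n (X j \<omega>)) {1..n}" by (rule indep_vars_compose_X) auto
        show "distr M borel (\<lambda>\<omega>. t n (X i \<omega>)) = distr M borel (\<lambda>\<omega>. t n (X 1 \<omega>))" if i: "i \<in> {1..n}" for i
        proof -
          have "distr (distr M borel (X l)) borel (t n) = distr M borel (\<lambda>\<omega>. t n (X l \<omega>))" if "l \<ge> 1" for l
            using that measurable_X[of l] by (subst distr_distr) (auto simp: o_def)
          from this[of i] this[of 1] show ?thesis using distr_X[of i] i by simp
        qed
        show "AE \<omega> in M. t n (X 1 \<omega>) \<in> {- real T..c n}" using c0 by (intro AE_I2) (auto simp: t_def)
      qed auto
      have "prob {\<omega>\<in>space M. (\<Sum>j=1..n. t n (X j \<omega>)) \<ge> real (card {1..n}) * (\<integral>\<omega>. t n (X 1 \<omega>) \<partial>M) + real n * (2 * d / 3)}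
          \<le> exp (- 2 * (real n * (2 * d / 3))\<^sup>2 / (real (card {1..n}) * (c n - - real T)\<^sup>2))"
        using d c0 n by (intro H.Hoeffding_ineq_ge) auto
      thus ?thesis by (simp add: B_def)
    qed
    finally have "prob {\<omega>\<in>space M. (\<Sum>j=1..n. h (X j \<omega>)) \<ge> real n * (\<mu> + d)}
        \<le> real n * (E / real n ^ (m + 2)) + exp (- 2 * (real n * (2 * d / 3))\<^sup>2 / (real n * (c n + real T)\<^sup>2))"
      by simp
    thus ?thesis unfolding Q_def by (intro mult_left_mono) auto
  qed
  have "Q \<longlonglongrightarrow> 0"
  proof -
    have 1: "(\<lambda>n. real n ^ m * (real n * (E / real n ^ (m + 2)))) \<longlonglongrightarrow> 0"
    proof -
      have "(\<lambda>n. E * inverse (real n)) \<longlonglongrightarrow> 0" by (intro tendsto_mult_right_zero lim_inverse_n)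
      moreover have "\<forall>\<^sub>F n in sequentially. E * inverse (real n) = real n ^ m * (real n * (E / real n ^ (m + 2)))"
        using eventually_gt_at_top[of 0] by eventually_elim (simp add: field_simps power_add power2_eq_square)
      ultimately show ?thesis by (rule Lim_transform_eventually)
    qed
    have 2: "(\<lambda>n. real n ^ m * exp (- 2 * (real n * (2 * d / 3))\<^sup>2 / (real n * (c n + real T)\<^sup>2))) \<longlonglongrightarrow> 0"
    proof -
      \<comment> \<open>The truncated variables have range at most n^(1/4) (1 + T), so Hoeffding's
        exponent is at least \<gamma> times the square root of n.\<close>
      define \<gamma> where "\<gamma> = 8 * d\<^sup>2 / (9 * (1 + real T)\<^sup>2)"
      have \<gamma>: "\<gamma> > 0" using d unfolding \<gamma>_def by (intro divide_pos_pos mult_pos_pos) auto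
      have "(\<lambda>n. real n ^ m * exp (- \<gamma> * sqrt (real n))) \<longlonglongrightarrow> 0" using \<gamma> by real_asymp
      moreover have "\<forall>\<^sub>F n in sequentially. norm (real n ^ m * exp (- 2 * (real n * (2 * d / 3))\<^sup>2 / (real n * (c n + real T)\<^sup>2)))
          \<le> real n ^ m * exp (- \<gamma> * sqrt (real n))"
        using eventually_gt_at_top[of 0]
      proof eventually_elim
        case (elim n)
        have c1: "c n \<ge> 1" using elim by (simp add: c_def ge_one_powr_ge_zero)
        have c2: "(c n)\<^sup>2 = sqrt (real n)"
        proof -
          have "(c n)\<^sup>2 = c n powr 2" using c1 by (simp add: powr_numeral)
          also have "\<dots> = real n powr (1/2)" unfolding c_def powr_powr by simp
          finally show ?thesis by (simp add: powr_half_sqrt)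
        qed
        have "c n + real T \<le> c n * (1 + real T)" using c1 mult_right_mono[of 1 "c n" "real T"] by (simp add: algebra_simps)
        hence "(c n + real T)\<^sup>2 \<le> (c n * (1 + real T))\<^sup>2" using c1 by (intro power_mono) auto
        also have "\<dots> = sqrt (real n) * (1 + real T)\<^sup>2" by (simp add: power_mult_distrib c2)
        finally have ct: "(c n + real T)\<^sup>2 \<le> sqrt (real n) * (1 + real T)\<^sup>2" .
        have p0: "(c n + real T)\<^sup>2 > 0" using c1 by (intro zero_less_power) auto
        have "\<gamma> * sqrt (real n) = (8 * d\<^sup>2 / 9) * real n / (sqrt (real n) * (1 + real T)\<^sup>2)"
          using elim by (simp add: \<gamma>_def real_div_sqrt field_simps)
        also have "\<dots> \<le> (8 * d\<^sup>2 / 9) * real n / (c n + real T)\<^sup>2"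
          using ct p0 elim by (intro divide_left_mono mult_pos_pos) auto
        also have "\<dots> = 2 * (real n * (2 * d / 3))\<^sup>2 / (real n * (c n + real T)\<^sup>2)"
          using elim by (simp add: power2_eq_square)
        finally show ?case by (simp add: mult_left_mono)
      qed
      ultimately show ?thesis by (rule Lim_null_comparison[rotated])
    qed
    show ?thesis unfolding Q_def distrib_left using tendsto_add[OF 1 2] by simp
  qed
  thus ?thesis
    unfolding \<mu>_def[symmetric]
  proof (rule Lim_null_comparison[rotated])
    show "\<forall>\<^sub>F n in sequentially. norm (real n ^ m * prob {\<omega>\<in>space M. (\<Sum>j=1..n. h (X j \<omega>)) \<ge> real n * (\<mu> + d)}) \<le> Q n"
      using eventually_gt_at_top[of 0] by eventually_elim (use bound in \<open>simp add: measure_nonneg\<close>)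
  qed
qed

end

section \<open>Means in convex sets, rare events and transfer of moments\<close>

section \<open>Means and rare events\<close>

text \<open>\<open>S\<close> need not be closed, so separation works in two rounds. If the mean were
  missing from \<open>S\<close>, a line through it would contain \<open>Y\<close> almost surely; the
  part of \<open>S\<close> on that line lies on one side of the mean, so \<open>Y\<close> would
  equal its mean almost surely and the mean would be in \<open>S\<close>.\<close>

lemma (in prob_space) expectation_in_convex:
  fixes Y :: "'a \<Rightarrow> complex"
  assumes Y: "integrable M Y" and S: "convex S" and in_S: "AE \<omega> in M. Y \<omega> \<in> S"
  shows "(\<integral>\<omega>. Y \<omega> \<partial>M) \<in> S"
proof (rule ccontr)
  define \<mu> where "\<mu> = (\<integral>\<omega>. Y \<omega> \<partial>M)"
  assume "(\<integral>\<omega>. Y \<omega> \<partial>M) \<notin> S"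
  hence notin: "\<mu> \<notin> S" by (simp add: \<mu>_def)
  have const: "AE \<omega> in M. a \<bullet> Y \<omega> = a \<bullet> \<mu>" if ge: "AE \<omega> in M. a \<bullet> \<mu> \<le> a \<bullet> Y \<omega>" for a
  proof -
    have int: "integrable M (\<lambda>\<omega>. a \<bullet> Y \<omega> - a \<bullet> \<mu>)" using Y by simp
    have "(\<integral>\<omega>. a \<bullet> Y \<omega> - a \<bullet> \<mu> \<partial>M) = 0" using Y by (simp add: \<mu>_def prob_space)
    moreover have "AE \<omega> in M. 0 \<le> a \<bullet> Y \<omega> - a \<bullet> \<mu>" using ge by eventually_elim simp
    ultimately have "AE \<omega> in M. a \<bullet> Y \<omega> - a \<bullet> \<mu> = 0" using integral_nonneg_eq_0_iff_AE[OF int] by simp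
    thus ?thesis by eventually_elim simp
  qed
  obtain w0 where "w0 \<in> S"
  proof -
    have "\<exists>\<omega>. Y \<omega> \<in> S" using eventually_happens'[OF ae_filter_bot in_S] .
    thus ?thesis using that by blast
  qed
  then obtain a b where a: "a \<noteq> 0" "\<And>x. x \<in> {\<mu>} \<Longrightarrow> a \<bullet> x \<le> b" "\<And>x. x \<in> S \<Longrightarrow> b \<le> a \<bullet> x"
    using separating_hyperplane_sets[of "{\<mu>}" S] S notin by auto
  have a1: "AE \<omega> in M. a \<bullet> Y \<omega> = a \<bullet> \<mu>"
  proof (rule const)
    have "a \<bullet> \<mu> \<le> a \<bullet> x" if "x \<in> S" for x using a(2)[of \<mu>] a(3)[OF that] by simp
    hence "AE \<omega> in M. Y \<omega> \<in> S \<longrightarrow> a \<bullet> \<mu> \<le> a \<bullet> Y \<omega>" by (intro AE_I2) simp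
    with in_S show "AE \<omega> in M. a \<bullet> \<mu> \<le> a \<bullet> Y \<omega>" by (rule AE_mp)
  qed
  \<comment> \<open>\<open>a\<close> turned by a right angle; together the two functionals are
    coordinates of the plane.\<close>
  define a' where "a' = \<i> * a"
  have eq_if: "x = y" if "a \<bullet> x = a \<bullet> y" "a' \<bullet> x = a' \<bullet> y" for x y
  proof -
    have "cnj a * (x - y) = 0"
      using that by (simp add: complex_eq_iff inner_complex_def a'_def algebra_simps)
    thus ?thesis using a(1) by simp
  qed
  have line: "a' \<bullet> x \<noteq> a' \<bullet> \<mu>" if "x \<in> S" "a \<bullet> x = a \<bullet> \<mu>" for x
    using eq_if[of x \<mu>] that notin by auto
  have side: "(\<forall>x\<in>S. a \<bullet> x = a \<bullet> \<mu> \<longrightarrow> a' \<bullet> \<mu> \<le> a' \<bullet> x) \<or> (\<forall>x\<in>S. a \<bullet> x = a \<bullet> \<mu> \<longrightarrow> a' \<bullet> x \<le> a' \<bullet> \<mu>)"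
  proof (rule ccontr)
    assume "\<not> ?thesis"
    then obtain x y where x: "x \<in> S" "a \<bullet> x = a \<bullet> \<mu>" "a' \<bullet> x < a' \<bullet> \<mu>" and y: "y \<in> S" "a \<bullet> y = a \<bullet> \<mu>" "a' \<bullet> \<mu> < a' \<bullet> y"
      by (auto simp: not_le)
    define t where "t = (a' \<bullet> \<mu> - a' \<bullet> x) / (a' \<bullet> y - a' \<bullet> x)"
    have t: "0 \<le> t" "t \<le> 1" "t * (a' \<bullet> y - a' \<bullet> x) = a' \<bullet> \<mu> - a' \<bullet> x" using x y by (auto simp: t_def field_simps)
    have "(1 - t) *\<^sub>R x + t *\<^sub>R y \<in> S" using x y t by (intro convexD[OF S]) auto
    moreover have "(1 - t) *\<^sub>R x + t *\<^sub>R y = \<mu>"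
      using t(3) x(2) y(2) by (intro eq_if) (simp_all add: inner_add_right algebra_simps)
    ultimately show False using notin by simp
  qed
  have "AE \<omega> in M. a' \<bullet> Y \<omega> = a' \<bullet> \<mu>"
    using side
  proof
    assume *: "\<forall>x\<in>S. a \<bullet> x = a \<bullet> \<mu> \<longrightarrow> a' \<bullet> \<mu> \<le> a' \<bullet> x"
    have "AE \<omega> in M. a' \<bullet> \<mu> \<le> a' \<bullet> Y \<omega>" using in_S a1 by eventually_elim (use * in blast)
    thus ?thesis by (rule const)
  next
    assume *: "\<forall>x\<in>S. a \<bullet> x = a \<bullet> \<mu> \<longrightarrow> a' \<bullet> x \<le> a' \<bullet> \<mu>"
    have "AE \<omega> in M. (- a') \<bullet> \<mu> \<le> (- a') \<bullet> Y \<omega>" using in_S a1 by eventually_elim (use * in auto)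
    from const[OF this] show ?thesis by simp
  qed
  hence "AE \<omega> in M. False" using a1 in_S by eventually_elim (use line in blast)
  thus False by simp
qed

text \<open>The second moment is split at the level t = n^k. Below it the rarity of
  \<open>E n\<close> beats t^2; above it W^2 \<le> t^(-\<epsilon>) W^(2 + \<epsilon>), and k
  \<epsilon> \<ge> 2 makes the expectation O(n^-2), enough against the factor n.\<close>

lemma (in prob_space) truncated_second_moment_negligible:
  fixes W :: "nat \<Rightarrow> 'a \<Rightarrow> real"
  assumes \<epsilon>: "\<epsilon> > 0" and W [measurable]: "\<And>n. W n \<in> borel_measurable M" and W0: "\<And>n \<omega>. 0 \<le> W n \<omega>"
    and bdd: "\<forall>\<^sub>F n in sequentially. integrable M (\<lambda>\<omega>. W n \<omega> powr (2 + \<epsilon>)) \<and> (\<integral>\<omega>. W n \<omega> powr (2 + \<epsilon>) \<partial>M) \<le> B"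
    and E [measurable]: "\<And>n. E n \<in> events" and E0: "\<And>m::nat. (\<lambda>n. real n ^ m * prob (E n)) \<longlonglongrightarrow> 0"
  shows "(\<lambda>n. real n * (\<integral>\<omega>. indicator (E n) \<omega> * (W n \<omega>)\<^sup>2 \<partial>M)) \<longlonglongrightarrow> 0"
proof -
  define k :: nat where "k = nat \<lceil>2 / \<epsilon>\<rceil>"
  have k: "real k * \<epsilon> \<ge> 2"
  proof -
    have "real k \<ge> 2 / \<epsilon>" unfolding k_def by (rule real_nat_ceiling_ge)
    thus ?thesis using \<epsilon> by (simp add: field_simps)
  qed
  define Q where "Q n = real n * (B * inverse ((real n)\<^sup>2) + real n ^ (2 * k) * prob (E n))" for n
  have B0: "B \<ge> 0"
  proof -
    obtain n where "(\<integral>\<omega>. W n \<omega> powr (2 + \<epsilon>) \<partial>M) \<le> B"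
      using eventually_happens'[OF sequentially_bot bdd] by blast
    moreover have "0 \<le> (\<integral>\<omega>. W n \<omega> powr (2 + \<epsilon>) \<partial>M)" by (intro integral_nonneg_AE) auto
    ultimately show ?thesis by linarith
  qed
  have "Q \<longlonglongrightarrow> 0"
  proof -
    have "(\<lambda>n. B * inverse (real n) + real n ^ (2 * k + 1) * prob (E n)) \<longlonglongrightarrow> B * 0 + 0"
      by (intro tendsto_intros E0 lim_inverse_n)
    moreover have "\<forall>\<^sub>F n in sequentially. B * inverse (real n) + real n ^ (2 * k + 1) * prob (E n) = Q n"
      using eventually_gt_at_top[of 0]
      by eventually_elim (simp add: Q_def field_simps power2_eq_square)
    ultimately show ?thesis by (simp add: Lim_transform_eventually)
  qed
  thus ?thesis
  proof (rule Lim_null_comparison[rotated])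
    show "\<forall>\<^sub>F n in sequentially. norm (real n * (\<integral>\<omega>. indicator (E n) \<omega> * (W n \<omega>)\<^sup>2 \<partial>M)) \<le> Q n"
      using bdd eventually_gt_at_top[of 0]
    proof eventually_elim
      case (elim n)
      define t where "t = real n ^ k"
      have t: "t \<ge> 1" unfolding t_def using elim by (intro one_le_power) auto
      have t\<epsilon>: "t powr (- \<epsilon>) \<le> inverse ((real n)\<^sup>2)"
      proof -
        have "t powr (- \<epsilon>) = real n powr (- (real k * \<epsilon>))"
          unfolding t_def using elim by (simp add: powr_realpow[symmetric] powr_powr)
        also have "\<dots> \<le> real n powr (- 2)" using k elim by (intro powr_mono) auto
        also have "\<dots> = inverse ((real n)\<^sup>2)" using elim by (simp add: powr_minus powr_numeral)
        finally show ?thesis .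
      qed
      define q where "q = (\<lambda>\<omega>. t powr (- \<epsilon>) * W n \<omega> powr (2 + \<epsilon>) + t\<^sup>2 * indicator (E n) \<omega>)"
      have le: "indicator (E n) \<omega> * (W n \<omega>)\<^sup>2 \<le> q \<omega>" for \<omega>
      proof (cases "\<omega> \<in> E n")
        case True
        show ?thesis
        proof (cases "W n \<omega> \<le> t")
          case True
          have "(W n \<omega>)\<^sup>2 \<le> t\<^sup>2" using True W0 by (intro power_mono) auto
          thus ?thesis using \<open>\<omega> \<in> E n\<close> by (simp add: q_def add_increasing)
        next
          case False
          hence w: "W n \<omega> > 0" "t \<le> W n \<omega>" using t by auto
          have "1 = t powr (- \<epsilon>) * t powr \<epsilon>" using t by (simp flip: powr_add)
          also have "\<dots> \<le> t powr (- \<epsilon>) * W n \<omega> powr \<epsilon>" using w t \<epsilon> by (intro mult_left_mono powr_mono2) auto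
          finally have "(W n \<omega>)\<^sup>2 * 1 \<le> (W n \<omega>)\<^sup>2 * (t powr (- \<epsilon>) * W n \<omega> powr \<epsilon>)" by (intro mult_left_mono) auto
          also have "\<dots> = t powr (- \<epsilon>) * W n \<omega> powr (2 + \<epsilon>)" using w by (simp add: powr_add powr_numeral)
          finally show ?thesis using \<open>\<omega> \<in> E n\<close> by (simp add: q_def add_increasing2)
        qed
      qed (simp add: q_def)
      have iq: "integrable M q" unfolding q_def using elim by (auto simp: emeasure_eq_measure)
      have "(\<integral>\<omega>. indicator (E n) \<omega> * (W n \<omega>)\<^sup>2 \<partial>M) \<le> (\<integral>\<omega>. q \<omega> \<partial>M)"
      proof (rule integral_mono[OF _ iq le])
        show "integrable M (\<lambda>\<omega>. indicator (E n) \<omega> * (W n \<omega>)\<^sup>2)"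
        proof (rule Bochner_Integration.integrable_bound[OF iq])
          show "AE \<omega> in M. norm (indicator (E n) \<omega> * (W n \<omega>)\<^sup>2) \<le> norm (q \<omega>)"
            using le by (intro AE_I2) (auto simp: abs_mult intro: order_trans[OF _ abs_ge_self])
        qed measurable
      qed
      also have "\<dots> = t powr (- \<epsilon>) * (\<integral>\<omega>. W n \<omega> powr (2 + \<epsilon>) \<partial>M) + t\<^sup>2 * prob (E n)"
        unfolding q_def using elim by (simp add: emeasure_eq_measure)
      also have "\<dots> \<le> inverse ((real n)\<^sup>2) * B + t\<^sup>2 * prob (E n)"
        using elim t\<epsilon> B0 by (intro add_mono mult_mono order_refl integral_nonneg_AE) auto
      also have "t\<^sup>2 = real n ^ (2 * k)" by (simp add: t_def mult.commute flip: power_mult)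
      finally have "real n * (\<integral>\<omega>. indicator (E n) \<omega> * (W n \<omega>)\<^sup>2 \<partial>M) \<le> Q n"
        unfolding Q_def by (intro mult_left_mono) (auto simp: mult.commute)
      moreover have "0 \<le> (\<integral>\<omega>. indicator (E n) \<omega> * (W n \<omega>)\<^sup>2 \<partial>M)" by (intro integral_nonneg_AE) auto
      ultimately show ?case by simp
    qed
  qed
qed

context iid_sequence
begin

text \<open>For some level \<open>K\<close>, the values of \<open>h\<close> at \<open>X 2\<close>,
  ..., \<open>X N\<close> are all bounded by \<open>K\<close> with positive probability. On this
  event \<phi> (X 1) is dominated through \<open>G\<close>, and by independence its integral over
  the event is the wanted integral times that probability. In the application \<open>G\<close> is a
  moment of the inverse at the average of \<open>N\<close> terms.\<close>

lemma first_moment_finite_of_mean: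
  fixes h :: "real \<Rightarrow> complex" and \<phi> :: "real \<Rightarrow> ennreal"
  assumes [measurable]: "h \<in> borel_measurable borel" "\<phi> \<in> borel_measurable borel" "G \<in> borel_measurable M"
    and N: "N \<ge> 1" and G: "(\<integral>\<^sup>+\<omega>. G \<omega> \<partial>M) < \<infinity>"
    and dom: "\<And>K. \<exists>c<\<infinity>. AE \<omega> in M. (\<forall>j\<in>{2..N}. norm (h (X j \<omega>)) \<le> K) \<longrightarrow> \<phi> (X 1 \<omega>) \<le> c * (1 + G \<omega>)"
  shows "(\<integral>\<^sup>+\<omega>. \<phi> (X 1 \<omega>) \<partial>M) < \<infinity>"
proof -
  have "\<exists>K::nat. prob {\<omega>\<in>space M. norm (h (X 1 \<omega>)) \<le> real K} \<noteq> 0"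
  proof (rule ccontr)
    assume "\<not> ?thesis"
    hence "AE \<omega> in M. \<not> norm (h (X 1 \<omega>)) \<le> real K" for K :: nat
      by (subst (asm) AE_iff_measurable[OF _ refl, symmetric] | simp add: AE_iff_measurable[OF _ refl] emeasure_eq_measure)+
    hence "AE \<omega> in M. \<forall>K::nat. \<not> norm (h (X 1 \<omega>)) \<le> real K" by (simp add: AE_all_countable)
    hence "AE \<omega> in M. False" by eventually_elim (meson real_arch_simple)
    thus False by simp
  qed
  then obtain K :: nat where K: "prob {\<omega>\<in>space M. norm (h (X 1 \<omega>)) \<le> real K} \<noteq> 0" by blast
  obtain c where c: "c < \<infinity>" "AE \<omega> in M. (\<forall>j\<in>{2..N}. norm (h (X j \<omega>)) \<le> real K) \<longrightarrow> \<phi> (X 1 \<omega>) \<le> c * (1 + G \<omega>)"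
    using dom by blast
  \<comment> \<open>A product over the single variables: \<phi> for the first, and for the others
    the indicator that \<open>h\<close> is bounded by \<open>K\<close>.\<close>
  define F :: "nat \<Rightarrow> real \<Rightarrow> ennreal" where "F j = (if j = 1 then \<phi> else indicator {x. norm (h x) \<le> real K})" for j
  have [measurable]: "F j \<in> borel_measurable borel" for j by (simp add: F_def)
  have split: "{1..N} = insert 1 {2..N}" using N by auto
  have "(\<integral>\<^sup>+\<omega>. (\<Prod>j\<in>{1..N}. F j (X j \<omega>)) \<partial>M) = (\<Prod>j\<in>{1..N}. \<integral>\<^sup>+\<omega>. F j (X j \<omega>) \<partial>M)"
    by (intro indep_vars_nn_integral indep_vars_compose_X) auto
  also have "\<dots> = (\<integral>\<^sup>+\<omega>. \<phi> (X 1 \<omega>) \<partial>M) * (\<Prod>j\<in>{2..N}. \<integral>\<^sup>+\<omega>. F j (X j \<omega>) \<partial>M)"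
    unfolding split by (simp add: F_def)
  finally have eq: "(\<integral>\<^sup>+\<omega>. (\<Prod>j\<in>{1..N}. F j (X j \<omega>)) \<partial>M) = (\<integral>\<^sup>+\<omega>. \<phi> (X 1 \<omega>) \<partial>M) * (\<Prod>j\<in>{2..N}. \<integral>\<^sup>+\<omega>. F j (X j \<omega>) \<partial>M)" .
  have "(\<integral>\<^sup>+\<omega>. (\<Prod>j\<in>{1..N}. F j (X j \<omega>)) \<partial>M) \<le> (\<integral>\<^sup>+\<omega>. c * (1 + G \<omega>) \<partial>M)"
  proof (rule nn_integral_mono_AE)
    show "AE \<omega> in M. (\<Prod>j\<in>{1..N}. F j (X j \<omega>)) \<le> c * (1 + G \<omega>)"
      using c(2)
    proof eventually_elim
      case (elim \<omega>)
      show ?case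
      proof (cases "\<forall>j\<in>{2..N}. norm (h (X j \<omega>)) \<le> real K")
        case True
        hence "(\<Prod>j\<in>{2..N}. F j (X j \<omega>)) = 1" by (intro prod.neutral) (auto simp: F_def)
        hence "(\<Prod>j\<in>{1..N}. F j (X j \<omega>)) = \<phi> (X 1 \<omega>)" unfolding split by (simp add: F_def)
        thus ?thesis using elim True by simp
      next
        case False
        then obtain j where "j \<in> {2..N}" "F j (X j \<omega>) = 0" by (auto simp: F_def)
        hence zero: "(\<Prod>j\<in>{1..N}. F j (X j \<omega>)) = 0" by (intro prod_zero) auto
        show ?thesis unfolding zero by simp
      qed
    qed
  qed
  also have "\<dots> = c * (1 + (\<integral>\<^sup>+\<omega>. G \<omega> \<partial>M))"
    by (simp add: nn_integral_cmult nn_integral_add emeasure_space_1)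
  also have "\<dots> < \<infinity>" using c(1) G by (simp add: ennreal_mult_less_top)
  finally have fin: "(\<integral>\<^sup>+\<omega>. \<phi> (X 1 \<omega>) \<partial>M) * (\<Prod>j\<in>{2..N}. \<integral>\<^sup>+\<omega>. F j (X j \<omega>) \<partial>M) < \<infinity>" unfolding eq .
  have nz: "(\<Prod>j\<in>{2..N}. \<integral>\<^sup>+\<omega>. F j (X j \<omega>) \<partial>M) \<noteq> 0"
  proof -
    have "(\<integral>\<^sup>+\<omega>. F j (X j \<omega>) \<partial>M) \<noteq> 0" if j: "j \<in> {2..N}" for j
    proof -
      have [measurable]: "X j \<in> borel_measurable M" using j by (intro measurable_X) simp
      have "(\<integral>\<^sup>+\<omega>. F j (X j \<omega>) \<partial>M) = (\<integral>\<^sup>+\<omega>. indicator {\<omega>\<in>space M. norm (h (X j \<omega>)) \<le> real K} \<omega> \<partial>M)"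
        using j by (intro nn_integral_cong) (auto simp: F_def split: split_indicator)
      also have "\<dots> = prob {\<omega>\<in>space M. norm (h (X j \<omega>)) \<le> real K}"
        by (simp add: emeasure_eq_measure)
      also have "prob {\<omega>\<in>space M. norm (h (X j \<omega>)) \<le> real K} = prob {\<omega>\<in>space M. norm (h (X 1 \<omega>)) \<le> real K}"
        using j by (intro prob_X) auto
      finally show ?thesis using K by (simp add: measure_le_0_iff)
    qed
    thus ?thesis by (simp add: prod_zero_iff)
  qed
  show ?thesis
  proof (rule ccontr)
    assume "\<not> ?thesis"
    hence top: "(\<integral>\<^sup>+\<omega>. \<phi> (X 1 \<omega>) \<partial>M) = \<infinity>" by (simp add: less_top[symmetric])
    have "(\<integral>\<^sup>+\<omega>. \<phi> (X 1 \<omega>) \<partial>M) * (\<Prod>j\<in>{2..N}. \<integral>\<^sup>+\<omega>. F j (X j \<omega>) \<partial>M) = \<infinity>"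
      unfolding top using nz by (simp only: infinity_ennreal_def ennreal_top_mult if_False)
    with fin show False by simp
  qed
qed

text \<open>\<open>k\<close> is not centred: its fluctuation is handled by uniform integrability,
  while the square of its mean contributes a multiple of n P(A n), which explains the hypothesis
  that this product tends to 0.\<close>

lemma mean_square_on_rare_events:
  fixes k :: "real \<Rightarrow> real"
  assumes k [measurable]: "k \<in> borel_measurable borel" and sq: "integrable M (\<lambda>\<omega>. (k (X 1 \<omega>))\<^sup>2)"
    and A [measurable]: "\<And>n. A n \<in> events" and A0: "(\<lambda>n. real n * prob (A n)) \<longlonglongrightarrow> 0"
  shows "(\<lambda>n. real n * (\<integral>\<omega>. indicator (A n) \<omega> * ((\<Sum>j=1..n. k (X j \<omega>)) / real n)\<^sup>2 \<partial>M)) \<longlonglongrightarrow> 0"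
    and "n > 0 \<Longrightarrow> integrable M (\<lambda>\<omega>. ((\<Sum>j=1..n. k (X j \<omega>)) / real n)\<^sup>2)"
proof -
  define m where "m = (\<integral>\<omega>. k (X 1 \<omega>) \<partial>M)"
  define h where "h x = k x - m" for x
  have [measurable]: "h \<in> borel_measurable borel" unfolding h_def by measurable
  have int1: "integrable M (\<lambda>\<omega>. k (X 1 \<omega>))" by (rule square_integrable_imp_integrable[OF _ sq]) simp
  have h_mean: "(\<integral>\<omega>. h (X 1 \<omega>) \<partial>M) = 0" unfolding h_def using int1 by (simp add: m_def prob_space)
  have "(h x)\<^sup>2 = (k x)\<^sup>2 - 2 * m * k x + m\<^sup>2" for x by (simp add: h_def power2_eq_square algebra_simps)
  hence h2: "integrable M (\<lambda>\<omega>. (h (X 1 \<omega>))\<^sup>2)" using int1 sq by simp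
  have sum_eq: "(\<Sum>j=1..n. k (X j \<omega>)) / real n = (\<Sum>j=1..n. h (X j \<omega>)) / real n + m" if "n > 0" for n \<omega>
    using that by (simp add: h_def sum_subtractf field_simps)
  have le: "((\<Sum>j=1..n. k (X j \<omega>)) / real n)\<^sup>2 \<le> 2 * ((\<Sum>j=1..n. h (X j \<omega>))\<^sup>2 / (real n)\<^sup>2) + 2 * m\<^sup>2" if "n > 0" for n \<omega>
  proof -
    have "(a + b)\<^sup>2 \<le> 2 * a\<^sup>2 + 2 * b\<^sup>2" for a b :: real
      using zero_le_power2[of "a - b"] by (simp add: power2_eq_square algebra_simps)
    from this[of "(\<Sum>j=1..n. h (X j \<omega>)) / real n" m] show ?thesis unfolding sum_eq[OF that] by (simp add: power_divide)
  qed
  have Sh2: "integrable M (\<lambda>\<omega>. (\<Sum>j=1..n. h (X j \<omega>))\<^sup>2)" for n by (rule second_moment_sum(1)[OF _ h2 h_mean]) simp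
  have [measurable]: "(\<lambda>\<omega>. \<Sum>j=1..n. h (X j \<omega>)) \<in> borel_measurable M" "(\<lambda>\<omega>. \<Sum>j=1..n. k (X j \<omega>)) \<in> borel_measurable M" for n
    by measurable
  show int: "integrable M (\<lambda>\<omega>. ((\<Sum>j=1..n. k (X j \<omega>)) / real n)\<^sup>2)" if n: "n > 0" for n
  proof (rule Bochner_Integration.integrable_bound)
    show "integrable M (\<lambda>\<omega>. 2 * ((\<Sum>j=1..n. h (X j \<omega>))\<^sup>2 / (real n)\<^sup>2) + 2 * m\<^sup>2)" using Sh2 by simp
    show "AE \<omega> in M. norm (((\<Sum>j=1..n. k (X j \<omega>)) / real n)\<^sup>2) \<le> norm (2 * ((\<Sum>j=1..n. h (X j \<omega>))\<^sup>2 / (real n)\<^sup>2) + 2 * m\<^sup>2)"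
      using le[OF n] by (intro AE_I2) (auto intro: order_trans[OF _ abs_ge_self])
  qed measurable
  have pA: "(\<lambda>n. prob (A n)) \<longlonglongrightarrow> 0"
  proof (rule Lim_null_comparison[OF _ A0])
    show "\<forall>\<^sub>F n in sequentially. norm (prob (A n)) \<le> real n * prob (A n)"
      using eventually_ge_at_top[of 1] by eventually_elim (auto simp: mult_le_cancel_right1 not_less)
  qed
  define Q where "Q n = 2 * ((\<integral>\<omega>. indicator (A n) \<omega> * (\<Sum>j=1..n. h (X j \<omega>))\<^sup>2 \<partial>M) / real n) + 2 * m\<^sup>2 * (real n * prob (A n))" for n
  have "Q \<longlonglongrightarrow> 2 * 0 + 2 * m\<^sup>2 * 0"
    unfolding Q_def by (intro tendsto_intros normalized_sum_uniformly_integrable[OF _ h2 h_mean A pA] A0) simp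
  hence "Q \<longlonglongrightarrow> 0" by simp
  thus "(\<lambda>n. real n * (\<integral>\<omega>. indicator (A n) \<omega> * ((\<Sum>j=1..n. k (X j \<omega>)) / real n)\<^sup>2 \<partial>M)) \<longlonglongrightarrow> 0"
  proof (rule Lim_null_comparison[rotated])
    show "\<forall>\<^sub>F n in sequentially. norm (real n * (\<integral>\<omega>. indicator (A n) \<omega> * ((\<Sum>j=1..n. k (X j \<omega>)) / real n)\<^sup>2 \<partial>M)) \<le> Q n"
      using eventually_gt_at_top[of 0]
    proof eventually_elim
      case (elim n)
      define p where "p = (\<lambda>\<omega>. (2 / (real n)\<^sup>2) * (indicator (A n) \<omega> * (\<Sum>j=1..n. h (X j \<omega>))\<^sup>2) + 2 * m\<^sup>2 * indicator (A n) \<omega>)"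
      have iA: "integrable M (\<lambda>\<omega>. indicator (A n) \<omega> * (Y \<omega> :: real))" if "integrable M Y" for Y
        using integrable_mult_indicator[OF A that] by simp
      have ip: "integrable M p" unfolding p_def using iA[OF Sh2] by (auto simp: emeasure_eq_measure)
      have "(\<integral>\<omega>. indicator (A n) \<omega> * ((\<Sum>j=1..n. k (X j \<omega>)) / real n)\<^sup>2 \<partial>M) \<le> (\<integral>\<omega>. p \<omega> \<partial>M)"
      proof (rule integral_mono[OF iA[OF int[OF elim]] ip])
        show "indicator (A n) \<omega> * ((\<Sum>j=1..n. k (X j \<omega>)) / real n)\<^sup>2 \<le> p \<omega>" for \<omega>
          using le[OF elim, of \<omega>] by (cases "\<omega> \<in> A n") (simp_all add: p_def)
      qed
      also have "\<dots> = (2 / (real n)\<^sup>2) * (\<integral>\<omega>. indicator (A n) \<omega> * (\<Sum>j=1..n. h (X j \<omega>))\<^sup>2 \<partial>M) + 2 * m\<^sup>2 * prob (A n)"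
        unfolding p_def using iA[OF Sh2] by (simp add: emeasure_eq_measure)
      finally have "real n * (\<integral>\<omega>. indicator (A n) \<omega> * ((\<Sum>j=1..n. k (X j \<omega>)) / real n)\<^sup>2 \<partial>M)
          \<le> real n * ((2 / (real n)\<^sup>2) * (\<integral>\<omega>. indicator (A n) \<omega> * (\<Sum>j=1..n. h (X j \<omega>))\<^sup>2 \<partial>M) + 2 * m\<^sup>2 * prob (A n))"
        by (intro mult_left_mono) auto
      also have "\<dots> = Q n" using elim by (simp add: Q_def power2_eq_square field_simps)
      finally have "real n * (\<integral>\<omega>. indicator (A n) \<omega> * ((\<Sum>j=1..n. k (X j \<omega>)) / real n)\<^sup>2 \<partial>M) \<le> Q n" .
      moreover have "0 \<le> (\<integral>\<omega>. indicator (A n) \<omega> * ((\<Sum>j=1..n. k (X j \<omega>)) / real n)\<^sup>2 \<partial>M)"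
        by (intro integral_nonneg_AE) auto
      ultimately show ?case by simp
    qed
  qed
qed

section \<open>Complex averages: deviations, variance and Chebyshev bounds\<close>

section \<open>Deviations of complex averages\<close>

lemma directional_deviation_superpolynomial:
  fixes h :: "real \<Rightarrow> complex"
  assumes h [measurable]: "h \<in> borel_measurable borel"
    and int: "integrable M (\<lambda>\<omega>. h (X 1 \<omega>))"
    and pos: "\<And>k::nat. integrable M (\<lambda>\<omega>. (max 0 (Re (\<kappa> * h (X 1 \<omega>)))) ^ k)"
    and d: "d > 0"
  shows "(\<lambda>n. real n ^ m * prob {\<omega>\<in>space M. Re (\<kappa> * ((\<Sum>j=1..n. h (X j \<omega>)) / of_nat n)) \<ge> Re (\<kappa> * (\<integral>\<omega>. h (X 1 \<omega>) \<partial>M)) + d}) \<longlonglongrightarrow> 0"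
proof -
  have [measurable]: "(\<lambda>x. Re (\<kappa> * h x)) \<in> borel_measurable borel" by measurable
  have mean: "(\<integral>\<omega>. Re (\<kappa> * h (X 1 \<omega>)) \<partial>M) = Re (\<kappa> * (\<integral>\<omega>. h (X 1 \<omega>) \<partial>M))"
    using int by simp
  have "(\<lambda>n. real n ^ m * prob {\<omega>\<in>space M. (\<Sum>j=1..n. Re (\<kappa> * h (X j \<omega>))) \<ge> real n * ((\<integral>\<omega>. Re (\<kappa> * h (X 1 \<omega>)) \<partial>M) + d)}) \<longlonglongrightarrow> 0"
    by (rule upper_deviation_superpolynomial[where h = "\<lambda>x. Re (\<kappa> * h x)"]) (use int pos d in auto)
  moreover have "\<forall>\<^sub>F n in sequentially.
      real n ^ m * prob {\<omega>\<in>space M. (\<Sum>j=1..n. Re (\<kappa> * h (X j \<omega>))) \<ge> real n * ((\<integral>\<omega>. Re (\<kappa> * h (X 1 \<omega>)) \<partial>M) + d)} =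
      real n ^ m * prob {\<omega>\<in>space M. Re (\<kappa> * ((\<Sum>j=1..n. h (X j \<omega>)) / of_nat n)) \<ge> Re (\<kappa> * (\<integral>\<omega>. h (X 1 \<omega>) \<partial>M)) + d}"
    using eventually_gt_at_top[of 0]
  proof eventually_elim
    case (elim n)
    have "Re (\<kappa> * ((\<Sum>j=1..n. h (X j \<omega>)) / of_nat n)) = (\<Sum>j=1..n. Re (\<kappa> * h (X j \<omega>))) / real n" for \<omega>
    proof -
      have "\<kappa> * ((\<Sum>j=1..n. h (X j \<omega>)) / of_nat n) = (\<Sum>j=1..n. \<kappa> * h (X j \<omega>)) / complex_of_real (real n)"
        by (simp add: sum_distrib_left)
      thus ?thesis by (simp only: Re_divide_of_real Re_sum)
    qed
    hence "(Re (\<kappa> * ((\<Sum>j=1..n. h (X j \<omega>)) / of_nat n)) \<ge> Re (\<kappa> * (\<integral>\<omega>. h (X 1 \<omega>) \<partial>M)) + d) \<longleftrightarrow>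
        (\<Sum>j=1..n. Re (\<kappa> * h (X j \<omega>))) \<ge> real n * ((\<integral>\<omega>. Re (\<kappa> * h (X 1 \<omega>)) \<partial>M) + d)" for \<omega>
      unfolding mean using elim by (simp only: pos_le_divide_eq of_nat_0_less_iff mult.commute)
    thus ?case by (simp only:)
  qed
  ultimately show ?thesis by (rule Lim_transform_eventually)
qed

text \<open>A deviation of modulus \<delta> forces a real deviation of at least \<delta> / 2 in one
  of the directions 1, -1, \<i>, -\<i>, and each of these is superpolynomially rare.\<close>

lemma norm_deviation_superpolynomial:
  fixes h :: "real \<Rightarrow> complex"
  assumes h [measurable]: "h \<in> borel_measurable borel"
    and mom: "\<And>k::nat. integrable M (\<lambda>\<omega>. norm (h (X 1 \<omega>)) ^ k)" and \<delta>: "\<delta> > 0"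
  shows "(\<lambda>n. real n ^ m * prob {\<omega>\<in>space M. norm ((\<Sum>j=1..n. h (X j \<omega>)) / of_nat n - (\<integral>\<omega>. h (X 1 \<omega>) \<partial>M)) \<ge> \<delta>}) \<longlonglongrightarrow> 0"
proof -
  define S where "S n \<omega> = (\<Sum>j=1..n. h (X j \<omega>)) / of_nat n" for n \<omega>
  define \<mu> where "\<mu> = (\<integral>\<omega>. h (X 1 \<omega>) \<partial>M)"
  have [measurable]: "S n \<in> borel_measurable M" for n unfolding S_def by measurable
  have int: "integrable M (\<lambda>\<omega>. h (X 1 \<omega>))" using mom[of 1] by (simp add: integrable_norm_iff)
  define E where "E \<kappa> n = {\<omega>\<in>space M. Re (\<kappa> * S n \<omega>) \<ge> Re (\<kappa> * \<mu>) + \<delta> / 2}" for \<kappa> n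
  have [measurable]: "E \<kappa> n \<in> events" for \<kappa> n unfolding E_def by measurable
  have lim: "(\<lambda>n. real n ^ m * prob (E \<kappa> n)) \<longlonglongrightarrow> 0" if "norm \<kappa> = 1" for \<kappa>
    unfolding E_def S_def \<mu>_def
  proof (rule directional_deviation_superpolynomial[OF h int])
    fix k :: nat
    show "integrable M (\<lambda>\<omega>. (max 0 (Re (\<kappa> * h (X 1 \<omega>)))) ^ k)"
    proof (rule Bochner_Integration.integrable_bound[OF mom[of k]])
      show "AE \<omega> in M. norm ((max 0 (Re (\<kappa> * h (X 1 \<omega>)))) ^ k) \<le> norm (norm (h (X 1 \<omega>)) ^ k)"
      proof (rule AE_I2)
        fix \<omega>
        have "Re (\<kappa> * h (X 1 \<omega>)) \<le> norm (h (X 1 \<omega>))"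
          using complex_Re_le_cmod[of "\<kappa> * h (X 1 \<omega>)"] that by (simp add: norm_mult)
        hence "(max 0 (Re (\<kappa> * h (X 1 \<omega>)))) ^ k \<le> norm (h (X 1 \<omega>)) ^ k" by (intro power_mono) auto
        thus "norm ((max 0 (Re (\<kappa> * h (X 1 \<omega>)))) ^ k) \<le> norm (norm (h (X 1 \<omega>)) ^ k)" by simp
      qed
    qed measurable
  qed (use \<delta> in simp)
  have "(\<lambda>n. real n ^ m * prob (E 1 n) + real n ^ m * prob (E (- 1) n) + real n ^ m * prob (E (- \<i>) n) + real n ^ m * prob (E \<i> n)) \<longlonglongrightarrow> 0 + 0 + 0 + 0"
    by (intro tendsto_add lim) auto
  hence "(\<lambda>n. real n ^ m * (prob (E 1 n) + prob (E (- 1) n) + prob (E (- \<i>) n) + prob (E \<i> n))) \<longlonglongrightarrow> 0"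
    by (simp add: distrib_left)
  thus ?thesis
    unfolding S_def[symmetric] \<mu>_def[symmetric]
  proof (rule Lim_null_comparison[rotated], intro always_eventually allI)
    fix n
    have "prob {\<omega>\<in>space M. norm (S n \<omega> - \<mu>) \<ge> \<delta>} \<le> prob (E 1 n \<union> E (- 1) n \<union> E (- \<i>) n \<union> E \<i> n)"
    proof (rule finite_measure_mono)
      show "{\<omega>\<in>space M. norm (S n \<omega> - \<mu>) \<ge> \<delta>} \<subseteq> E 1 n \<union> E (- 1) n \<union> E (- \<i>) n \<union> E \<i> n"
      proof
        fix \<omega> assume \<omega>: "\<omega> \<in> {\<omega>\<in>space M. norm (S n \<omega> - \<mu>) \<ge> \<delta>}"
        hence "\<bar>Re (S n \<omega>) - Re \<mu>\<bar> \<ge> \<delta> / 2 \<or> \<bar>Im (S n \<omega>) - Im \<mu>\<bar> \<ge> \<delta> / 2"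
          using cmod_le[of "S n \<omega> - \<mu>"] by auto
        then consider "Re (S n \<omega>) - Re \<mu> \<ge> \<delta> / 2" | "Re \<mu> - Re (S n \<omega>) \<ge> \<delta> / 2"
          | "Im (S n \<omega>) - Im \<mu> \<ge> \<delta> / 2" | "Im \<mu> - Im (S n \<omega>) \<ge> \<delta> / 2" by linarith
        thus "\<omega> \<in> E 1 n \<union> E (- 1) n \<union> E (- \<i>) n \<union> E \<i> n" using \<omega> by cases (auto simp: E_def)
      qed
    qed measurable
    also have "\<dots> \<le> prob (E 1 n) + prob (E (- 1) n) + prob (E (- \<i>) n) + prob (E \<i> n)"
      by (intro order_trans[OF measure_Un_le] add_mono order_refl) measurable
    finally show "norm (real n ^ m * prob {\<omega>\<in>space M. norm (S n \<omega> - \<mu>) \<ge> \<delta>})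
        \<le> real n ^ m * (prob (E 1 n) + prob (E (- 1) n) + prob (E (- \<i>) n) + prob (E \<i> n))"
      by (simp add: mult_left_mono)
  qed
qed

context
  fixes h :: "real \<Rightarrow> complex" and \<mu> :: complex and S :: "nat \<Rightarrow> 'a \<Rightarrow> complex"
  assumes h [measurable]: "h \<in> borel_measurable borel"
    and sq: "integrable M (\<lambda>\<omega>. (norm (h (X 1 \<omega>)))\<^sup>2)"
  defines "\<mu> \<equiv> (\<integral>\<omega>. h (X 1 \<omega>) \<partial>M)"
    and "S \<equiv> (\<lambda>n \<omega>. (\<Sum>j=1..n. h (X j \<omega>)) / of_nat n)"
begin

lemma measurable_mean [measurable]: "S n \<in> borel_measurable M"
  unfolding S_def by measurable

lemma integrable_h_X1: "integrable M (\<lambda>\<omega>. h (X 1 \<omega>))"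
proof -
  have "integrable M (\<lambda>\<omega>. norm (h (X 1 \<omega>)))" by (rule square_integrable_imp_integrable[OF _ sq]) simp
  thus ?thesis by (simp add: integrable_norm_iff)
qed

text \<open>Real and imaginary part are treated alike as real-linear functionals of the deviation,
  which reduces complex averages to centred real sums.\<close>

lemma centred_component:
  assumes l: "bounded_linear l"
  defines "k \<equiv> (\<lambda>x. l (h x - \<mu>) :: real)"
  shows "k \<in> borel_measurable borel" "integrable M (\<lambda>\<omega>. (k (X 1 \<omega>))\<^sup>2)" "(\<integral>\<omega>. k (X 1 \<omega>) \<partial>M) = 0"
    and "n > 0 \<Longrightarrow> l (S n \<omega> - \<mu>) = (\<Sum>j=1..n. k (X j \<omega>)) / real n"
proof -
  interpret l: bounded_linear l by (rule l)
  have [measurable]: "l \<in> borel_measurable borel"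
    by (intro borel_measurable_continuous_onI l.continuous_on continuous_on_id)
  show meas: "k \<in> borel_measurable borel" unfolding k_def by measurable
  obtain B where B: "\<And>x. \<bar>l x\<bar> \<le> norm x * B" using l.bounded by auto
  show "integrable M (\<lambda>\<omega>. (k (X 1 \<omega>))\<^sup>2)"
  proof (rule Bochner_Integration.integrable_bound)
    show "integrable M (\<lambda>\<omega>. B\<^sup>2 * (2 * (norm (h (X 1 \<omega>)))\<^sup>2 + 2 * (norm \<mu>)\<^sup>2))" using sq by simp
    show "AE \<omega> in M. norm ((k (X 1 \<omega>))\<^sup>2) \<le> norm (B\<^sup>2 * (2 * (norm (h (X 1 \<omega>)))\<^sup>2 + 2 * (norm \<mu>)\<^sup>2))"
    proof (rule AE_I2)
      fix \<omega>
      have "(k (X 1 \<omega>))\<^sup>2 = \<bar>k (X 1 \<omega>)\<bar>\<^sup>2" by simp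
      also have "\<dots> \<le> (norm (h (X 1 \<omega>) - \<mu>) * B)\<^sup>2" unfolding k_def by (intro power_mono B) auto
      also have "\<dots> = B\<^sup>2 * (norm (h (X 1 \<omega>) - \<mu>))\<^sup>2" by (simp add: power_mult_distrib)
      also have "\<dots> \<le> B\<^sup>2 * (norm (h (X 1 \<omega>)) + norm \<mu>)\<^sup>2"
        by (intro mult_left_mono power_mono norm_triangle_ineq4) auto
      also have "\<dots> \<le> B\<^sup>2 * (2 * (norm (h (X 1 \<omega>)))\<^sup>2 + 2 * (norm \<mu>)\<^sup>2)"
      proof (intro mult_left_mono)
        show "(norm (h (X 1 \<omega>)) + norm \<mu>)\<^sup>2 \<le> 2 * (norm (h (X 1 \<omega>)))\<^sup>2 + 2 * (norm \<mu>)\<^sup>2"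
          using zero_le_power2[of "norm (h (X 1 \<omega>)) - norm \<mu>"] by (simp add: power2_eq_square algebra_simps)
      qed simp
      finally show "norm ((k (X 1 \<omega>))\<^sup>2) \<le> norm (B\<^sup>2 * (2 * (norm (h (X 1 \<omega>)))\<^sup>2 + 2 * (norm \<mu>)\<^sup>2))" by simp
    qed
  qed (use meas in measurable)
  have "(\<integral>\<omega>. l (h (X 1 \<omega>) - \<mu>) \<partial>M) = l (\<integral>\<omega>. h (X 1 \<omega>) - \<mu> \<partial>M)"
    by (intro integral_bounded_linear l) (use integrable_h_X1 in simp)
  also have "(\<integral>\<omega>. h (X 1 \<omega>) - \<mu> \<partial>M) = 0" using integrable_h_X1 by (simp add: \<mu>_def prob_space)
  finally show "(\<integral>\<omega>. k (X 1 \<omega>) \<partial>M) = 0" by (simp add: k_def l.zero)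
  show "l (S n \<omega> - \<mu>) = (\<Sum>j=1..n. k (X j \<omega>)) / real n" if "n > 0"
  proof -
    have "S n \<omega> - \<mu> = (\<Sum>j=1..n. h (X j \<omega>) - \<mu>) /\<^sub>R real n"
      using that by (simp add: S_def sum_subtractf scaleR_conv_of_real field_simps)
    thus ?thesis by (simp add: l.scaleR l.sum k_def field_simps)
  qed
qed

lemmas centred_Re = centred_component[OF bounded_linear_Re]
  and centred_Im = centred_component[OF bounded_linear_Im]

lemma integrable_mean_deviation:
  assumes n: "n > 0"
  shows "integrable M (\<lambda>\<omega>. (norm (S n \<omega> - \<mu>))\<^sup>2)"
    and "real n * (\<integral>\<omega>. (norm (S n \<omega> - \<mu>))\<^sup>2 \<partial>M) = (\<integral>\<omega>. (norm (h (X 1 \<omega>) - \<mu>))\<^sup>2 \<partial>M)"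
    and "integrable M (S n)" and "(\<integral>\<omega>. S n \<omega> \<partial>M) = \<mu>"
proof -
  have eq: "(norm (S n \<omega> - \<mu>))\<^sup>2 = ((\<Sum>j=1..n. Re (h (X j \<omega>) - \<mu>))\<^sup>2 + (\<Sum>j=1..n. Im (h (X j \<omega>) - \<mu>))\<^sup>2) / (real n)\<^sup>2" for \<omega>
    unfolding cmod_power2 centred_Re(4)[OF n] centred_Im(4)[OF n] by (simp add: power_divide add_divide_distrib)
  note R = second_moment_sum[OF centred_Re(1,2,3)] and I = second_moment_sum[OF centred_Im(1,2,3)]
  show int: "integrable M (\<lambda>\<omega>. (norm (S n \<omega> - \<mu>))\<^sup>2)"
    unfolding eq using R(1)[of n] I(1)[of n] by simp
  have "real n * (\<integral>\<omega>. (norm (S n \<omega> - \<mu>))\<^sup>2 \<partial>M) = (\<integral>\<omega>. (Re (h (X 1 \<omega>) - \<mu>))\<^sup>2 \<partial>M) + (\<integral>\<omega>. (Im (h (X 1 \<omega>) - \<mu>))\<^sup>2 \<partial>M)"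
  proof -
    have X: "(\<integral>\<omega>. (norm (S n \<omega> - \<mu>))\<^sup>2 \<partial>M) =
        (real n * (\<integral>\<omega>. (Re (h (X 1 \<omega>) - \<mu>))\<^sup>2 \<partial>M) + real n * (\<integral>\<omega>. (Im (h (X 1 \<omega>) - \<mu>))\<^sup>2 \<partial>M)) / (real n)\<^sup>2"
      unfolding eq R(2)[symmetric] I(2)[symmetric] using R(1)[of n] I(1)[of n] by simp
    have conv: "r * x = a + b" if "x = (r * a + r * b) / r\<^sup>2" "r \<noteq> 0" for x a b r :: real
      using that by (simp add: power2_eq_square flip: distrib_left)
    show ?thesis by (rule conv[OF X]) (use n in simp)
  qed
  also have "\<dots> = (\<integral>\<omega>. (norm (h (X 1 \<omega>) - \<mu>))\<^sup>2 \<partial>M)"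
    unfolding cmod_power2 by (rule Bochner_Integration.integral_add[OF centred_Re(2) centred_Im(2), symmetric])
  finally show "real n * (\<integral>\<omega>. (norm (S n \<omega> - \<mu>))\<^sup>2 \<partial>M) = (\<integral>\<omega>. (norm (h (X 1 \<omega>) - \<mu>))\<^sup>2 \<partial>M)" .
  have ij: "integrable M (\<lambda>\<omega>. h (X j \<omega>))" if "j \<in> {1..n}" for j
    using integrable_X_iff[OF h, of j] that integrable_h_X1 by simp
  have "integrable M (\<lambda>\<omega>. \<Sum>j=1..n. h (X j \<omega>))" by (rule Bochner_Integration.integrable_sum[OF ij])
  thus "integrable M (S n)" unfolding S_def by simp
  have "(\<integral>\<omega>. S n \<omega> \<partial>M) = (\<Sum>j=1..n. \<integral>\<omega>. h (X j \<omega>) \<partial>M) / of_nat n"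
    unfolding S_def using ij by simp
  also have "(\<Sum>j=1..n. \<integral>\<omega>. h (X j \<omega>) \<partial>M) = (\<Sum>j=1..n. \<mu>)"
    unfolding \<mu>_def by (intro sum.cong[OF refl] integral_X[OF h]) auto
  also have "\<dots> / of_nat n = \<mu>" using n by simp
  finally show "(\<integral>\<omega>. S n \<omega> \<partial>M) = \<mu>" .
qed

lemma mean_deviation_uniformly_integrable:
  assumes A [measurable]: "\<And>n. A n \<in> events" and A0: "(\<lambda>n. prob (A n)) \<longlonglongrightarrow> 0"
  shows "(\<lambda>n. real n * (\<integral>\<omega>. indicator (A n) \<omega> * (norm (S n \<omega> - \<mu>))\<^sup>2 \<partial>M)) \<longlonglongrightarrow> 0"
proof -
  define I1 where "I1 n = (\<integral>\<omega>. indicator (A n) \<omega> * (\<Sum>j=1..n. Re (h (X j \<omega>) - \<mu>))\<^sup>2 \<partial>M)" for n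
  define I2 where "I2 n = (\<integral>\<omega>. indicator (A n) \<omega> * (\<Sum>j=1..n. Im (h (X j \<omega>) - \<mu>))\<^sup>2 \<partial>M)" for n
  have "(\<lambda>n. I1 n / real n + I2 n / real n) \<longlonglongrightarrow> 0 + 0"
    unfolding I1_def I2_def
    by (intro tendsto_add normalized_sum_uniformly_integrable[OF centred_Re(1,2,3) A A0]
        normalized_sum_uniformly_integrable[OF centred_Im(1,2,3) A A0])
  moreover have "\<forall>\<^sub>F n in sequentially. I1 n / real n + I2 n / real n = real n * (\<integral>\<omega>. indicator (A n) \<omega> * (norm (S n \<omega> - \<mu>))\<^sup>2 \<partial>M)"
    using eventually_gt_at_top[of 0]
  proof eventually_elim
    case (elim n)
    have iA: "integrable M (\<lambda>\<omega>. indicator (A n) \<omega> * (Y \<omega> :: real))" if "integrable M Y" for Y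
      using integrable_mult_indicator[OF A that] by simp
    have "indicator (A n) \<omega> * (norm (S n \<omega> - \<mu>))\<^sup>2 = (indicator (A n) \<omega> * (\<Sum>j=1..n. Re (h (X j \<omega>) - \<mu>))\<^sup>2) / (real n)\<^sup>2
        + (indicator (A n) \<omega> * (\<Sum>j=1..n. Im (h (X j \<omega>) - \<mu>))\<^sup>2) / (real n)\<^sup>2" for \<omega>
      unfolding cmod_power2 centred_Re(4)[OF elim] centred_Im(4)[OF elim] by (simp add: power_divide distrib_left)
    hence "(\<integral>\<omega>. indicator (A n) \<omega> * (norm (S n \<omega> - \<mu>))\<^sup>2 \<partial>M) = I1 n / (real n)\<^sup>2 + I2 n / (real n)\<^sup>2"
      unfolding I1_def I2_def
      using iA[OF second_moment_sum(1)[OF centred_Re(1,2,3)]] iA[OF second_moment_sum(1)[OF centred_Im(1,2,3)]] by simp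
    thus ?case using elim by (simp add: power2_eq_square field_simps)
  qed
  ultimately show ?thesis by (simp add: Lim_transform_eventually)
qed

text \<open>Chebyshev's inequality is used twice: plainly it gives a probability of order 1/n, and
  once the probability tends to 0, uniform integrability on the deviation event itself improves this
  to o(1/n).\<close>

lemma prob_mean_deviation:
  assumes \<delta>: "\<delta> > 0"
  shows "(\<lambda>n. prob {\<omega>\<in>space M. \<delta> \<le> norm (S n \<omega> - \<mu>)}) \<longlonglongrightarrow> 0"
    and "(\<lambda>n. real n * prob {\<omega>\<in>space M. \<delta> \<le> norm (S n \<omega> - \<mu>)}) \<longlonglongrightarrow> 0"
proof -
  define A where "A n = {\<omega>\<in>space M. \<delta> \<le> norm (S n \<omega> - \<mu>)}" for n
  have A [measurable]: "A n \<in> events" for n unfolding A_def by measurable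
  define V where "V = (\<integral>\<omega>. (norm (h (X 1 \<omega>) - \<mu>))\<^sup>2 \<partial>M)"
  have cheb: "\<delta>\<^sup>2 * prob (A n) \<le> (\<integral>\<omega>. indicator (A n) \<omega> * (norm (S n \<omega> - \<mu>))\<^sup>2 \<partial>M)" if n: "n > 0" for n
  proof -
    have "(\<integral>\<omega>. \<delta>\<^sup>2 * indicator (A n) \<omega> \<partial>M) \<le> (\<integral>\<omega>. indicator (A n) \<omega> * (norm (S n \<omega> - \<mu>))\<^sup>2 \<partial>M)"
    proof (rule integral_mono)
      show "integrable M (\<lambda>\<omega>. indicator (A n) \<omega> * (norm (S n \<omega> - \<mu>))\<^sup>2)"
        using integrable_mult_indicator[OF A integrable_mean_deviation(1)[OF n]] by simp
      show "\<delta>\<^sup>2 * indicator (A n) \<omega> \<le> indicator (A n) \<omega> * (norm (S n \<omega> - \<mu>))\<^sup>2" for \<omega>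
      proof (cases "\<omega> \<in> A n")
        case True
        hence "\<delta>\<^sup>2 \<le> (norm (S n \<omega> - \<mu>))\<^sup>2" using \<delta> by (intro power_mono) (auto simp: A_def)
        thus ?thesis using True by simp
      qed simp
    qed (auto simp: emeasure_eq_measure)
    thus ?thesis by (simp add: emeasure_eq_measure)
  qed
  have "(\<lambda>n. prob (A n)) \<longlonglongrightarrow> 0"
  proof (rule Lim_null_comparison)
    show "(\<lambda>n. V / \<delta>\<^sup>2 * inverse (real n)) \<longlonglongrightarrow> 0" by (intro tendsto_mult_right_zero lim_inverse_n)
    show "\<forall>\<^sub>F n in sequentially. norm (prob (A n)) \<le> V / \<delta>\<^sup>2 * inverse (real n)"
      using eventually_gt_at_top[of 0]
    proof eventually_elim
      case (elim n)
      have "(\<integral>\<omega>. indicator (A n) \<omega> * (norm (S n \<omega> - \<mu>))\<^sup>2 \<partial>M) \<le> (\<integral>\<omega>. (norm (S n \<omega> - \<mu>))\<^sup>2 \<partial>M)"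
        using integrable_mult_indicator[OF A integrable_mean_deviation(1)[OF elim]]
        by (intro integral_mono integrable_mean_deviation(1)[OF elim]) (auto simp: indicator_def)
      hence "\<delta>\<^sup>2 * prob (A n) \<le> (\<integral>\<omega>. (norm (S n \<omega> - \<mu>))\<^sup>2 \<partial>M)" using cheb[OF elim] by linarith
      hence "real n * (\<delta>\<^sup>2 * prob (A n)) \<le> V" unfolding V_def integrable_mean_deviation(2)[OF elim, symmetric]
        by (intro mult_left_mono) auto
      thus ?case using \<delta> elim by (simp add: field_simps)
    qed
  qed
  thus "(\<lambda>n. prob {\<omega>\<in>space M. \<delta> \<le> norm (S n \<omega> - \<mu>)}) \<longlonglongrightarrow> 0" by (simp add: A_def)
  have "(\<lambda>n. inverse (\<delta>\<^sup>2) * (real n * (\<integral>\<omega>. indicator (A n) \<omega> * (norm (S n \<omega> - \<mu>))\<^sup>2 \<partial>M))) \<longlonglongrightarrow> 0"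
    using mean_deviation_uniformly_integrable[OF A \<open>(\<lambda>n. prob (A n)) \<longlonglongrightarrow> 0\<close>] by (rule tendsto_mult_right_zero)
  hence "(\<lambda>n. real n * prob (A n)) \<longlonglongrightarrow> 0"
  proof (rule Lim_null_comparison[rotated])
    show "\<forall>\<^sub>F n in sequentially. norm (real n * prob (A n)) \<le> inverse (\<delta>\<^sup>2) * (real n * (\<integral>\<omega>. indicator (A n) \<omega> * (norm (S n \<omega> - \<mu>))\<^sup>2 \<partial>M))"
      using eventually_gt_at_top[of 0]
    proof eventually_elim
      case (elim n)
      have "real n * (\<delta>\<^sup>2 * prob (A n)) \<le> real n * (\<integral>\<omega>. indicator (A n) \<omega> * (norm (S n \<omega> - \<mu>))\<^sup>2 \<partial>M)"
        by (intro mult_left_mono cheb[OF elim]) auto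
      thus ?case using \<delta> by (simp add: field_simps)
    qed
  qed
  thus "(\<lambda>n. real n * prob {\<omega>\<in>space M. \<delta> \<le> norm (S n \<omega> - \<mu>)}) \<longlonglongrightarrow> 0" by (simp add: A_def)
qed

end

end

section \<open>Averages in the convex image and their pullback under \<open>f\<close>\<close>

section \<open>Quasi-arithmetic means\<close>

lemma one_plus_powr_le:
  fixes x p :: real
  assumes "0 \<le> x" "0 \<le> p"
  shows "(1 + x) powr p \<le> 2 powr p * (1 + x powr p)"
proof -
  have "(1 + x) powr p \<le> (2 * max 1 x) powr p" using assms by (intro powr_mono2) auto
  also have "\<dots> = 2 powr p * (max 1 x) powr p" by (simp add: powr_mult)
  also have "\<dots> \<le> 2 powr p * (1 + x powr p)" by (intro mult_left_mono) (auto simp: max_def)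
  finally show ?thesis .
qed

lemma convex_on_one_plus_powr:
  fixes q :: real
  assumes "1 \<le> q" and "finite I" "I \<noteq> {}" and x: "\<And>i. i \<in> I \<Longrightarrow> 0 \<le> x i"
  shows "(1 + (\<Sum>i\<in>I. x i) / card I) powr q \<le> (\<Sum>i\<in>I. (1 + x i) powr q) / card I"
proof -
  have c: "card I > 0" using assms by (simp add: card_gt_0_iff)
  have "(\<Sum>i\<in>I. (1 / card I) *\<^sub>R (1 + x i)) powr q \<le> (\<Sum>i\<in>I. (1 / card I) * (1 + x i) powr q)"
    using assms c by (intro convex_on_sum[OF _ _ powr_convex[of q]]) (auto intro: add_pos_nonneg)
  moreover have "(\<Sum>i\<in>I. (1 / card I) *\<^sub>R (1 + x i)) = 1 + (\<Sum>i\<in>I. x i) / card I"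
    using c by (simp add: add_divide_distrib sum.distrib sum_divide_distrib)
  ultimately show ?thesis by (simp add: sum_divide_distrib)
qed

text \<open>The closure of the image of far points is compact. A point of it in \<open>C\<close> has
  a neighbourhood that the image of still farther points avoids, because \<open>g\<close> is
  continuous there; a point outside \<open>C\<close> lies in an open half-plane given by the
  separating functional. A finite subcover leaves finitely many half-planes.\<close>

lemma (in convex_half_plane_map) far_points_in_half_planes:
  assumes bdd: "\<And>z. z \<in> K \<Longrightarrow> R0 < norm z \<Longrightarrow> norm (f z) \<le> R0" and \<mu>: "\<mu> \<in> C"
  obtains R F where "finite F" "\<And>a c. (a, c) \<in> F \<Longrightarrow> (\<exists>b. \<forall>w\<in>C. b \<le> a \<bullet> w) \<and> c < a \<bullet> \<mu>"
    "\<And>z. z \<in> K \<Longrightarrow> R < norm z \<Longrightarrow> \<exists>(a, c)\<in>F. a \<bullet> f z < c"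
proof -
  define T where "T r = closure (f ` {z \<in> K. r < norm z})" for r
  define good where "good = {(a, c). (\<exists>b. \<forall>w\<in>C. b \<le> a \<bullet> w) \<and> c < a \<bullet> \<mu>}"
  \<comment> \<open>Indices of a cover with two kinds of members: \<open>Inl (a, c)\<close> stands
    for a half-plane, \<open>Inr k\<close> for the complement of the closed set belonging to the
    points beyond radius \<open>k\<close>.\<close>
  define I :: "(complex \<times> real + nat) set" where "I = Inl ` good \<union> range Inr"
  define O' where "O' i = (case i of Inl (a, c) \<Rightarrow> {w. a \<bullet> w < c} | Inr k \<Rightarrow> - T (real k))" for i
  have "bounded (f ` {z \<in> K. R0 < norm z})" using bdd by (intro boundedI) auto
  hence "compact (T R0)" by (simp add: T_def compact_closure)
  moreover have "open (O' i)" if "i \<in> I" for i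
    by (auto simp: O'_def T_def split: sum.split intro: open_halfspace_lt)
  moreover have "T R0 \<subseteq> (\<Union>i\<in>I. O' i)"
  proof
    fix q assume q: "q \<in> T R0"
    show "q \<in> (\<Union>i\<in>I. O' i)"
    proof (cases "q \<in> C")
      case True
      obtain k :: nat where k: "norm (g q) < real k" using reals_Archimedean2 by blast
      define V where "V = f ` U \<inter> g -` {z. norm z < real k}"
      have "open V" unfolding V_def
        by (intro continuous_open_preimage continuous_g open_image open_Collect_less continuous_intros)
      moreover have "q \<in> V" using True k C_subset by (auto simp: V_def)
      moreover have "V \<inter> f ` {z \<in> K. real k < norm z} = {}"
        using g_f dom_subset by (fastforce simp: V_def)
      ultimately have "q \<notin> T (real k)" unfolding T_def using open_Int_closure_eq_empty by blast
      hence "q \<in> O' (Inr k)" by (simp add: O'_def)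
      moreover have "Inr k \<in> I" by (simp add: I_def)
      ultimately show ?thesis by (rule UN_I[rotated])
    next
      case False
      have "q \<in> closure C" using q closure_mono[of "f ` {z \<in> K. R0 < norm z}" C] by (auto simp: T_def)
      then obtain a b where ab: "\<forall>w\<in>C. b \<le> a \<bullet> w" "a \<bullet> q < a \<bullet> \<mu>"
        using functional_separating_missing_point[OF _ False \<mu>] by metis
      define c where "c = (a \<bullet> q + a \<bullet> \<mu>) / 2"
      have "(a, c) \<in> good" using ab by (auto simp: good_def c_def)
      moreover have "q \<in> O' (Inl (a, c))" using ab by (simp add: O'_def c_def)
      ultimately show ?thesis unfolding I_def by (intro UN_I[of "Inl (a, c)"]) auto
    qed
  qed
  ultimately obtain I' where I': "I' \<subseteq> I" "finite I'" "T R0 \<subseteq> (\<Union>i\<in>I'. O' i)"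
    by (rule compactE_image)
  define F where "F = Inl -` I'"
  \<comment> \<open>Beyond \<open>R\<close> no value of \<open>f\<close> lies in a chosen set of the
    second kind, so one of the chosen half-planes must catch it.\<close>
  define R where "R = Max (insert R0 (real ` (Inr -` I')))"
  have fin: "finite F" "finite (Inr -` I')"
    unfolding F_def using I'(2) by (auto intro!: finite_vimageI simp: inj_on_def)
  have R: "R0 \<le> R" "\<And>k. Inr k \<in> I' \<Longrightarrow> real k \<le> R"
    unfolding R_def using fin by (auto intro!: Max_ge)
  show ?thesis
  proof (rule that[OF fin(1)])
    show "(\<exists>b. \<forall>w\<in>C. b \<le> a \<bullet> w) \<and> c < a \<bullet> \<mu>" if "(a, c) \<in> F" for a c
    proof -
      have "Inl (a, c) \<in> I" using that I'(1) by (auto simp: F_def)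
      hence "(a, c) \<in> good" by (auto simp: I_def)
      thus ?thesis by (simp add: good_def)
    qed
    fix z assume z: "z \<in> K" "R < norm z"
    have inT: "f z \<in> T r" if "r \<le> R" for r
      unfolding T_def using z that by (intro subsetD[OF closure_subset] imageI) auto
    then obtain i where i: "i \<in> I'" "f z \<in> O' i" using I'(3) R(1) by blast
    show "\<exists>(a, c)\<in>F. a \<bullet> f z < c"
    proof (cases i)
      case (Inl p)
      obtain a c where "p = (a, c)" by (cases p)
      thus ?thesis using i Inl by (intro bexI[of _ p]) (auto simp: F_def O'_def)
    next
      case (Inr k)
      thus ?thesis using i inT[OF R(2)[of k]] by (simp add: O'_def)
    qed
  qed
qed

locale quasi_arithmetic = convex_half_plane_map f U \<alpha> + iid_sequence M X
  for f :: "complex \<Rightarrow> complex" and U \<alpha> and M :: "'a measure" and X +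
  assumes no_atoms: "\<And>x. measure M {\<omega> \<in> space M. X 1 \<omega> = x} = 0"
    and square_integrable: "integrable M (\<lambda>\<omega>. (norm (f (complex_of_real (X 1 \<omega>))))\<^sup>2)"
begin

definition h :: "real \<Rightarrow> complex" where "h x = f (complex_of_real x)"
definition S :: "nat \<Rightarrow> 'a \<Rightarrow> complex" where "S n \<omega> = (\<Sum>j=1..n. h (X j \<omega>)) / of_nat n"
definition \<mu> :: complex where "\<mu> = (\<integral>\<omega>. h (X 1 \<omega>) \<partial>M)"

lemma h_in_C: "complex_of_real x \<noteq> \<alpha> \<Longrightarrow> h x \<in> C"
  unfolding h_def by (intro imageI) (auto simp: closed_upper_half_plane_def)

lemma measurable_h [measurable]: "h \<in> borel_measurable borel"
\<comment> \<open>At most one real point, \<open>\<alpha>\<close>, can lie outside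
  \<open>U\<close>.\<close>
proof (rule borel_measurable_continuous_countable_exceptions[of "{Re \<alpha>}"])
  have "complex_of_real x \<in> U" if "x \<noteq> Re \<alpha>" for x
    using that dom_subset by (auto simp: closed_upper_half_plane_def)
  thus "continuous_on (- {Re \<alpha>}) h"
    unfolding h_def by (intro continuous_on_compose2[OF continuous_f] continuous_intros) auto
qed simp

lemma measurable_g [measurable]: "g \<in> borel_measurable borel"
proof -
  \<comment> \<open>Off the image of \<open>U\<close>, \<open>inv_into\<close> chooses from the
    empty predicate, so it has one constant value there and \<open>g\<close> is piecewise
    continuous.\<close>
  have "(\<lambda>y. if y \<in> f ` U then g y else (SOME x. False)) \<in> borel_measurable borel"
    by (intro borel_measurable_continuous_on_if continuous_g borel_open open_image continuous_intros)
  also have "(\<lambda>y. if y \<in> f ` U then g y else (SOME x. False)) = g"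
  proof
    fix y
    have "g y = (SOME x. False)" if "y \<notin> f ` U"
    proof -
      have "(\<lambda>x. x \<in> U \<and> f x = y) = (\<lambda>x. False)" using that by auto
      thus ?thesis unfolding inv_into_def by simp
    qed
    thus "(if y \<in> f ` U then g y else (SOME x. False)) = g y" by simp
  qed
  finally show ?thesis .
qed

lemma measurable_S [measurable]: "S n \<in> borel_measurable M"
  unfolding S_def by measurable

lemma square_integrable_h: "integrable M (\<lambda>\<omega>. (norm (h (X 1 \<omega>)))\<^sup>2)"
  using square_integrable by (simp add: h_def)

lemmas integrable_h = integrable_h_X1[OF measurable_h square_integrable_h]

text \<open>Without an atom at \<open>Re \<alpha>\<close> the variable almost surely misses the one
  real point whose value might fall outside \<open>C\<close>.\<close>

lemma AE_h_in_C: "j \<ge> 1 \<Longrightarrow> AE \<omega> in M. h (X j \<omega>) \<in> C"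
proof -
  assume j: "j \<ge> 1"
  have "prob {\<omega>\<in>space M. X 1 \<omega> = Re \<alpha>} = 0" by (rule no_atoms)
  hence "AE \<omega> in M. X 1 \<omega> \<noteq> Re \<alpha>"
    by (subst AE_iff_measurable[OF _ refl]) (auto simp: emeasure_eq_measure)
  hence "AE \<omega> in M. X j \<omega> \<noteq> Re \<alpha>" by (intro AE_X[OF _ j]) auto
  thus ?thesis by eventually_elim (auto intro!: h_in_C)
qed

lemma AE_all_h_in_C: "AE \<omega> in M. \<forall>j\<ge>1. h (X j \<omega>) \<in> C"
  using AE_h_in_C by (simp add: AE_all_countable)

lemma S_in_C: "\<forall>j\<ge>1. h (X j \<omega>) \<in> C \<Longrightarrow> n \<ge> 1 \<Longrightarrow> S n \<omega> \<in> C"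
proof -
  assume "\<forall>j\<ge>1. h (X j \<omega>) \<in> C" and n: "n \<ge> 1"
  hence "(\<Sum>j\<in>{1..n}. (1 / real n) *\<^sub>R h (X j \<omega>)) \<in> C"
    by (intro convex_sum[OF _ convex_image]) auto
  moreover have "(\<Sum>j\<in>{1..n}. (1 / real n) *\<^sub>R h (X j \<omega>)) = S n \<omega>"
    by (simp add: S_def scaleR_conv_of_real sum_divide_distrib)
  ultimately show ?thesis by simp
qed

lemma \<mu>_in_C: "\<mu> \<in> C"
  unfolding \<mu>_def by (rule expectation_in_convex[OF integrable_h convex_image AE_h_in_C]) simp

text \<open>Both estimates isolate the first summand of N S_N. The absolute value of
  \<open>k\<close> is taken because for N = 1 the bound by \<open>k\<close> is vacuous, so
  \<open>k\<close> may be negative.\<close>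

lemma norm_first_le:
  assumes N: "N \<ge> 1" and K: "\<And>j. j \<in> {2..N} \<Longrightarrow> norm (h (X j \<omega>)) \<le> k"
  shows "norm (h (X 1 \<omega>)) \<le> real N * norm (S N \<omega>) + real N * \<bar>k\<bar>"
    and "Re (\<kappa> * h (X 1 \<omega>)) / real N \<le> Re (\<kappa> * S N \<omega>) + norm \<kappa> * \<bar>k\<bar>"
proof -
  define Y where "Y = (\<Sum>j=2..N. h (X j \<omega>))"
  have "{1..N} = insert 1 {2..N}" using N by auto
  hence eq: "of_nat N * S N \<omega> = h (X 1 \<omega>) + Y" using N by (simp add: S_def Y_def)
  have "norm Y \<le> (\<Sum>j=2..N. \<bar>k\<bar>)" unfolding Y_def by (intro order_trans[OF norm_sum] sum_mono) (use K in force)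
  also have "\<dots> \<le> real N * \<bar>k\<bar>" by (simp add: mult_right_mono)
  finally have Y: "norm Y \<le> real N * \<bar>k\<bar>" .
  have "h (X 1 \<omega>) = of_nat N * S N \<omega> - Y" using eq by simp
  thus "norm (h (X 1 \<omega>)) \<le> real N * norm (S N \<omega>) + real N * \<bar>k\<bar>"
    using norm_triangle_ineq4[of "of_nat N * S N \<omega>" Y] Y by (simp add: norm_mult)
  have "\<kappa> * h (X 1 \<omega>) = real N *\<^sub>R (\<kappa> * S N \<omega>) - \<kappa> * Y"
    using eq by (simp add: scaleR_conv_of_real algebra_simps)
  hence "Re (\<kappa> * h (X 1 \<omega>)) = real N * Re (\<kappa> * S N \<omega>) - Re (\<kappa> * Y)" by simp
  moreover have "- Re (\<kappa> * Y) \<le> norm \<kappa> * (real N * \<bar>k\<bar>)"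
  proof -
    have "- Re (\<kappa> * Y) \<le> norm \<kappa> * norm Y" using abs_Re_le_cmod[of "\<kappa> * Y"] by (simp add: norm_mult)
    also have "\<dots> \<le> norm \<kappa> * (real N * \<bar>k\<bar>)" by (intro mult_left_mono Y) simp
    finally show ?thesis .
  qed
  ultimately have "Re (\<kappa> * h (X 1 \<omega>)) \<le> real N * (Re (\<kappa> * S N \<omega>) + norm \<kappa> * \<bar>k\<bar>)" by (simp add: algebra_simps)
  thus "Re (\<kappa> * h (X 1 \<omega>)) / real N \<le> Re (\<kappa> * S N \<omega>) + norm \<kappa> * \<bar>k\<bar>" using N by (simp add: field_simps)
qed

text \<open>The transfer of moments in the form used below: domination is required only where
  \<open>S N\<close> lies in \<open>C\<close>, which is almost everywhere and is where the growth
  bounds hold.\<close>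

lemma integrable_from_mean:
  assumes [measurable]: "\<phi> \<in> borel_measurable borel" and \<phi>0: "\<And>x. 0 \<le> (\<phi> x :: real)"
    and N: "N \<ge> 1" and mom: "integrable M (\<lambda>\<omega>. norm (g (S N \<omega>)) powr p)"
    and dom: "\<And>k. \<exists>c\<ge>0. \<forall>\<omega>. S N \<omega> \<in> C \<longrightarrow> (\<forall>j\<in>{2..N}. norm (h (X j \<omega>)) \<le> k) \<longrightarrow>
        \<phi> (X 1 \<omega>) \<le> c * (1 + norm (g (S N \<omega>)) powr p)"
  shows "integrable M (\<lambda>\<omega>. \<phi> (X 1 \<omega>))"
proof (rule integrableI_bounded)
  have "(\<integral>\<^sup>+\<omega>. ennreal (\<phi> (X 1 \<omega>)) \<partial>M) < \<infinity>"
  proof (rule first_moment_finite_of_mean[where h = h and N = N and G = "\<lambda>\<omega>. ennreal (norm (g (S N \<omega>)) powr p)"])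
    show "(\<integral>\<^sup>+\<omega>. ennreal (norm (g (S N \<omega>)) powr p) \<partial>M) < \<infinity>"
      using mom by (simp add: integrable_iff_bounded)
    fix k
    obtain c where c: "c \<ge> 0" "\<And>\<omega>. S N \<omega> \<in> C \<Longrightarrow> \<forall>j\<in>{2..N}. norm (h (X j \<omega>)) \<le> k \<Longrightarrow>
        \<phi> (X 1 \<omega>) \<le> c * (1 + norm (g (S N \<omega>)) powr p)" using dom[of k] by metis
    have "AE \<omega> in M. (\<forall>j\<in>{2..N}. norm (h (X j \<omega>)) \<le> k) \<longrightarrow>
        ennreal (\<phi> (X 1 \<omega>)) \<le> ennreal c * (1 + ennreal (norm (g (S N \<omega>)) powr p))"
      using AE_all_h_in_C
    proof eventually_elim
      case (elim \<omega>)
      show ?case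
      proof
        assume "\<forall>j\<in>{2..N}. norm (h (X j \<omega>)) \<le> k"
        hence "ennreal (\<phi> (X 1 \<omega>)) \<le> ennreal (c * (1 + norm (g (S N \<omega>)) powr p))"
          using c(2)[OF S_in_C[OF elim N]] by (intro ennreal_leI) simp
        also have "\<dots> = ennreal c * (1 + ennreal (norm (g (S N \<omega>)) powr p))"
          using c(1) by (simp add: ennreal_mult ennreal_plus flip: ennreal_1)
        finally show "ennreal (\<phi> (X 1 \<omega>)) \<le> ennreal c * (1 + ennreal (norm (g (S N \<omega>)) powr p))" .
      qed
    qed
    thus "\<exists>c<\<infinity>. AE \<omega> in M. (\<forall>j\<in>{2..N}. norm (h (X j \<omega>)) \<le> k) \<longrightarrow>
        ennreal (\<phi> (X 1 \<omega>)) \<le> c * (1 + ennreal (norm (g (S N \<omega>)) powr p))"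
      by (intro exI[of _ "ennreal c"]) auto
  qed (use N in auto)
  thus "(\<integral>\<^sup>+\<omega>. ennreal (norm (\<phi> (X 1 \<omega>))) \<partial>M) < \<infinity>" using \<phi>0 by simp
qed measurable

end

section \<open>The contribution of large deviations, by type of growth\<close>

section \<open>The far contribution\<close>

lemma power_le_fact_exp:
  fixes x :: real
  assumes "0 \<le> x"
  shows "x ^ k \<le> fact k * exp x"
proof -
  have "(\<lambda>n. x ^ n /\<^sub>R fact n) sums exp x" by (rule exp_converges)
  hence "(\<Sum>n\<in>{k}. x ^ n /\<^sub>R fact n) \<le> exp x"
    using assms by (subst sums_unique[OF \<open>_ sums _\<close>]) (intro sum_le_suminf, auto simp: sums_iff)
  thus ?thesis by (simp add: field_simps)
qed

lemma (in prob_space) integrable_indicator_times: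
  fixes Y :: "'a \<Rightarrow> real"
  assumes "integrable M Y" "E \<in> events" shows "integrable M (\<lambda>\<omega>. indicator E \<omega> * Y \<omega>)"
  using integrable_mult_indicator[OF assms(2,1)] by simp

context quasi_arithmetic
begin

context
  fixes \<epsilon> B :: real
  assumes \<epsilon>: "\<epsilon> > 0"
    and bdd: "\<forall>\<^sub>F n in sequentially. integrable M (\<lambda>\<omega>. norm (g (S n \<omega>)) powr (2 + \<epsilon>)) \<and>
      (\<integral>\<omega>. norm (g (S n \<omega>)) powr (2 + \<epsilon>) \<partial>M) \<le> B"
begin

lemma powr_le_one_plus:
  fixes x :: real
  assumes "0 \<le> x" shows "x \<le> 1 + x powr (2 + \<epsilon>)" "x\<^sup>2 \<le> 1 + x powr (2 + \<epsilon>)"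
proof -
  have "x \<le> 1 + x powr (2 + \<epsilon>) \<and> x\<^sup>2 \<le> 1 + x powr (2 + \<epsilon>)"
  proof (cases "x \<le> 1")
    case True
    have "x\<^sup>2 \<le> 1" using assms True by (simp add: power_le_one)
    thus ?thesis using True powr_ge_zero[of x "2 + \<epsilon>"] by linarith
  next
    case False
    have "x powr 1 \<le> x powr (2 + \<epsilon>)" "x powr 2 \<le> x powr (2 + \<epsilon>)"
      using False \<epsilon> by (intro powr_mono; simp)+
    moreover have "x powr 1 = x" "x powr 2 = x\<^sup>2" using False by (simp_all add: powr_numeral)
    ultimately show ?thesis by linarith
  qed
  thus "x \<le> 1 + x powr (2 + \<epsilon>)" "x\<^sup>2 \<le> 1 + x powr (2 + \<epsilon>)" by auto
qed

lemma eventually_integrable_g_S: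
  "\<forall>\<^sub>F n in sequentially. integrable M (\<lambda>\<omega>. (norm (g (S n \<omega>)))\<^sup>2)"
  using bdd
proof eventually_elim
  case (elim n)
  show ?case
  proof (rule Bochner_Integration.integrable_bound)
    show "integrable M (\<lambda>\<omega>. 1 + norm (g (S n \<omega>)) powr (2 + \<epsilon>))" using elim by simp
    show "AE \<omega> in M. norm ((norm (g (S n \<omega>)))\<^sup>2) \<le> norm (1 + norm (g (S n \<omega>)) powr (2 + \<epsilon>))"
      using powr_le_one_plus(2)[OF norm_ge_zero] by (intro AE_I2) (simp add: order_trans[OF _ abs_ge_self])
  qed measurable
qed

text \<open>One index with a finite moment is all that the transfer to \<open>X 1\<close>
  uses.\<close>

lemma moment_index:
  obtains N where "N \<ge> 1" "integrable M (\<lambda>\<omega>. norm (g (S N \<omega>)) powr (2 + \<epsilon>))"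
proof -
  obtain N where "1 \<le> N \<and> integrable M (\<lambda>\<omega>. norm (g (S N \<omega>)) powr (2 + \<epsilon>))"
    using eventually_happens'[OF sequentially_bot eventually_conj[OF eventually_ge_at_top[of 1] bdd]] by blast
  thus ?thesis using that by blast
qed

context
  fixes \<delta> :: real and A :: "nat \<Rightarrow> 'a set"
  assumes \<delta>: "\<delta> > 0"
  defines "A \<equiv> (\<lambda>n. {\<omega>\<in>space M. \<delta> \<le> norm (S n \<omega> - \<mu>)})"
begin

lemma events_A [measurable]: "A n \<in> events"
  unfolding A_def by measurable

lemma n_prob_A: "(\<lambda>n. real n * prob (A n)) \<longlonglongrightarrow> 0"
  using prob_mean_deviation(2)[OF measurable_h square_integrable_h \<delta>] by (simp only: A_def S_def \<mu>_def)

lemma prob_A: "(\<lambda>n. prob (A n)) \<longlonglongrightarrow> 0"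
  using prob_mean_deviation(1)[OF measurable_h square_integrable_h \<delta>] by (simp only: A_def S_def \<mu>_def)

lemma deviation_negligible:
  "(\<lambda>n. real n * (\<integral>\<omega>. indicator (A n) \<omega> * (norm (S n \<omega> - \<mu>))\<^sup>2 \<partial>M)) \<longlonglongrightarrow> 0"
  using mean_deviation_uniformly_integrable[OF measurable_h square_integrable_h events_A prob_A]
  by (simp only: S_def \<mu>_def)

text \<open>On \<open>A n\<close> the values with |g| \<le> R contribute at most R^2 n P(A n), which
  tends to 0; larger values occur only in \<open>E n\<close>, where the truncation estimate
  applies.\<close>

lemma negligible_if_far_values_rare:
  assumes E [measurable]: "\<And>n. E n \<in> events"
    and E0: "\<And>m::nat. (\<lambda>n. real n ^ m * prob (E n)) \<longlonglongrightarrow> 0"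
    and far: "\<And>n. n \<ge> 1 \<Longrightarrow> AE \<omega> in M. \<omega> \<in> A n \<longrightarrow> R < norm (g (S n \<omega>)) \<longrightarrow> \<omega> \<in> E n"
  shows "(\<lambda>n. real n * (\<integral>\<omega>. indicator (A n) \<omega> * (norm (g (S n \<omega>)))\<^sup>2 \<partial>M)) \<longlonglongrightarrow> 0"
proof -
  define Q where "Q n = real n * (\<integral>\<omega>. indicator (E n) \<omega> * (norm (g (S n \<omega>)))\<^sup>2 \<partial>M) + R\<^sup>2 * (real n * prob (A n))" for n
  have "Q \<longlonglongrightarrow> 0 + R\<^sup>2 * 0"
    unfolding Q_def
    by (intro tendsto_intros truncated_second_moment_negligible[OF \<epsilon> _ _ bdd] E E0 n_prob_A) auto
  hence "Q \<longlonglongrightarrow> 0" by simp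
  thus ?thesis
  proof (rule Lim_null_comparison[rotated])
    show "\<forall>\<^sub>F n in sequentially. norm (real n * (\<integral>\<omega>. indicator (A n) \<omega> * (norm (g (S n \<omega>)))\<^sup>2 \<partial>M)) \<le> Q n"
      using eventually_integrable_g_S eventually_ge_at_top[of 1]
    proof eventually_elim
      case (elim n)
      note int = integrable_indicator_times[OF elim(1)]
      have "(\<integral>\<omega>. indicator (A n) \<omega> * (norm (g (S n \<omega>)))\<^sup>2 \<partial>M)
          \<le> (\<integral>\<omega>. indicator (E n) \<omega> * (norm (g (S n \<omega>)))\<^sup>2 + R\<^sup>2 * indicator (A n) \<omega> \<partial>M)"
      proof (rule integral_mono_AE)
        show "AE \<omega> in M. indicator (A n) \<omega> * (norm (g (S n \<omega>)))\<^sup>2 \<le> indicator (E n) \<omega> * (norm (g (S n \<omega>)))\<^sup>2 + R\<^sup>2 * indicator (A n) \<omega>"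
          using far[OF elim(2)]
        proof eventually_elim
          case *: (elim \<omega>)
          show ?case
          proof (cases "\<omega> \<in> A n \<and> norm (g (S n \<omega>)) \<le> R")
            case True
            hence "(norm (g (S n \<omega>)))\<^sup>2 \<le> R\<^sup>2" by (intro power_mono) auto
            thus ?thesis using True by (simp add: add_increasing)
          next
            case False
            thus ?thesis using * by (cases "\<omega> \<in> A n") (auto simp: not_le)
          qed
        qed
      qed (use int[of "A n"] int[of "E n"] in \<open>auto simp: emeasure_eq_measure\<close>)
      also have "\<dots> = (\<integral>\<omega>. indicator (E n) \<omega> * (norm (g (S n \<omega>)))\<^sup>2 \<partial>M) + R\<^sup>2 * prob (A n)"
        using int[of "E n"] by (simp add: emeasure_eq_measure)
      finally have "real n * (\<integral>\<omega>. indicator (A n) \<omega> * (norm (g (S n \<omega>)))\<^sup>2 \<partial>M) \<le> Q n"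
        unfolding Q_def by (simp add: mult_left_mono flip: distrib_left mult.left_commute[of "real n"])
      moreover have "0 \<le> (\<integral>\<omega>. indicator (A n) \<omega> * (norm (g (S n \<omega>)))\<^sup>2 \<partial>M)" by (intro integral_nonneg_AE) auto
      ultimately show ?case by simp
    qed
  qed
qed

lemma negligible_if_bounded_near_infinity:
  assumes "\<And>z. z \<in> K \<Longrightarrow> R0 < norm z \<Longrightarrow> norm (f z) \<le> R0"
  shows "(\<lambda>n. real n * (\<integral>\<omega>. indicator (A n) \<omega> * (norm (g (S n \<omega>)))\<^sup>2 \<partial>M)) \<longlonglongrightarrow> 0"
proof -
  obtain R F where F: "finite F" "\<And>a c. (a, c) \<in> F \<Longrightarrow> (\<exists>b. \<forall>w\<in>C. b \<le> a \<bullet> w) \<and> c < a \<bullet> \<mu>"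
    and R: "\<And>z. z \<in> K \<Longrightarrow> R < norm z \<Longrightarrow> \<exists>(a, c)\<in>F. a \<bullet> f z < c"
    using far_points_in_half_planes[OF assms \<mu>_in_C] by metis
  define G where "G p n = {\<omega>\<in>space M. fst p \<bullet> S n \<omega> < snd p}" for p n
  have [measurable]: "G p n \<in> events" for p n unfolding G_def by measurable
  have G0: "(\<lambda>n. real n ^ m * prob (G p n)) \<longlonglongrightarrow> 0" if p: "p \<in> F" for p m
  proof -
    obtain a c where p_eq: "p = (a, c)" by (cases p)
    obtain b where b: "\<And>w. w \<in> C \<Longrightarrow> b \<le> a \<bullet> w" and c: "c < a \<bullet> \<mu>" using F(2)[of a c] p p_eq by auto
    \<comment> \<open>A low value of the functional is an upper deviation in direction
      \<open>- cnj a\<close>; its lower bound \<open>b\<close> on \<open>C\<close> bounds the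
      positive part there, which therefore has all moments.\<close>
    have inner: "Re (- cnj a * w) = - (a \<bullet> w)" for w by (simp add: inner_complex_def)
    have "(\<lambda>n. real n ^ m * prob {\<omega>\<in>space M. Re (- cnj a * S n \<omega>) \<ge> Re (- cnj a * \<mu>) + (a \<bullet> \<mu> - c)}) \<longlonglongrightarrow> 0"
      unfolding S_def \<mu>_def
    proof (rule directional_deviation_superpolynomial[OF measurable_h integrable_h])
      fix k :: nat
      show "integrable M (\<lambda>\<omega>. (max 0 (Re (- cnj a * h (X 1 \<omega>)))) ^ k)"
      proof (rule integrable_const_bound)
        show "AE \<omega> in M. norm ((max 0 (Re (- cnj a * h (X 1 \<omega>)))) ^ k) \<le> \<bar>b\<bar> ^ k"
          using AE_h_in_C[OF order_refl]
        proof eventually_elim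
          case (elim \<omega>)
          have "max 0 (Re (- cnj a * h (X 1 \<omega>))) \<le> \<bar>b\<bar>" unfolding inner using b[OF elim] by linarith
          thus ?case by (simp add: power_mono)
        qed
      qed measurable
    qed (use c in \<open>simp add: \<mu>_def\<close>)
    thus ?thesis
    proof (rule Lim_null_comparison[rotated], intro always_eventually allI)
      fix n
      have "prob (G p n) \<le> prob {\<omega>\<in>space M. Re (- cnj a * S n \<omega>) \<ge> Re (- cnj a * \<mu>) + (a \<bullet> \<mu> - c)}"
        unfolding inner by (intro finite_measure_mono) (auto simp: G_def p_eq)
      thus "norm (real n ^ m * prob (G p n)) \<le> real n ^ m * prob {\<omega>\<in>space M. Re (- cnj a * S n \<omega>) \<ge> Re (- cnj a * \<mu>) + (a \<bullet> \<mu> - c)}"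
        by (simp add: mult_left_mono)
    qed
  qed
  show ?thesis
  proof (rule negligible_if_far_values_rare[where E = "\<lambda>n. \<Union>p\<in>F. G p n" and R = R])
    show "(\<Union>p\<in>F. G p n) \<in> events" for n using F(1) by (intro sets.finite_UN) auto
    show "(\<lambda>n. real n ^ m * prob (\<Union>p\<in>F. G p n)) \<longlonglongrightarrow> 0" for m
    proof (rule Lim_null_comparison)
      show "(\<lambda>n. \<Sum>p\<in>F. real n ^ m * prob (G p n)) \<longlonglongrightarrow> 0"
        by (intro tendsto_null_sum G0)
      show "\<forall>\<^sub>F n in sequentially. norm (real n ^ m * prob (\<Union>p\<in>F. G p n)) \<le> (\<Sum>p\<in>F. real n ^ m * prob (G p n))"
      proof (intro always_eventually allI)
        fix n
        have "prob (\<Union>p\<in>F. G p n) \<le> (\<Sum>p\<in>F. prob (G p n))"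
          using F(1) by (intro finite_measure_subadditive_finite) auto
        thus "norm (real n ^ m * prob (\<Union>p\<in>F. G p n)) \<le> (\<Sum>p\<in>F. real n ^ m * prob (G p n))"
          by (simp add: mult_left_mono flip: sum_distrib_left)
      qed
    qed
    fix n :: nat assume n: "n \<ge> 1"
    show "AE \<omega> in M. \<omega> \<in> A n \<longrightarrow> R < norm (g (S n \<omega>)) \<longrightarrow> \<omega> \<in> (\<Union>p\<in>F. G p n)"
      using AE_all_h_in_C
    proof eventually_elim
      case (elim \<omega>)
      have SC: "S n \<omega> \<in> C" by (rule S_in_C[OF elim n])
      have fg: "f (g (S n \<omega>)) = S n \<omega>" by (rule f_g[OF subsetD[OF C_subset SC]])
      show ?case
      proof (intro impI)
        assume "\<omega> \<in> A n" and far: "R < norm (g (S n \<omega>))"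
        hence "\<omega> \<in> space M" by (simp add: A_def)
        from R[OF g_C[OF SC] far] obtain p where "p \<in> F" "fst p \<bullet> S n \<omega> < snd p" unfolding fg by auto
        thus "\<omega> \<in> (\<Union>p\<in>F. G p n)" using \<open>\<omega> \<in> space M\<close> by (auto simp: G_def)
      qed
    qed
  qed
qed

text \<open>The function k = (1 + |h|)^q is square-integrable at \<open>X 1\<close>: for q = 1
  directly, otherwise because the lower growth bound, squared, is dominated by the moment of order 2
  (1 + \<epsilon> / 2) = 2 + \<epsilon> of a single \<open>g (S N)\<close>. Jensen's inequality then
  bounds |g (S n)| by a constant times the average of the k (X j), to which the estimate on rare
  events applies.\<close>

lemma negligible_if_power_growth:
  assumes q: "1 \<le> q" and upper: "\<And>w. w \<in> C \<Longrightarrow> norm (g w) \<le> a * (1 + norm w) powr q"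
    and lower: "q = 1 \<or> (\<forall>w\<in>C. (1 + norm w) powr q \<le> a * (1 + norm (g w)) powr (1 + \<epsilon> / 2))"
  shows "(\<lambda>n. real n * (\<integral>\<omega>. indicator (A n) \<omega> * (norm (g (S n \<omega>)))\<^sup>2 \<partial>M)) \<longlonglongrightarrow> 0"
proof -
  define k where "k x = (1 + norm (h x)) powr q" for x
  have [measurable]: "k \<in> borel_measurable borel" unfolding k_def by measurable
  have k2: "integrable M (\<lambda>\<omega>. (k (X 1 \<omega>))\<^sup>2)"
    using lower
  proof
    assume "q = 1"
    hence "(k x)\<^sup>2 = (1 + norm (h x))\<^sup>2" for x by (simp add: k_def add_nonneg_nonneg)
    moreover have "(1 + y)\<^sup>2 \<le> 2 + 2 * y\<^sup>2" for y :: real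
      using zero_le_power2[of "1 - y"] by (simp add: power2_eq_square algebra_simps)
    ultimately have le: "(k x)\<^sup>2 \<le> 2 + 2 * (norm (h x))\<^sup>2" for x by simp
    show ?thesis
    proof (rule Bochner_Integration.integrable_bound)
      show "integrable M (\<lambda>\<omega>. 2 + 2 * (norm (h (X 1 \<omega>)))\<^sup>2)" using square_integrable_h by simp
      show "AE \<omega> in M. norm ((k (X 1 \<omega>))\<^sup>2) \<le> norm (2 + 2 * (norm (h (X 1 \<omega>)))\<^sup>2)"
        using le by (intro AE_I2) (simp add: order_trans[OF _ abs_ge_self])
    qed measurable
  next
    assume low: "\<forall>w\<in>C. (1 + norm w) powr q \<le> a * (1 + norm (g w)) powr (1 + \<epsilon> / 2)"
    obtain N where N: "N \<ge> 1" "integrable M (\<lambda>\<omega>. norm (g (S N \<omega>)) powr (2 + \<epsilon>))" by (rule moment_index)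
    show ?thesis
    proof (rule integrable_from_mean[OF _ _ N])
      show "\<exists>c\<ge>0. \<forall>\<omega>. S N \<omega> \<in> C \<longrightarrow> (\<forall>j\<in>{2..N}. norm (h (X j \<omega>)) \<le> b) \<longrightarrow>
          (k (X 1 \<omega>))\<^sup>2 \<le> c * (1 + norm (g (S N \<omega>)) powr (2 + \<epsilon>))" for b
      proof (intro exI conjI allI impI)
        define P where "P = 1 + real N + real N * \<bar>b\<bar>"
        have P: "P \<ge> 1" by (simp add: P_def)
        fix \<omega> assume SC: "S N \<omega> \<in> C" and small: "\<forall>j\<in>{2..N}. norm (h (X j \<omega>)) \<le> b"
        define s where "s = norm (S N \<omega>)"
        have "1 + norm (h (X 1 \<omega>)) \<le> 1 + (real N * s + real N * \<bar>b\<bar>)"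
          using norm_first_le(1)[OF N(1), of \<omega> b] small by (simp add: s_def)
        also have "\<dots> \<le> P * (1 + s)"
        proof -
          have "0 \<le> s + real N * \<bar>b\<bar> * s" by (simp add: s_def)
          thus ?thesis by (simp add: P_def algebra_simps)
        qed
        finally have "k (X 1 \<omega>) \<le> (P * (1 + s)) powr q" unfolding k_def using q by (intro powr_mono2) auto
        also have "\<dots> = P powr q * (1 + s) powr q" using P by (simp add: powr_mult s_def)
        also have "\<dots> \<le> P powr q * (a * (1 + norm (g (S N \<omega>))) powr (1 + \<epsilon> / 2))"
          using low SC unfolding s_def by (intro mult_left_mono) auto
        finally have "(k (X 1 \<omega>))\<^sup>2 \<le> (P powr q * (a * (1 + norm (g (S N \<omega>))) powr (1 + \<epsilon> / 2)))\<^sup>2"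
          by (intro power_mono) (auto simp: k_def)
        also have "\<dots> = (P powr q * a)\<^sup>2 * ((1 + norm (g (S N \<omega>))) powr (1 + \<epsilon> / 2))\<^sup>2"
          by (simp add: power_mult_distrib)
        also have "((1 + norm (g (S N \<omega>))) powr (1 + \<epsilon> / 2))\<^sup>2 = (1 + norm (g (S N \<omega>))) powr (2 + \<epsilon>)"
          by (simp add: power2_eq_square flip: powr_add)
        also have "(P powr q * a)\<^sup>2 * (1 + norm (g (S N \<omega>))) powr (2 + \<epsilon>)
            \<le> (P powr q * a)\<^sup>2 * (2 powr (2 + \<epsilon>) * (1 + norm (g (S N \<omega>)) powr (2 + \<epsilon>)))"
          using \<epsilon> by (intro mult_left_mono one_plus_powr_le) auto
        finally show "(k (X 1 \<omega>))\<^sup>2 \<le> ((1 + real N + real N * \<bar>b\<bar>) powr q * a)\<^sup>2 * 2 powr (2 + \<epsilon>) * (1 + norm (g (S N \<omega>)) powr (2 + \<epsilon>))"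
          by (simp add: P_def mult.assoc)
      qed simp
    qed auto
  qed
  note rare = mean_square_on_rare_events[OF _ k2 events_A n_prob_A]
  have "(\<lambda>n. a\<^sup>2 * (real n * (\<integral>\<omega>. indicator (A n) \<omega> * ((\<Sum>j=1..n. k (X j \<omega>)) / real n)\<^sup>2 \<partial>M))) \<longlonglongrightarrow> 0"
    by (intro tendsto_mult_right_zero rare(1)) simp
  thus ?thesis
  proof (rule Lim_null_comparison[rotated])
    show "\<forall>\<^sub>F n in sequentially. norm (real n * (\<integral>\<omega>. indicator (A n) \<omega> * (norm (g (S n \<omega>)))\<^sup>2 \<partial>M))
        \<le> a\<^sup>2 * (real n * (\<integral>\<omega>. indicator (A n) \<omega> * ((\<Sum>j=1..n. k (X j \<omega>)) / real n)\<^sup>2 \<partial>M))"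
      using eventually_integrable_g_S eventually_ge_at_top[of 1]
    proof eventually_elim
      case (elim n)
      have intk: "integrable M (\<lambda>\<omega>. ((\<Sum>j=1..n. k (X j \<omega>)) / real n)\<^sup>2)" using elim by (intro rare(2)) auto
      have "(\<integral>\<omega>. indicator (A n) \<omega> * (norm (g (S n \<omega>)))\<^sup>2 \<partial>M)
          \<le> (\<integral>\<omega>. a\<^sup>2 * (indicator (A n) \<omega> * ((\<Sum>j=1..n. k (X j \<omega>)) / real n)\<^sup>2) \<partial>M)"
      proof (rule integral_mono_AE)
        show "integrable M (\<lambda>\<omega>. indicator (A n) \<omega> * (norm (g (S n \<omega>)))\<^sup>2)"
          by (rule integrable_indicator_times[OF elim(1) events_A])
        show "integrable M (\<lambda>\<omega>. a\<^sup>2 * (indicator (A n) \<omega> * ((\<Sum>j=1..n. k (X j \<omega>)) / real n)\<^sup>2))"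
          by (rule integrable_mult_right[OF integrable_indicator_times[OF intk events_A]])
        show "AE \<omega> in M. indicator (A n) \<omega> * (norm (g (S n \<omega>)))\<^sup>2 \<le> a\<^sup>2 * (indicator (A n) \<omega> * ((\<Sum>j=1..n. k (X j \<omega>)) / real n)\<^sup>2)"
          using AE_all_h_in_C
        proof eventually_elim
          case *: (elim \<omega>)
          have SC: "S n \<omega> \<in> C" by (rule S_in_C[OF * elim(2)])
          define s where "s = (\<Sum>j=1..n. norm (h (X j \<omega>))) / real n"
          have nS: "norm (S n \<omega>) \<le> s"
            unfolding S_def s_def norm_divide using elim(2) by (simp add: divide_right_mono norm_sum)
          have "(1 + norm (S n \<omega>)) powr q \<le> (1 + s) powr q" using nS q by (intro powr_mono2) auto
          also have "\<dots> \<le> (\<Sum>j=1..n. k (X j \<omega>)) / real n"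
            using convex_on_one_plus_powr[OF q, of "{1..n}" "\<lambda>j. norm (h (X j \<omega>))"] elim(2) by (simp add: k_def s_def)
          finally have j: "(1 + norm (S n \<omega>)) powr q \<le> (\<Sum>j=1..n. k (X j \<omega>)) / real n" .
          have "norm (g (S n \<omega>)) \<le> \<bar>a\<bar> * ((\<Sum>j=1..n. k (X j \<omega>)) / real n)"
          proof (rule order_trans[OF upper[OF SC]])
            have "a * (1 + norm (S n \<omega>)) powr q \<le> \<bar>a\<bar> * (1 + norm (S n \<omega>)) powr q" by (intro mult_right_mono) auto
            also have "\<dots> \<le> \<bar>a\<bar> * ((\<Sum>j=1..n. k (X j \<omega>)) / real n)" by (intro mult_left_mono j) auto
            finally show "a * (1 + norm (S n \<omega>)) powr q \<le> \<bar>a\<bar> * ((\<Sum>j=1..n. k (X j \<omega>)) / real n)" .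
          qed
          hence "(norm (g (S n \<omega>)))\<^sup>2 \<le> (\<bar>a\<bar> * ((\<Sum>j=1..n. k (X j \<omega>)) / real n))\<^sup>2" by (intro power_mono) auto
          also have "\<dots> = a\<^sup>2 * ((\<Sum>j=1..n. k (X j \<omega>)) / real n)\<^sup>2" unfolding power_mult_distrib power2_abs ..
          finally have "(norm (g (S n \<omega>)))\<^sup>2 \<le> a\<^sup>2 * ((\<Sum>j=1..n. k (X j \<omega>)) / real n)\<^sup>2" .
          thus ?case by (cases "\<omega> \<in> A n") simp_all
        qed
      qed
      hence "real n * (\<integral>\<omega>. indicator (A n) \<omega> * (norm (g (S n \<omega>)))\<^sup>2 \<partial>M)
          \<le> real n * (a\<^sup>2 * (\<integral>\<omega>. indicator (A n) \<omega> * ((\<Sum>j=1..n. k (X j \<omega>)) / real n)\<^sup>2 \<partial>M))"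
        by (intro mult_left_mono) simp_all
      moreover have "0 \<le> (\<integral>\<omega>. indicator (A n) \<omega> * (norm (g (S n \<omega>)))\<^sup>2 \<partial>M)" by (intro integral_nonneg_AE) auto
      ultimately show ?case by (simp only: real_norm_def abs_of_nonneg mult_nonneg_nonneg of_nat_0_le_iff mult.left_commute[of "a\<^sup>2"])
    qed
  qed
qed

text \<open>All moments of |h (X 1)| turn out to be finite, so the deviation event
  \<open>A n\<close> is itself superpolynomially rare and serves as \<open>E n\<close>, with R =
  0.\<close>

lemma negligible_if_superpolynomial_growth:
  assumes growth: "\<And>s::real. s > 0 \<Longrightarrow> \<exists>a. \<forall>w\<in>C. norm w powr s \<le> a * (1 + norm (g w))"
  shows "(\<lambda>n. real n * (\<integral>\<omega>. indicator (A n) \<omega> * (norm (g (S n \<omega>)))\<^sup>2 \<partial>M)) \<longlonglongrightarrow> 0"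
proof -
  obtain N where N: "N \<ge> 1" "integrable M (\<lambda>\<omega>. norm (g (S N \<omega>)) powr (2 + \<epsilon>))" by (rule moment_index)
  have mom: "integrable M (\<lambda>\<omega>. norm (h (X 1 \<omega>)) ^ k)" for k :: nat
  proof (cases "k = 0")
    case False
    obtain a where a: "\<And>w. w \<in> C \<Longrightarrow> norm w powr real k \<le> a * (1 + norm (g w))" using growth[of "real k"] False by auto
    show ?thesis
    proof (rule integrable_from_mean[OF _ _ N])
      show "\<exists>c\<ge>0. \<forall>\<omega>. S N \<omega> \<in> C \<longrightarrow> (\<forall>j\<in>{2..N}. norm (h (X j \<omega>)) \<le> b) \<longrightarrow>
          norm (h (X 1 \<omega>)) ^ k \<le> c * (1 + norm (g (S N \<omega>)) powr (2 + \<epsilon>))" for b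
      proof (intro exI conjI allI impI)
        define P where "P = real N + real N * \<bar>b\<bar>"
        have P: "P > 0" using N by (simp add: P_def add_pos_nonneg)
        fix \<omega> assume SC: "S N \<omega> \<in> C" and small: "\<forall>j\<in>{2..N}. norm (h (X j \<omega>)) \<le> b"
        define s where "s = norm (S N \<omega>)"
        define y where "y = norm (g (S N \<omega>)) powr (2 + \<epsilon>)"
        have y: "0 \<le> y" "norm (g (S N \<omega>)) \<le> 1 + y"
          using powr_le_one_plus(1)[OF norm_ge_zero, of "g (S N \<omega>)"] by (simp_all add: y_def)
        have "norm (h (X 1 \<omega>)) \<le> real N * s + real N * \<bar>b\<bar>"
          using norm_first_le(1)[OF N(1), of \<omega> b] small by (simp add: s_def)
        also have "\<dots> \<le> P * (1 + s)"
        proof -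
          have "0 \<le> real N * \<bar>b\<bar> * s" "0 \<le> real N" by (simp_all add: s_def)
          thus ?thesis by (simp add: P_def algebra_simps)
        qed
        finally have "norm (h (X 1 \<omega>)) ^ k \<le> (P * (1 + s)) ^ k" by (intro power_mono) auto
        also have "\<dots> = P ^ k * (1 + s) powr real k" by (simp add: power_mult_distrib powr_realpow s_def add_pos_nonneg)
        also have "\<dots> \<le> P ^ k * (2 powr real k * (1 + s powr real k))"
          using P by (intro mult_left_mono one_plus_powr_le) (auto simp: s_def)
        also have "\<dots> \<le> P ^ k * (2 powr real k * ((1 + 2 * \<bar>a\<bar>) * (1 + y)))"
        proof (intro mult_left_mono)
          have "s powr real k \<le> a * (1 + norm (g (S N \<omega>)))" unfolding s_def by (rule a[OF SC])
          also have "\<dots> \<le> \<bar>a\<bar> * (1 + norm (g (S N \<omega>)))" by (intro mult_right_mono) auto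
          also have "\<dots> \<le> \<bar>a\<bar> * (2 * (1 + y))" using y by (intro mult_left_mono) auto
          finally show "1 + s powr real k \<le> (1 + 2 * \<bar>a\<bar>) * (1 + y)" using y(1) by (simp add: algebra_simps)
        qed (use P in auto)
        finally show "norm (h (X 1 \<omega>)) ^ k \<le> ((real N + real N * \<bar>b\<bar>) ^ k * (2 powr real k * (1 + 2 * \<bar>a\<bar>))) * (1 + norm (g (S N \<omega>)) powr (2 + \<epsilon>))"
          by (simp add: P_def y_def mult.assoc)
      qed simp
    qed auto
  qed simp
  show ?thesis
  proof (rule negligible_if_far_values_rare[where E = A and R = 0])
    show "(\<lambda>n. real n ^ m * prob (A n)) \<longlonglongrightarrow> 0" for m
      unfolding A_def S_def \<mu>_def by (rule norm_deviation_superpolynomial[OF measurable_h mom \<delta>])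
  qed auto
qed

text \<open>\<open>S N\<close> carries \<open>h (X 1)\<close> with weight 1 / N, so the exponential
  moment obtained is that of Re (\<kappa> h) / N; it still dominates every power of the positive
  part. Unless Re (\<kappa> S n) exceeds its mean by at least 1, the upper growth bound keeps |g (S
  n)| below the constant \<open>R\<close>.\<close>

lemma negligible_if_exponential_growth:
  assumes upper: "\<And>w. w \<in> C \<Longrightarrow> norm (g w) \<le> a * (1 + exp (Re (\<kappa> * w)))"
    and lower: "\<And>w. w \<in> C \<Longrightarrow> exp (Re (\<kappa> * w)) \<le> a * (1 + norm (g w))"
  shows "(\<lambda>n. real n * (\<integral>\<omega>. indicator (A n) \<omega> * (norm (g (S n \<omega>)))\<^sup>2 \<partial>M)) \<longlonglongrightarrow> 0"
proof -
  obtain N where N: "N \<ge> 1" "integrable M (\<lambda>\<omega>. norm (g (S N \<omega>)) powr (2 + \<epsilon>))" by (rule moment_index)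
  have exp_int: "integrable M (\<lambda>\<omega>. exp (Re (\<kappa> * h (X 1 \<omega>)) / real N))"
  proof (rule integrable_from_mean[OF _ _ N])
    show "\<exists>c\<ge>0. \<forall>\<omega>. S N \<omega> \<in> C \<longrightarrow> (\<forall>j\<in>{2..N}. norm (h (X j \<omega>)) \<le> b) \<longrightarrow>
        exp (Re (\<kappa> * h (X 1 \<omega>)) / real N) \<le> c * (1 + norm (g (S N \<omega>)) powr (2 + \<epsilon>))" for b
    proof (intro exI conjI allI impI)
      fix \<omega> assume SC: "S N \<omega> \<in> C" and small: "\<forall>j\<in>{2..N}. norm (h (X j \<omega>)) \<le> b"
      define y where "y = norm (g (S N \<omega>)) powr (2 + \<epsilon>)"
      have y: "0 \<le> y" "norm (g (S N \<omega>)) \<le> 1 + y"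
        using powr_le_one_plus(1)[OF norm_ge_zero, of "g (S N \<omega>)"] by (simp_all add: y_def)
      have "exp (Re (\<kappa> * h (X 1 \<omega>)) / real N) \<le> exp (Re (\<kappa> * S N \<omega>) + norm \<kappa> * \<bar>b\<bar>)"
        using norm_first_le(2)[OF N(1), of \<omega> b \<kappa>] small by simp
      also have "\<dots> = exp (norm \<kappa> * \<bar>b\<bar>) * exp (Re (\<kappa> * S N \<omega>))" by (simp only: exp_add mult.commute)
      also have "\<dots> \<le> exp (norm \<kappa> * \<bar>b\<bar>) * (\<bar>a\<bar> * (2 * (1 + y)))"
      proof (intro mult_left_mono)
        have "exp (Re (\<kappa> * S N \<omega>)) \<le> a * (1 + norm (g (S N \<omega>)))" by (rule lower[OF SC])
        also have "\<dots> \<le> \<bar>a\<bar> * (1 + norm (g (S N \<omega>)))" by (intro mult_right_mono) auto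
        also have "\<dots> \<le> \<bar>a\<bar> * (2 * (1 + y))" using y by (intro mult_left_mono) auto
        finally show "exp (Re (\<kappa> * S N \<omega>)) \<le> \<bar>a\<bar> * (2 * (1 + y))" .
      qed simp
      finally show "exp (Re (\<kappa> * h (X 1 \<omega>)) / real N) \<le> (exp (norm \<kappa> * \<bar>b\<bar>) * \<bar>a\<bar> * 2) * (1 + norm (g (S N \<omega>)) powr (2 + \<epsilon>))"
        by (simp add: y_def mult.assoc)
    qed simp
  qed auto
  have pos: "integrable M (\<lambda>\<omega>. (max 0 (Re (\<kappa> * h (X 1 \<omega>)))) ^ k)" for k :: nat
  proof (rule Bochner_Integration.integrable_bound)
    \<comment> \<open>The summand \<open>0 ^ k\<close> is for k = 0 at negative values, where the
      power of the positive part is 1 but the exponential is smaller.\<close>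
    show "integrable M (\<lambda>\<omega>. (real N ^ k * fact k) * exp (Re (\<kappa> * h (X 1 \<omega>)) / real N) + 0 ^ k)" using exp_int by simp
    show "AE \<omega> in M. norm ((max 0 (Re (\<kappa> * h (X 1 \<omega>)))) ^ k) \<le> norm ((real N ^ k * fact k) * exp (Re (\<kappa> * h (X 1 \<omega>)) / real N) + 0 ^ k)"
    proof (rule AE_I2)
      fix \<omega>
      define x where "x = Re (\<kappa> * h (X 1 \<omega>))"
      have "(max 0 x) ^ k \<le> (real N ^ k * fact k) * exp (x / real N) + 0 ^ k"
      proof (cases "x \<ge> 0")
        case True
        have "x ^ k = real N ^ k * (x / real N) ^ k" using N by (simp add: power_divide)
        also have "\<dots> \<le> real N ^ k * (fact k * exp (x / real N))"
          using True by (intro mult_left_mono power_le_fact_exp) auto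
        finally have "(max 0 x) ^ k \<le> (real N ^ k * fact k) * exp (x / real N)" using True by (simp add: mult.assoc)
        moreover have "(0::real) \<le> 0 ^ k" by simp
        ultimately show ?thesis by linarith
      next
        case False thus ?thesis by simp
      qed
      thus "norm ((max 0 (Re (\<kappa> * h (X 1 \<omega>)))) ^ k) \<le> norm ((real N ^ k * fact k) * exp (Re (\<kappa> * h (X 1 \<omega>)) / real N) + 0 ^ k)"
        unfolding x_def[symmetric] by simp
    qed
  qed measurable
  define E where "E n = {\<omega>\<in>space M. Re (\<kappa> * S n \<omega>) \<ge> Re (\<kappa> * \<mu>) + 1}" for n
  have [measurable]: "E n \<in> events" for n unfolding E_def by measurable
  define R where "R = \<bar>a\<bar> * (1 + exp (Re (\<kappa> * \<mu>) + 1))"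
  show ?thesis
  proof (rule negligible_if_far_values_rare[where E = E and R = R])
    show "(\<lambda>n. real n ^ m * prob (E n)) \<longlonglongrightarrow> 0" for m
      unfolding E_def S_def \<mu>_def
      by (rule directional_deviation_superpolynomial[OF measurable_h integrable_h pos]) simp
    fix n :: nat assume n: "n \<ge> 1"
    show "AE \<omega> in M. \<omega> \<in> A n \<longrightarrow> R < norm (g (S n \<omega>)) \<longrightarrow> \<omega> \<in> E n"
      using AE_all_h_in_C
    proof eventually_elim
      case (elim \<omega>)
      have SC: "S n \<omega> \<in> C" by (rule S_in_C[OF elim n])
      show ?case
      proof (intro impI, rule ccontr)
        assume "\<omega> \<in> A n" and far: "R < norm (g (S n \<omega>))" and "\<omega> \<notin> E n"
        hence "Re (\<kappa> * S n \<omega>) < Re (\<kappa> * \<mu>) + 1" by (simp add: A_def E_def del: times_complex.sel)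
        hence e: "exp (Re (\<kappa> * S n \<omega>)) \<le> exp (Re (\<kappa> * \<mu>) + 1)" by (simp del: times_complex.sel)
        have "norm (g (S n \<omega>)) \<le> a * (1 + exp (Re (\<kappa> * S n \<omega>)))" by (rule upper[OF SC])
        also have "\<dots> \<le> \<bar>a\<bar> * (1 + exp (Re (\<kappa> * S n \<omega>)))" by (intro mult_right_mono) (auto intro: add_nonneg_nonneg)
        also have "\<dots> \<le> R" unfolding R_def using e by (intro mult_left_mono) auto
        finally show False using far by simp
      qed
    qed
  qed auto
qed

lemma far_second_moment_negligible:
  "(\<lambda>n. real n * (\<integral>\<omega>. indicator (A n) \<omega> * (norm (g (S n \<omega>)))\<^sup>2 \<partial>M)) \<longlonglongrightarrow> 0"
proof (cases "\<exists>R0. \<forall>z\<in>K. R0 < norm z \<longrightarrow> norm (f z) \<le> R0")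
  case True
  then obtain R0 where "\<forall>z\<in>K. R0 < norm z \<longrightarrow> norm (f z) \<le> R0" ..
  thus ?thesis by (intro negligible_if_bounded_near_infinity[of R0]) simp
next
  case False
  hence unb: "\<exists>z\<in>K. R < norm z \<and> R < norm (f z)" for R by (simp add: not_le)
  \<comment> \<open>With \<eta> = \<epsilon> / 2 the squared lower growth bound has exponent exactly
    2 + \<epsilon>.\<close>
  have "\<epsilon> / 2 > 0" using \<epsilon> by simp
  from inverse_growth[OF unb this] show ?thesis
  proof (elim disjE)
    assume "\<exists>a q. 1 \<le> q \<and> (\<forall>w\<in>C. norm (g w) \<le> a * (1 + norm w) powr q \<and>
      (q = 1 \<or> (1 + norm w) powr q \<le> a * (1 + norm (g w)) powr (1 + \<epsilon> / 2)))"
    then obtain a q where "1 \<le> q" "\<forall>w\<in>C. norm (g w) \<le> a * (1 + norm w) powr q \<and>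
      (q = 1 \<or> (1 + norm w) powr q \<le> a * (1 + norm (g w)) powr (1 + \<epsilon> / 2))" by metis
    thus ?thesis by (intro negligible_if_power_growth[of q a]) auto
  next
    assume "\<forall>s>0. \<exists>a. \<forall>w\<in>C. norm w powr s \<le> a * (1 + norm (g w))"
    thus ?thesis by (intro negligible_if_superpolynomial_growth) simp
  next
    assume "\<exists>a \<kappa>. \<forall>w\<in>C. norm (g w) \<le> a * (1 + exp (Re (\<kappa> * w))) \<and> exp (Re (\<kappa> * w)) \<le> a * (1 + norm (g w))"
    then obtain a \<kappa> where "\<forall>w\<in>C. norm (g w) \<le> a * (1 + exp (Re (\<kappa> * w))) \<and> exp (Re (\<kappa> * w)) \<le> a * (1 + norm (g w))" by metis
    thus ?thesis using negligible_if_exponential_growth[of a \<kappa>] by metis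
  qed
qed

end

end

end

section \<open>Linearization of the inverse and the variance limit\<close>

section \<open>The delta method\<close>

text \<open>Young's inequality with a free weight \<open>t\<close>: a small multiple of the main
  term is traded against a large multiple of the error.\<close>

lemma norm_add_sq_diff_le:
  fixes x y :: "'b::real_inner"
  assumes t: "t > 0"
  shows "\<bar>(norm (x + y))\<^sup>2 - (norm x)\<^sup>2\<bar> \<le> t * (norm x)\<^sup>2 + (1 + 1 / t) * (norm y)\<^sup>2"
proof -
  have "(norm (x + y))\<^sup>2 - (norm x)\<^sup>2 = 2 * (x \<bullet> y) + (norm y)\<^sup>2"
    by (simp add: power2_norm_eq_inner inner_add_left inner_add_right inner_commute)
  moreover have "\<bar>2 * (x \<bullet> y)\<bar> \<le> t * (norm x)\<^sup>2 + 1 / t * (norm y)\<^sup>2"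
  proof -
    have "0 \<le> (t * norm x - norm y)\<^sup>2 / t" using t by simp
    also have "\<dots> = t * (norm x)\<^sup>2 + 1 / t * (norm y)\<^sup>2 - 2 * (norm x * norm y)"
      using t by (simp add: power2_eq_square field_simps)
    finally show ?thesis using Cauchy_Schwarz_ineq2[of x y] by (simp add: abs_mult)
  qed
  moreover have "(1 + 1 / t) * (norm y)\<^sup>2 = (norm y)\<^sup>2 + 1 / t * (norm y)\<^sup>2" by (simp add: distrib_right)
  moreover have "0 \<le> (norm y)\<^sup>2" by simp
  ultimately show ?thesis by linarith
qed

lemma norm_sq_sum3_le:
  fixes x y z :: "'b::real_normed_vector"
  shows "(norm (x - y - z))\<^sup>2 \<le> 3 * ((norm x)\<^sup>2 + (norm y)\<^sup>2 + (norm z)\<^sup>2)"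
proof -
  have "norm (x - y - z) \<le> norm x + norm y + norm z"
    using norm_triangle_ineq4[of "x - y" z] norm_triangle_ineq4[of x y] by linarith
  hence "(norm (x - y - z))\<^sup>2 \<le> (norm x + norm y + norm z)\<^sup>2" by (intro power_mono) auto
  also have "\<dots> \<le> 3 * ((norm x)\<^sup>2 + (norm y)\<^sup>2 + (norm z)\<^sup>2)"
    using sum_squares_bound[of "norm x" "norm y"] sum_squares_bound[of "norm x" "norm z"] sum_squares_bound[of "norm y" "norm z"]
    by (simp add: power2_eq_square algebra_simps)
  finally show ?thesis .
qed

text \<open>Centring \<open>e\<close> does not increase its second moment, so the variance differs
  from the second moment of the centred linear part \<open>L\<close> by no more than Young's
  inequality allows.\<close>

lemma (in prob_space) complex_variance_linear_approximation:
  fixes L e :: "'a \<Rightarrow> complex"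
  assumes L: "integrable M L" "(\<integral>\<omega>. L \<omega> \<partial>M) = 0" "integrable M (\<lambda>\<omega>. (norm (L \<omega>))\<^sup>2)"
    and e: "integrable M e" "integrable M (\<lambda>\<omega>. (norm (e \<omega>))\<^sup>2)" and t: "t > 0"
  shows "\<bar>complex_variance M (\<lambda>\<omega>. c + L \<omega> + e \<omega>) - (\<integral>\<omega>. (norm (L \<omega>))\<^sup>2 \<partial>M)\<bar>
    \<le> t * (\<integral>\<omega>. (norm (L \<omega>))\<^sup>2 \<partial>M) + (1 + 1 / t) * (\<integral>\<omega>. (norm (e \<omega>))\<^sup>2 \<partial>M)"
proof -
  define m where "m = (\<integral>\<omega>. e \<omega> \<partial>M)"
  note [measurable] = borel_measurable_integrable[OF L(1)] borel_measurable_integrable[OF e(1)]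
  have eq: "(norm (e \<omega> - m))\<^sup>2 = (norm (e \<omega>))\<^sup>2 - 2 * (e \<omega> \<bullet> m) + (norm m)\<^sup>2" for \<omega>
    by (simp add: power2_norm_eq_inner inner_diff_left inner_diff_right inner_commute)
  have int': "integrable M (\<lambda>\<omega>. (norm (e \<omega> - m))\<^sup>2)" unfolding eq using e by simp
  have "(\<integral>\<omega>. (norm (e \<omega> - m))\<^sup>2 \<partial>M) = (\<integral>\<omega>. (norm (e \<omega>))\<^sup>2 \<partial>M) - (norm m)\<^sup>2"
    unfolding eq using e by (simp add: prob_space power2_norm_eq_inner flip: m_def)
  hence le: "(\<integral>\<omega>. (norm (e \<omega> - m))\<^sup>2 \<partial>M) \<le> (\<integral>\<omega>. (norm (e \<omega>))\<^sup>2 \<partial>M)" by simp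
  have pt: "\<bar>(norm (L \<omega> + (e \<omega> - m)))\<^sup>2 - (norm (L \<omega>))\<^sup>2\<bar> \<le> t * (norm (L \<omega>))\<^sup>2 + (1 + 1 / t) * (norm (e \<omega> - m))\<^sup>2" for \<omega>
    by (rule norm_add_sq_diff_le[OF t])
  have rhs: "integrable M (\<lambda>\<omega>. t * (norm (L \<omega>))\<^sup>2 + (1 + 1 / t) * (norm (e \<omega> - m))\<^sup>2)" using L(3) int' by simp
  have diff: "integrable M (\<lambda>\<omega>. (norm (L \<omega> + (e \<omega> - m)))\<^sup>2 - (norm (L \<omega>))\<^sup>2)"
    by (rule Bochner_Integration.integrable_bound[OF rhs]) (measurable, intro AE_I2, simp only: real_norm_def, rule order_trans[OF pt abs_ge_self])
  have "(\<integral>\<omega>. c + L \<omega> + e \<omega> \<partial>M) = c + m" using L e by (simp add: m_def prob_space)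
  hence "complex_variance M (\<lambda>\<omega>. c + L \<omega> + e \<omega>) = (\<integral>\<omega>. ((norm (L \<omega> + (e \<omega> - m)))\<^sup>2 - (norm (L \<omega>))\<^sup>2) + (norm (L \<omega>))\<^sup>2 \<partial>M)"
    by (simp add: complex_variance_def algebra_simps)
  also have "\<dots> = (\<integral>\<omega>. (norm (L \<omega> + (e \<omega> - m)))\<^sup>2 - (norm (L \<omega>))\<^sup>2 \<partial>M) + (\<integral>\<omega>. (norm (L \<omega>))\<^sup>2 \<partial>M)"
    by (rule Bochner_Integration.integral_add[OF diff L(3)])
  finally have "\<bar>complex_variance M (\<lambda>\<omega>. c + L \<omega> + e \<omega>) - (\<integral>\<omega>. (norm (L \<omega>))\<^sup>2 \<partial>M)\<bar>
      = \<bar>\<integral>\<omega>. (norm (L \<omega> + (e \<omega> - m)))\<^sup>2 - (norm (L \<omega>))\<^sup>2 \<partial>M\<bar>" by simp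
  also have "\<dots> \<le> (\<integral>\<omega>. \<bar>(norm (L \<omega> + (e \<omega> - m)))\<^sup>2 - (norm (L \<omega>))\<^sup>2\<bar> \<partial>M)" by (rule integral_abs_bound)
  also have "\<dots> \<le> (\<integral>\<omega>. t * (norm (L \<omega>))\<^sup>2 + (1 + 1 / t) * (norm (e \<omega> - m))\<^sup>2 \<partial>M)"
    by (rule integral_mono[OF integrable_abs[OF diff] rhs pt])
  also have "\<dots> = t * (\<integral>\<omega>. (norm (L \<omega>))\<^sup>2 \<partial>M) + (1 + 1 / t) * (\<integral>\<omega>. (norm (e \<omega> - m))\<^sup>2 \<partial>M)"
    using L(3) int' by simp
  also have "\<dots> \<le> t * (\<integral>\<omega>. (norm (L \<omega>))\<^sup>2 \<partial>M) + (1 + 1 / t) * (\<integral>\<omega>. (norm (e \<omega>))\<^sup>2 \<partial>M)"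
    using le t by (intro add_mono mult_left_mono order_refl) auto
  finally show ?thesis .
qed

context quasi_arithmetic
begin

definition linearization_error :: "nat \<Rightarrow> 'a \<Rightarrow> complex" where
  "linearization_error n \<omega> = g (S n \<omega>) - g \<mu> - deriv g \<mu> * (S n \<omega> - \<mu>)"

lemma measurable_linearization_error [measurable]: "linearization_error n \<in> borel_measurable M"
  unfolding linearization_error_def by measurable

lemma integrable_S_deviation:
  assumes "n \<ge> 1"
  shows "integrable M (\<lambda>\<omega>. (norm (S n \<omega> - \<mu>))\<^sup>2)"
    and "real n * (\<integral>\<omega>. (norm (S n \<omega> - \<mu>))\<^sup>2 \<partial>M) = complex_variance M (\<lambda>\<omega>. h (X 1 \<omega>))"
    and "integrable M (S n)" and "(\<integral>\<omega>. S n \<omega> \<partial>M) = \<mu>"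
  using integrable_mean_deviation[OF measurable_h square_integrable_h, of n] assms
  unfolding complex_variance_def S_def[abs_def] \<mu>_def by auto

context
  fixes \<epsilon> B :: real
  assumes \<epsilon>: "\<epsilon> > 0"
    and bdd: "\<forall>\<^sub>F n in sequentially. integrable M (\<lambda>\<omega>. norm (g (S n \<omega>)) powr (2 + \<epsilon>)) \<and>
      (\<integral>\<omega>. norm (g (S n \<omega>)) powr (2 + \<epsilon>) \<partial>M) \<le> B"
begin

lemma integrable_linearization_error:
  assumes "integrable M (\<lambda>\<omega>. (norm (g (S n \<omega>)))\<^sup>2)" "n \<ge> 1"
  shows "integrable M (\<lambda>\<omega>. (norm (linearization_error n \<omega>))\<^sup>2)" "integrable M (linearization_error n)"
proof -
  show sq: "integrable M (\<lambda>\<omega>. (norm (linearization_error n \<omega>))\<^sup>2)"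
  proof (rule Bochner_Integration.integrable_bound)
    show "integrable M (\<lambda>\<omega>. 3 * ((norm (g (S n \<omega>)))\<^sup>2 + (norm (g \<mu>))\<^sup>2 + (norm (deriv g \<mu>))\<^sup>2 * (norm (S n \<omega> - \<mu>))\<^sup>2))"
      using assms integrable_S_deviation(1)[OF assms(2)] by simp
    show "AE \<omega> in M. norm ((norm (linearization_error n \<omega>))\<^sup>2)
        \<le> norm (3 * ((norm (g (S n \<omega>)))\<^sup>2 + (norm (g \<mu>))\<^sup>2 + (norm (deriv g \<mu>))\<^sup>2 * (norm (S n \<omega> - \<mu>))\<^sup>2))"
    proof (rule AE_I2)
      fix \<omega>
      show "norm ((norm (linearization_error n \<omega>))\<^sup>2)
          \<le> norm (3 * ((norm (g (S n \<omega>)))\<^sup>2 + (norm (g \<mu>))\<^sup>2 + (norm (deriv g \<mu>))\<^sup>2 * (norm (S n \<omega> - \<mu>))\<^sup>2))"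
        using norm_sq_sum3_le[of "g (S n \<omega>)" "g \<mu>" "deriv g \<mu> * (S n \<omega> - \<mu>)"]
        unfolding linearization_error_def norm_mult power_mult_distrib by simp
    qed
  qed measurable
  have "integrable M (\<lambda>\<omega>. norm (linearization_error n \<omega>))"
    using square_integrable_imp_integrable[OF _ sq] by simp
  thus "integrable M (linearization_error n)" by (rule integrable_norm_cancel) measurable
qed

text \<open>Near \<open>\<mu>\<close> the error is at most \<tau> |S n - \<mu>|, and n E|S n -
  \<mu>|^2 is the constant \<open>V\<close>, so this part costs at most \<eta> / 2. Away from
  \<open>\<mu>\<close> the three terms of the error are estimated separately; \<open>Q\<close>
  collects them.\<close>

lemma linearization_error_negligible:
  "(\<lambda>n. real n * (\<integral>\<omega>. (norm (linearization_error n \<omega>))\<^sup>2 \<partial>M)) \<longlonglongrightarrow> 0"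
proof (rule tendstoI)
  fix \<eta> :: real assume \<eta>: "\<eta> > 0"
  define V where "V = complex_variance M (\<lambda>\<omega>. h (X 1 \<omega>))"
  have V: "V \<ge> 0" unfolding V_def complex_variance_def by (intro integral_nonneg_AE) auto
  \<comment> \<open>V + 1 instead of \<open>V\<close> covers a vanishing variance.\<close>
  define \<tau> where "\<tau> = sqrt (\<eta> / (2 * (V + 1)))"
  have \<tau>: "\<tau> > 0" using \<eta> V by (simp add: \<tau>_def)
  have "\<tau>\<^sup>2 * V \<le> \<eta> / 2"
  proof -
    have "\<tau>\<^sup>2 * V \<le> \<tau>\<^sup>2 * (V + 1)" by (intro mult_left_mono) auto
    also have "\<dots> = \<eta> / 2" using \<eta> V by (simp add: \<tau>_def field_simps)
    finally show ?thesis .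
  qed
  have "\<mu> \<in> f ` U" using \<mu>_in_C C_subset by auto
  hence "(g has_field_derivative deriv g \<mu>) (at \<mu>)" by (rule holomorphic_derivI[OF inverse_holomorphic open_image])
  hence "(g has_derivative (\<lambda>x. deriv g \<mu> * x)) (at \<mu>)" by (simp add: has_field_derivative_def)
  then obtain \<delta> where \<delta>: "\<delta> > 0" and lin: "\<And>w. norm (w - \<mu>) < \<delta> \<Longrightarrow>
      norm (g w - g \<mu> - deriv g \<mu> * (w - \<mu>)) \<le> \<tau> * norm (w - \<mu>)"
    using \<tau> unfolding has_derivative_at_alt by blast
  define A where "A n = {\<omega>\<in>space M. \<delta> \<le> norm (S n \<omega> - \<mu>)}" for n
  have [measurable]: "A n \<in> events" for n unfolding A_def by measurable
  define Q where "Q n = real n * (\<integral>\<omega>. indicator (A n) \<omega> * (norm (g (S n \<omega>)))\<^sup>2 \<partial>M)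
    + (norm (g \<mu>))\<^sup>2 * (real n * prob (A n))
    + (norm (deriv g \<mu>))\<^sup>2 * (real n * (\<integral>\<omega>. indicator (A n) \<omega> * (norm (S n \<omega> - \<mu>))\<^sup>2 \<partial>M))" for n
  have "Q \<longlonglongrightarrow> 0 + (norm (g \<mu>))\<^sup>2 * 0 + (norm (deriv g \<mu>))\<^sup>2 * 0"
    unfolding Q_def A_def
    by (intro tendsto_intros far_second_moment_negligible[OF \<epsilon> bdd \<delta>] n_prob_A[OF \<epsilon> bdd \<delta>] deviation_negligible[OF \<epsilon> bdd \<delta>])
  hence "Q \<longlonglongrightarrow> 0" by simp
  \<comment> \<open>One sixth, because the three-term inequality multiplies \<open>Q\<close> by 3
    and half of \<eta> is already spent near \<open>\<mu>\<close>.\<close>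
  hence "\<forall>\<^sub>F n in sequentially. Q n < \<eta> / 6" using \<eta> by (intro order_tendstoD) auto
  thus "\<forall>\<^sub>F n in sequentially. dist (real n * (\<integral>\<omega>. (norm (linearization_error n \<omega>))\<^sup>2 \<partial>M)) 0 < \<eta>"
    using eventually_integrable_g_S[OF \<epsilon> bdd] eventually_ge_at_top[of 1]
  proof eventually_elim
    case (elim n)
    note dev = integrable_S_deviation(1,2)[OF elim(3)]
    note int = integrable_indicator_times[OF elim(2), of "A n"] integrable_indicator_times[OF dev(1), of "A n"]
    define T where "T \<omega> = indicator (A n) \<omega> * (norm (g (S n \<omega>)))\<^sup>2 + (norm (g \<mu>))\<^sup>2 * indicator (A n) \<omega>
      + (norm (deriv g \<mu>))\<^sup>2 * (indicator (A n) \<omega> * (norm (S n \<omega> - \<mu>))\<^sup>2)" for \<omega>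
    have T: "integrable M T" unfolding T_def using int by (simp add: emeasure_eq_measure)
    have "(\<integral>\<omega>. (norm (linearization_error n \<omega>))\<^sup>2 \<partial>M) \<le> (\<integral>\<omega>. \<tau>\<^sup>2 * (norm (S n \<omega> - \<mu>))\<^sup>2 + 3 * T \<omega> \<partial>M)"
    proof (rule integral_mono)
      show "integrable M (\<lambda>\<omega>. (norm (linearization_error n \<omega>))\<^sup>2)"
        by (rule integrable_linearization_error[OF elim(2,3)])
      show "integrable M (\<lambda>\<omega>. \<tau>\<^sup>2 * (norm (S n \<omega> - \<mu>))\<^sup>2 + 3 * T \<omega>)" using dev(1) T by simp
      fix \<omega> assume \<omega>: "\<omega> \<in> space M"
      show "(norm (linearization_error n \<omega>))\<^sup>2 \<le> \<tau>\<^sup>2 * (norm (S n \<omega> - \<mu>))\<^sup>2 + 3 * T \<omega>"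
      proof (cases "\<omega> \<in> A n")
        case True
        have "(norm (linearization_error n \<omega>))\<^sup>2 \<le> 3 * T \<omega>"
          using norm_sq_sum3_le[of "g (S n \<omega>)" "g \<mu>" "deriv g \<mu> * (S n \<omega> - \<mu>)"] True
          unfolding linearization_error_def norm_mult power_mult_distrib T_def by simp
        thus ?thesis by (simp add: add_increasing)
      next
        case False
        hence "norm (linearization_error n \<omega>) \<le> \<tau> * norm (S n \<omega> - \<mu>)"
          using \<omega> unfolding linearization_error_def by (intro lin) (auto simp: A_def)
        hence "(norm (linearization_error n \<omega>))\<^sup>2 \<le> (\<tau> * norm (S n \<omega> - \<mu>))\<^sup>2" by (intro power_mono) auto
        thus ?thesis using False by (simp add: T_def power_mult_distrib)
      qed
    qed
    also have "\<dots> = \<tau>\<^sup>2 * (\<integral>\<omega>. (norm (S n \<omega> - \<mu>))\<^sup>2 \<partial>M) + 3 * (\<integral>\<omega>. T \<omega> \<partial>M)" using dev(1) T by simp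
    finally have "real n * (\<integral>\<omega>. (norm (linearization_error n \<omega>))\<^sup>2 \<partial>M)
        \<le> real n * (\<tau>\<^sup>2 * (\<integral>\<omega>. (norm (S n \<omega> - \<mu>))\<^sup>2 \<partial>M) + 3 * (\<integral>\<omega>. T \<omega> \<partial>M))" by (intro mult_left_mono) auto
    also have "\<dots> = \<tau>\<^sup>2 * V + 3 * (real n * (\<integral>\<omega>. T \<omega> \<partial>M))"
      unfolding V_def dev(2)[symmetric] by (simp add: algebra_simps)
    also have "real n * (\<integral>\<omega>. T \<omega> \<partial>M) = Q n"
    proof -
      have "(\<integral>\<omega>. T \<omega> \<partial>M) = (\<integral>\<omega>. indicator (A n) \<omega> * (norm (g (S n \<omega>)))\<^sup>2 \<partial>M) + (norm (g \<mu>))\<^sup>2 * prob (A n)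
          + (norm (deriv g \<mu>))\<^sup>2 * (\<integral>\<omega>. indicator (A n) \<omega> * (norm (S n \<omega> - \<mu>))\<^sup>2 \<partial>M)"
        unfolding T_def using int by (simp add: emeasure_eq_measure)
      thus ?thesis by (simp add: Q_def algebra_simps)
    qed
    finally have "real n * (\<integral>\<omega>. (norm (linearization_error n \<omega>))\<^sup>2 \<partial>M) < \<eta>"
      using elim(1) \<open>\<tau>\<^sup>2 * V \<le> \<eta> / 2\<close> by linarith
    moreover have "0 \<le> (\<integral>\<omega>. (norm (linearization_error n \<omega>))\<^sup>2 \<partial>M)" by (intro integral_nonneg_AE) auto
    ultimately show ?case by simp
  qed
qed

theorem variance_limit:
  "(\<lambda>n. real n * complex_variance M (\<lambda>\<omega>. g (S n \<omega>)))
    \<longlonglongrightarrow> complex_variance M (\<lambda>\<omega>. h (X 1 \<omega>)) / (norm (deriv f (g \<mu>)))\<^sup>2"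
proof (rule tendstoI)
  fix \<eta> :: real assume \<eta>: "\<eta> > 0"
  define V where "V = complex_variance M (\<lambda>\<omega>. h (X 1 \<omega>))"
  have V: "V \<ge> 0" unfolding V_def complex_variance_def by (intro integral_nonneg_AE) auto
  define W where "W = (norm (deriv g \<mu>))\<^sup>2 * V"
  have W: "W \<ge> 0" using V by (simp add: W_def)
  have "\<mu> \<in> f ` U" using \<mu>_in_C C_subset by auto
  \<comment> \<open>The relation f' g' = 1 turns the division by |f'|^2 into the factor |g'|^2 of
    the linear part and shows that the divisor is nonzero.\<close>
  hence "deriv f (g \<mu>) * deriv g \<mu> = 1" using deriv_g[of "g \<mu>"] f_g[of \<mu>] inv_into_into[of \<mu> f U] by simp
  hence "norm (deriv f (g \<mu>)) * norm (deriv g \<mu>) = 1" by (simp flip: norm_mult)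
  hence "(norm (deriv f (g \<mu>)))\<^sup>2 * (norm (deriv g \<mu>))\<^sup>2 = 1" by (simp flip: power_mult_distrib)
  hence eq: "V / (norm (deriv f (g \<mu>)))\<^sup>2 = W"
    unfolding W_def by (cases "deriv f (g \<mu>) = 0") (auto simp: field_simps)
  \<comment> \<open>Half of \<eta> pays for t W. Once \<open>t\<close> is fixed, 1 + 1 / t is a
    constant in front of a null sequence.\<close>
  define t where "t = \<eta> / (2 * (W + 1))"
  have t: "t > 0" using \<eta> W by (simp add: t_def)
  have tW: "t * W \<le> \<eta> / 2"
  proof -
    have "t * W \<le> t * (W + 1)" using t by (intro mult_left_mono) auto
    also have "\<dots> = \<eta> / 2" using W by (simp add: t_def field_simps)
    finally show ?thesis .
  qed
  have "(\<lambda>n. (1 + 1 / t) * (real n * (\<integral>\<omega>. (norm (linearization_error n \<omega>))\<^sup>2 \<partial>M))) \<longlonglongrightarrow> 0"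
    by (rule tendsto_mult_right_zero[OF linearization_error_negligible])
  hence "\<forall>\<^sub>F n in sequentially. (1 + 1 / t) * (real n * (\<integral>\<omega>. (norm (linearization_error n \<omega>))\<^sup>2 \<partial>M)) < \<eta> / 2"
    using \<eta> by (intro order_tendstoD) auto
  thus "\<forall>\<^sub>F n in sequentially. dist (real n * complex_variance M (\<lambda>\<omega>. g (S n \<omega>)))
      (complex_variance M (\<lambda>\<omega>. h (X 1 \<omega>)) / (norm (deriv f (g \<mu>)))\<^sup>2) < \<eta>"
    using eventually_integrable_g_S[OF \<epsilon> bdd] eventually_ge_at_top[of 1]
  proof eventually_elim
    case (elim n)
    note dev = integrable_S_deviation[OF elim(3)]
    define L where "L \<omega> = deriv g \<mu> * (S n \<omega> - \<mu>)" for \<omega>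
    define v where "v = complex_variance M (\<lambda>\<omega>. g (S n \<omega>))"
    define q where "q = (\<integral>\<omega>. (norm (linearization_error n \<omega>))\<^sup>2 \<partial>M)"
    have L: "integrable M L" "(\<integral>\<omega>. L \<omega> \<partial>M) = 0" "integrable M (\<lambda>\<omega>. (norm (L \<omega>))\<^sup>2)"
      unfolding L_def norm_mult power_mult_distrib using dev by (auto simp: prob_space)
    \<comment> \<open>For the linear part the limit is attained at every index n \<ge> 1, since the
      variance of the average is the variance of one summand divided by n.\<close>
    have "real n * (\<integral>\<omega>. (norm (L \<omega>))\<^sup>2 \<partial>M) = W"
      unfolding L_def norm_mult power_mult_distrib W_def V_def dev(2)[symmetric] by simp
    moreover have "\<bar>v - (\<integral>\<omega>. (norm (L \<omega>))\<^sup>2 \<partial>M)\<bar> \<le> t * (\<integral>\<omega>. (norm (L \<omega>))\<^sup>2 \<partial>M) + (1 + 1 / t) * q"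
      using complex_variance_linear_approximation[OF L integrable_linearization_error(2,1)[OF elim(2,3)] t, of "g \<mu>"]
      unfolding v_def q_def by (simp add: L_def linearization_error_def)
    hence "real n * \<bar>v - (\<integral>\<omega>. (norm (L \<omega>))\<^sup>2 \<partial>M)\<bar> \<le> real n * (t * (\<integral>\<omega>. (norm (L \<omega>))\<^sup>2 \<partial>M) + (1 + 1 / t) * q)"
      by (intro mult_left_mono) auto
    moreover have "real n * \<bar>v - x\<bar> = \<bar>real n * v - real n * x\<bar>"
      "real n * (t * x + (1 + 1 / t) * q) = t * (real n * x) + (1 + 1 / t) * (real n * q)" for x
      by (simp_all add: abs_mult distrib_left mult.left_commute flip: right_diff_distrib)
    ultimately have "\<bar>real n * v - W\<bar> \<le> t * W + (1 + 1 / t) * (real n * q)" by metis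
    also have "\<dots> < \<eta>" using tW elim(1) unfolding q_def by linarith
    finally show ?case unfolding v_def eq[unfolded V_def] dist_real_def .
  qed
qed

end

end

theorem theorem3p2:
  fixes M :: "'a measure" and X :: "nat \<Rightarrow> 'a \<Rightarrow> real"
    and f :: "complex \<Rightarrow> complex" and U :: "complex set"
    and \<alpha> :: complex and \<epsilon>\<^sub>0 :: real
  assumes "prob_space M"
    and "Im \<alpha> \<le> 0"
    and "open U" and "connected U" and "simply_connected U"
    and "closed_upper_half_plane - {\<alpha>} \<subseteq> U"
    and "f holomorphic_on U" and "inj_on f U"
    and "convex (f ` (closed_upper_half_plane - {\<alpha>}))"
    and "prob_space.indep_vars M (\<lambda>_. borel) X {1..}"
    and "\<And>j. j \<ge> 1 \<Longrightarrow> distr M borel (X j) = distr M borel (X 1)"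
    and "\<And>x. measure M {\<omega> \<in> space M. X 1 \<omega> = x} = 0"
    and "integrable M (\<lambda>\<omega>. (cmod (f (complex_of_real (X 1 \<omega>))))\<^sup>2)"
    and "(\<integral>\<omega>. f (complex_of_real (X 1 \<omega>)) \<partial>M) \<noteq> 0"
    and "\<epsilon>\<^sub>0 > 0"
    and "limsup (\<lambda>n. \<integral>\<^sup>+\<omega>. ennreal (cmod (quasi_arith_mean U f X n \<omega>) powr (2 + \<epsilon>\<^sub>0)) \<partial>M) < \<infinity>"
  shows "(\<lambda>n. real n * complex_variance M (quasi_arith_mean U f X n))
           \<longlonglongrightarrow> complex_variance M (\<lambda>\<omega>. f (complex_of_real (X 1 \<omega>)))
               / (cmod (deriv f (inv_into U f (\<integral>\<omega>. f (complex_of_real (X 1 \<omega>)) \<partial>M))))\<^sup>2"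
proof -
  interpret prob_space M by (rule assms(1))
  interpret quasi_arithmetic f U \<alpha> M X
    by (intro quasi_arithmetic.intro convex_half_plane_map.intro iid_sequence.intro
        iid_sequence_axioms.intro quasi_arithmetic_axioms.intro assms)
  have mean: "quasi_arith_mean U f X n = (\<lambda>\<omega>. g (S n \<omega>))" for n
    by (simp add: fun_eq_iff quasi_arith_mean_def S_def h_def)
  define I where "I n = (\<integral>\<^sup>+\<omega>. ennreal (norm (g (S n \<omega>)) powr (2 + \<epsilon>\<^sub>0)) \<partial>M)" for n
  \<comment> \<open>A finite number above the limsup bounds the moments from some index on; finitely
    many earlier ones may be infinite.\<close>
  obtain b where b: "limsup I < b" "b < \<infinity>"
    using assms(16) unfolding mean I_def[symmetric, abs_def] using dense by blast
  define B where "B = enn2real b"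
  have B: "b = ennreal B" "B \<ge> 0" using b(2) by (auto simp: B_def)
  have "\<forall>\<^sub>F n in sequentially. integrable M (\<lambda>\<omega>. norm (g (S n \<omega>)) powr (2 + \<epsilon>\<^sub>0)) \<and>
      (\<integral>\<omega>. norm (g (S n \<omega>)) powr (2 + \<epsilon>\<^sub>0) \<partial>M) \<le> B"
    using Limsup_lessD[OF b(1)]
  proof eventually_elim
    case (elim n)
    hence le: "I n \<le> ennreal B" using B by simp
    have int: "integrable M (\<lambda>\<omega>. norm (g (S n \<omega>)) powr (2 + \<epsilon>\<^sub>0))"
    proof (rule integrableI_bounded)
      show "(\<integral>\<^sup>+\<omega>. ennreal (norm (norm (g (S n \<omega>)) powr (2 + \<epsilon>\<^sub>0))) \<partial>M) < \<infinity>"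
        using le unfolding I_def by (simp add: order_le_less_trans[OF _ ennreal_less_top])
    qed measurable
    have "ennreal (\<integral>\<omega>. norm (g (S n \<omega>)) powr (2 + \<epsilon>\<^sub>0) \<partial>M) = I n"
      unfolding I_def by (rule nn_integral_eq_integral[symmetric, OF int]) simp
    hence "(\<integral>\<omega>. norm (g (S n \<omega>)) powr (2 + \<epsilon>\<^sub>0) \<partial>M) \<le> B" using le B(2) by (metis ennreal_le_iff)
    with int show ?case by blast
  qed
  from variance_limit[OF assms(15) this]
  show ?thesis unfolding mean unfolding h_def \<mu>_def .
qed

end
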